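(* Let $A$ be a separable recursive subhomogeneous algebra, and let $I$ be an ideal in $A$. Then $A/I$ is a recursive subhomogeneous algebra. Moreover, $A/I$ has a recursive subhomogeneous decomposition in which the topological dimension and maximum matrix size are no larger than for $A$.
   Context: Homomorphisms of C*-algebras are *-homomorphisms, ideals are closed and two-sided, and $M_n = M_n(\mathbf{C})$. Recursive subhomogeneous algebras. The class is defined recursively: (i) if $X$ is a compact Hausdorff space and $n \geq 1$, then $C(X, M_n)$ is a recursive subhomogeneous algebra; (ii) if $A$ is a recursive subhomogeneous algebra, $X$ is compact Hausdorff, $X^{(0)} \subset X$ is closed (possibly empty), $\varphi \colon A \to C(X^{(0)}, M_n)$ is any unital homomorphism and $\rho \colon C(X, M_n) \to C(X^{(0)}, M_n)$ is restriction, then the pullback $A \oplus_{C(X^{(0)}, M_n)} C(X, M_n) = \{(a,f) \in A \oplus C(X, M_n) : \varphi(a) = \rho(f)\}$ is a recursive subhomogeneous algebra. The zero algebra is also allowed. A recursive subhomogeneous decomposition of $R$ is an expression (isomorphism) of $R$ as such an iterated pullback: compact Hausdorff spaces $X_0, \dots, X_l$, positive integers $n(0), \dots, n(l)$, closed subsets $X_k^{(0)} \subset X_k$ ($1 \leq k \leq l$), $C_k = C(X_k, M_{n(k)})$, $C_k^{(0)} = C(X_k^{(0)}, M_{n(k)})$, with $R^{(0)} = C_0$, $R^{(k)} = R^{(k-1)} \oplus_{C_k^{(0)}} C_k$ formed using a unital homomorphism $R^{(k-1)} \to C_k^{(0)}$ and the restriction map $C_k \to C_k^{(0)}$, and $R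 = R^{(l)}$. Its maximum matrix size is $\max_k n(k)$, and its topological dimension is $\max_k \dim(X_k)$, where $\dim$ is covering dimension. Decompositions are not unique; a recursive subhomogeneous algebra is always assumed to come with a given decomposition, and its topological dimension and maximum matrix size are those of the given decomposition. *)

theory Defs
  imports
    "HOL-Analysis.Analysis"
    "HOL-Algebra.QuotRing"
    "HOL-Algebra.Module"
    "Jordan_Normal_Form.Schur_Decomposition"
begin

section \<open>Unital C*-algebras\<close>

text \<open>All C*-algebras below are unital (the zero algebra, where one equals zero, is included),
  so that they extend the rings of HOL-Algebra.\<close>

record 'a cstar = "(complex, 'a) module" +
  adj :: "'a \<Rightarrow> 'a"
  nrm :: "'a \<Rightarrow> real"

definition complex_ring :: "complex ring" where
  "complex_ring = \<lparr>carrier = UNIV, mult = (*), one = 1, zero = 0, add = (+)\<rparr>"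

text \<open>The value 0 off the carrier is a convention: the locale \<^locale>\<open>Metric_space\<close>
  demands symmetry and nonnegativity also there.\<close>

definition cstar_dist :: "('a, 'm) cstar_scheme \<Rightarrow> 'a \<Rightarrow> 'a \<Rightarrow> real" where
  "cstar_dist A x y =
     (if x \<in> carrier A \<and> y \<in> carrier A then nrm A (x \<ominus>\<^bsub>A\<^esub> y) else 0)"

definition cstar_topology :: "('a, 'm) cstar_scheme \<Rightarrow> 'a topology" where
  "cstar_topology A = Metric_space.mtopology (carrier A) (cstar_dist A)"

locale cstar_algebra = Module.module complex_ring A + ring A for A :: "('a, 'm) cstar_scheme" (structure) +
  assumes smult_mult_left:
      "\<lbrakk>x \<in> carrier A; y \<in> carrier A\<rbrakk> \<Longrightarrow> (c \<odot> x) \<otimes> y = c \<odot> (x \<otimes> y)"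
    and smult_mult_right:
      "\<lbrakk>x \<in> carrier A; y \<in> carrier A\<rbrakk> \<Longrightarrow> x \<otimes> (c \<odot> y) = c \<odot> (x \<otimes> y)"
    and adj_closed: "x \<in> carrier A \<Longrightarrow> adj A x \<in> carrier A"
    and adj_adj: "x \<in> carrier A \<Longrightarrow> adj A (adj A x) = x"
    and adj_add:
      "\<lbrakk>x \<in> carrier A; y \<in> carrier A\<rbrakk> \<Longrightarrow> adj A (x \<oplus> y) = adj A x \<oplus> adj A y"
    and adj_smult: "x \<in> carrier A \<Longrightarrow> adj A (c \<odot> x) = cnj c \<odot> adj A x"
    and adj_mult:
      "\<lbrakk>x \<in> carrier A; y \<in> carrier A\<rbrakk> \<Longrightarrow> adj A (x \<otimes> y) = adj A y \<otimes> adj A x"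
    and nrm_nonneg: "x \<in> carrier A \<Longrightarrow> 0 \<le> nrm A x"
    and nrm_eq_zero: "x \<in> carrier A \<Longrightarrow> nrm A x = 0 \<longleftrightarrow> x = \<zero>"
    and nrm_triangle:
      "\<lbrakk>x \<in> carrier A; y \<in> carrier A\<rbrakk> \<Longrightarrow> nrm A (x \<oplus> y) \<le> nrm A x + nrm A y"
    and nrm_smult: "x \<in> carrier A \<Longrightarrow> nrm A (c \<odot> x) = cmod c * nrm A x"
    and nrm_mult:
      "\<lbrakk>x \<in> carrier A; y \<in> carrier A\<rbrakk> \<Longrightarrow> nrm A (x \<otimes> y) \<le> nrm A x * nrm A y"
    and cstar_identity: "x \<in> carrier A \<Longrightarrow> nrm A (adj A x \<otimes> x) = (nrm A x)\<^sup>2"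
    and complete: "Metric_space.mcomplete (carrier A) (cstar_dist A)"

text \<open>Preservation of one is part of \<^const>\<open>Ring.ring_hom\<close>.\<close>

definition unital_star_hom ::
  "('a, 'm) cstar_scheme \<Rightarrow> ('b, 'n) cstar_scheme \<Rightarrow> ('a \<Rightarrow> 'b) set" where
  "unital_star_hom A B = {h \<in> Ring.ring_hom A B.
     (\<forall>c. \<forall>x\<in>carrier A. h (c \<odot>\<^bsub>A\<^esub> x) = c \<odot>\<^bsub>B\<^esub> h x) \<and>
     (\<forall>x\<in>carrier A. h (adj A x) = adj B (h x))}"

definition star_isomorphic :: "('a, 'm) cstar_scheme \<Rightarrow> ('b, 'n) cstar_scheme \<Rightarrow> bool" where
  "star_isomorphic A B \<longleftrightarrow>
     (\<exists>h \<in> unital_star_hom A B. bij_betw h (carrier A) (carrier B))"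

text \<open>A two-sided ring ideal of a unital algebra is a complex subspace, as
  c x = (c 1) x for every scalar c.\<close>

definition cstar_ideal :: "'a set \<Rightarrow> ('a, 'm) cstar_scheme \<Rightarrow> bool" where
  "cstar_ideal I A \<longleftrightarrow> ideal I A \<and> closedin (cstar_topology A) I"

definition cstar_quotient :: "('a, 'm) cstar_scheme \<Rightarrow> 'a set \<Rightarrow> 'a set cstar" where
  "cstar_quotient A I = \<lparr>
     carrier = carrier (A Quot I),
     mult = mult (A Quot I),
     one = one (A Quot I),
     zero = zero (A Quot I),
     add = add (A Quot I),
     smult = (\<lambda>c S. \<Union>x\<in>S. I +>\<^bsub>A\<^esub> (c \<odot>\<^bsub>A\<^esub> x)),
     adj = (\<lambda>S. \<Union>x\<in>S. I +>\<^bsub>A\<^esub> adj A x),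
     nrm = (\<lambda>S. INF x\<in>S. nrm A x)\<rparr>"


section \<open>Matrix-valued continuous functions\<close>

definition vec_l2norm :: "complex vec \<Rightarrow> real" where
  "vec_l2norm v = sqrt (Re (v \<bullet>c v))"

definition mat_opnorm :: "complex mat \<Rightarrow> real" where
  "mat_opnorm M =
     (SUP v \<in> {v \<in> carrier_vec (dim_col M). vec_l2norm v \<le> 1}. vec_l2norm (M *\<^sub>v v))"

text \<open>The topology of the n by n matrices is that of complex n*n-space, i.e. continuity is
  entrywise. Functions are extensional, so that equality of elements is equality on the space.
  In the norm, inserting 0 only matters for the empty space, where the algebra is zero.\<close>

definition cont_mat :: "'x topology \<Rightarrow> nat \<Rightarrow> ('x \<Rightarrow> complex mat) cstar" where
  "cont_mat X n = \<lparr>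
     carrier = {f \<in> topspace X \<rightarrow>\<^sub>E carrier_mat n n.
       \<forall>i<n. \<forall>j<n. continuous_map X euclidean (\<lambda>x. f x $$ (i, j))},
     mult = (\<lambda>f g. \<lambda>x\<in>topspace X. f x * g x),
     one = (\<lambda>x\<in>topspace X. 1\<^sub>m n),
     zero = (\<lambda>x\<in>topspace X. 0\<^sub>m n n),
     add = (\<lambda>f g. \<lambda>x\<in>topspace X. f x + g x),
     smult = (\<lambda>c f. \<lambda>x\<in>topspace X. c \<cdot>\<^sub>m f x),
     adj = (\<lambda>f. \<lambda>x\<in>topspace X. mat_adjoint (f x)),
     nrm = (\<lambda>f. Sup (insert 0 ((\<lambda>x. mat_opnorm (f x)) ` topspace X)))\<rparr>"


section \<open>Covering dimension\<close>

definition finite_open_cover :: "'x topology \<Rightarrow> 'x set set \<Rightarrow> bool" where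
  "finite_open_cover X \<U> \<longleftrightarrow> finite \<U> \<and> (\<forall>U\<in>\<U>. openin X U) \<and> \<Union>\<U> = topspace X"

text \<open>The covering dimension is at most m - 1 iff every finite open cover has a finite open
  refinement in which every point lies in at most m members. The empty space (and only it) has
  dimension -1; the value is infinite if there is no such m.\<close>

definition covering_dim :: "'x topology \<Rightarrow> ereal" where
  "covering_dim X = (INF m \<in> {m::nat. \<forall>\<U>. finite_open_cover X \<U> \<longrightarrow>
       (\<exists>\<V>. finite_open_cover X \<V> \<and> (\<forall>V\<in>\<V>. \<exists>U\<in>\<U>. V \<subseteq> U) \<and>
            (\<forall>x\<in>topspace X. card {V \<in> \<V>. x \<in> V} \<le> m))}. ereal (real m - 1))"


section \<open>Recursive subhomogeneous decompositions\<close>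

text \<open>For k up to \<open>len\<close>, \<open>base\<close> k and \<open>msize\<close> k are the k-th space and matrix size.
  For k from 1 to \<open>len\<close>, \<open>attach\<close> k is the closed subset of the k-th space, and \<open>glue\<close> k is
  the homomorphism from stage k - 1 to the functions on \<open>attach\<close> k. All spaces live in one
  carrier type, which is no restriction as there are finitely many of them.
  An element of stage k is the list of its k + 1 components.\<close>

record 'x rsh_data =
  len :: nat
  base :: "nat \<Rightarrow> 'x topology"
  msize :: "nat \<Rightarrow> nat"
  attach :: "nat \<Rightarrow> 'x set"
  glue :: "nat \<Rightarrow> ('x \<Rightarrow> complex mat) list \<Rightarrow> ('x \<Rightarrow> complex mat)"

definition level_alg :: "'x rsh_data \<Rightarrow> nat \<Rightarrow> ('x \<Rightarrow> complex mat) cstar" where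
  "level_alg D k = cont_mat (base D k) (msize D k)"

definition attach_alg :: "'x rsh_data \<Rightarrow> nat \<Rightarrow> ('x \<Rightarrow> complex mat) cstar" where
  "attach_alg D k = cont_mat (subtopology (base D k) (attach D k)) (msize D k)"

primrec stage_carrier :: "'x rsh_data \<Rightarrow> nat \<Rightarrow> ('x \<Rightarrow> complex mat) list set" where
  "stage_carrier D 0 = {[f] | f. f \<in> carrier (level_alg D 0)}"
| "stage_carrier D (Suc k) = {a @ [f] | a f.
     a \<in> stage_carrier D k \<and> f \<in> carrier (level_alg D (Suc k)) \<and>
     glue D (Suc k) a = restrict f (attach D (Suc k))}"

definition stage_alg :: "'x rsh_data \<Rightarrow> nat \<Rightarrow> ('x \<Rightarrow> complex mat) list cstar" where
  "stage_alg D k = \<lparr>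
     carrier = stage_carrier D k,
     mult = (\<lambda>a b. map (\<lambda>i. a ! i \<otimes>\<^bsub>level_alg D i\<^esub> b ! i) [0..<Suc k]),
     one = map (\<lambda>i. \<one>\<^bsub>level_alg D i\<^esub>) [0..<Suc k],
     zero = map (\<lambda>i. \<zero>\<^bsub>level_alg D i\<^esub>) [0..<Suc k],
     add = (\<lambda>a b. map (\<lambda>i. a ! i \<oplus>\<^bsub>level_alg D i\<^esub> b ! i) [0..<Suc k]),
     smult = (\<lambda>c a. map (\<lambda>i. c \<odot>\<^bsub>level_alg D i\<^esub> a ! i) [0..<Suc k]),
     adj = (\<lambda>a. map (\<lambda>i. adj (level_alg D i) (a ! i)) [0..<Suc k]),
     nrm = (\<lambda>a. MAX i\<in>{..k}. nrm (level_alg D i) (a ! i))\<rparr>"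

definition rsh_data_valid :: "'x rsh_data \<Rightarrow> bool" where
  "rsh_data_valid D \<longleftrightarrow>
     (\<forall>k\<le>len D. compact_space (base D k) \<and> Hausdorff_space (base D k) \<and> 1 \<le> msize D k) \<and>
     (\<forall>k<len D. closedin (base D (Suc k)) (attach D (Suc k)) \<and>
        glue D (Suc k) \<in> unital_star_hom (stage_alg D k) (attach_alg D (Suc k)))"

text \<open>A is a recursive subhomogeneous algebra with the decomposition D. The zero algebra is
  covered by D of length 0 with an empty space.\<close>

definition rsh_decomposition :: "'a cstar \<Rightarrow> 'x rsh_data \<Rightarrow> bool" where
  "rsh_decomposition A D \<longleftrightarrow>
     cstar_algebra A \<and> rsh_data_valid D \<and> star_isomorphic A (stage_alg D (len D))"

definition topological_dim :: "'x rsh_data \<Rightarrow> ereal" where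
  "topological_dim D = (MAX k\<in>{..len D}. covering_dim (base D k))"

definition max_matrix_size :: "'x rsh_data \<Rightarrow> nat" where
  "max_matrix_size D = (MAX k\<in>{..len D}. msize D k)"

end

theory Submission
  imports Defs
begin

text \<open>
  Write the algebra as an iterated pullback \<open>R\<close> inside the direct sum of the algebras
  \<open>C(X\<^sub>i, M(n\<^sub>i))\<close> of matrix-valued functions, and let \<open>Y\<^sub>i\<close> be the closed set of all points of \<open>X\<^sub>i\<close> at which the
  \<open>i\<close>-th components of all elements of the ideal vanish. Restricting the \<open>i\<close>-th component to \<open>Y\<^sub>i\<close>
  for every \<open>i\<close> maps \<open>R\<close> onto an iterated pullback of the same shape: its spaces are the \<open>Y\<^sub>i\<close>, its
  attaching sets are the intersections of the old ones with the \<open>Y\<^sub>i\<close>, and the matrix sizes are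
  the old ones. Covering dimension does not increase on closed subspaces
  (\<open>covering_dim_closed_subspace\<close>). Three points remain.

  The kernel of the restriction is the ideal. The main tool is \<open>ideal_approximation\<close>: an element
  that vanishes on all \<open>Y\<^sub>i\<close> is a norm limit of elements of the ideal. By induction on the number of
  levels the lower components may be assumed to be approximated. The error in the last
  component is then small on the attaching set, where the lower components determine it, and on the
  last \<open>Y\<^sub>i\<close>, so it is close to a function supported away from both. Such a function lies in the
  ideal (\<open>supported_in_ideal\<close>): the pullback contains all matrix-valued functions that vanish on
  the attaching set, so products with matrix units turn a nonzero entry into a scalar function, and
  finitely many of these scalar functions have no common zero on the compact support.

  The gluing maps descend to the quotient (\<open>glue_vanishes\<close>). This follows from the approximation,
  because the gluing maps are continuous.

  The restriction is onto (\<open>restr_stage\<close>). The components of a preimage are found level by level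
  with the Tietze theorem, and a radial retraction keeps their norms below the given norm. Hence
  the norm of the quotient is the norm of the new pullback, which is how the quotient is seen to
  be a C*-algebra (\<open>cstar_quotient_by_kernel\<close>).

  The analytic input from the theory of C*-algebras is that unital *-homomorphisms are
  contractive (\<open>star_hom_contractive\<close>). It makes the gluing maps continuous, which also gives the
  completeness of pullbacks, and it makes the isomorphism between the given algebra and \<open>R\<close>
  isometric, so that a set closed in one norm is closed in the other.
\<close>

section \<open>Unital C*-algebras\<close>

lemma complex_ring_simps [simp]:
  "carrier complex_ring = UNIV" "mult complex_ring = (*)" "add complex_ring = (+)"
  "one complex_ring = 1" "zero complex_ring = 0"
  by (simp_all add: complex_ring_def)

lemma cring_complex_ring: "cring complex_ring"
proof (rule cringI)
  show "abelian_group complex_ring"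
  proof (rule abelian_groupI)
    fix x :: complex
    show "\<exists>y\<in>carrier complex_ring. y \<oplus>\<^bsub>complex_ring\<^esub> x = \<zero>\<^bsub>complex_ring\<^esub>"
      by (rule bexI [of _ "- x"]) auto
  qed auto
  show "comm_monoid complex_ring"
    by (rule comm_monoidI) auto
qed (auto simp: algebra_simps)

lemma complex_ring_minus [simp]: "\<ominus>\<^bsub>complex_ring\<^esub> c = - c"
proof -
  interpret cring complex_ring by (rule cring_complex_ring)
  show ?thesis
    by (rule minus_equality) auto
qed

lemma cstar_metric:
  fixes A :: "('a, 'm) cstar_scheme" (structure)
  assumes "abelian_group A"
    and nn: "\<And>x. x \<in> carrier A \<Longrightarrow> 0 \<le> nrm A x"
    and z: "\<And>x. x \<in> carrier A \<Longrightarrow> nrm A x = 0 \<longleftrightarrow> x = \<zero>"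
    and tri: "\<And>x y. \<lbrakk>x \<in> carrier A; y \<in> carrier A\<rbrakk> \<Longrightarrow> nrm A (x \<oplus> y) \<le> nrm A x + nrm A y"
    and neg: "\<And>x. x \<in> carrier A \<Longrightarrow> nrm A (\<ominus> x) = nrm A x"
  shows "Metric_space (carrier A) (cstar_dist A)"
proof -
  interpret abelian_group A by fact
  show ?thesis
  proof
    fix x y
    show "0 \<le> cstar_dist A x y" by (simp add: cstar_dist_def nn)
    show "cstar_dist A x y = cstar_dist A y x"
    proof (cases "x \<in> carrier A \<and> y \<in> carrier A")
      case True
      then have "y \<ominus> x = \<ominus> (x \<ominus> y)"
        by (simp add: a_minus_def minus_add a_comm)
      then show ?thesis using True by (simp add: cstar_dist_def neg)
    qed (auto simp: cstar_dist_def)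
  next
    fix x y assume xy: "x \<in> carrier A" "y \<in> carrier A"
    then show "cstar_dist A x y = 0 \<longleftrightarrow> x = y"
      by (simp add: cstar_dist_def z)
    fix w assume w: "w \<in> carrier A"
    have "x \<ominus> w = (x \<ominus> y) \<oplus> (y \<ominus> w)"
      using xy w by (simp add: a_minus_def a_assoc r_neg1)
    then show "cstar_dist A x w \<le> cstar_dist A x y + cstar_dist A y w"
      using xy w tri [of "x \<ominus> y" "y \<ominus> w"] by (simp add: cstar_dist_def)
  qed
qed

text \<open>In this form completeness can be checked before the distance is known to be a metric.\<close>

lemma cstar_algebraI:
  fixes A :: "('a, 'm) cstar_scheme" (structure)
  assumes "ring A"
    and sm: "\<And>c x. x \<in> carrier A \<Longrightarrow> c \<odot> x \<in> carrier A"
      "\<And>a b x. x \<in> carrier A \<Longrightarrow> (a + b) \<odot> x = a \<odot> x \<oplus> b \<odot> x"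
      "\<And>c x y. \<lbrakk>x \<in> carrier A; y \<in> carrier A\<rbrakk> \<Longrightarrow> c \<odot> (x \<oplus> y) = c \<odot> x \<oplus> c \<odot> y"
      "\<And>a b x. x \<in> carrier A \<Longrightarrow> (a * b) \<odot> x = a \<odot> (b \<odot> x)"
      "\<And>x. x \<in> carrier A \<Longrightarrow> 1 \<odot> x = x"
    and ax: "\<And>c x y. \<lbrakk>x \<in> carrier A; y \<in> carrier A\<rbrakk> \<Longrightarrow> (c \<odot> x) \<otimes> y = c \<odot> (x \<otimes> y)"
      "\<And>c x y. \<lbrakk>x \<in> carrier A; y \<in> carrier A\<rbrakk> \<Longrightarrow> x \<otimes> (c \<odot> y) = c \<odot> (x \<otimes> y)"
      "\<And>x. x \<in> carrier A \<Longrightarrow> adj A x \<in> carrier A"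
      "\<And>x. x \<in> carrier A \<Longrightarrow> adj A (adj A x) = x"
      "\<And>x y. \<lbrakk>x \<in> carrier A; y \<in> carrier A\<rbrakk> \<Longrightarrow> adj A (x \<oplus> y) = adj A x \<oplus> adj A y"
      "\<And>c x. x \<in> carrier A \<Longrightarrow> adj A (c \<odot> x) = cnj c \<odot> adj A x"
      "\<And>x y. \<lbrakk>x \<in> carrier A; y \<in> carrier A\<rbrakk> \<Longrightarrow> adj A (x \<otimes> y) = adj A y \<otimes> adj A x"
    and n: "\<And>x. x \<in> carrier A \<Longrightarrow> 0 \<le> nrm A x"
      "\<And>x. x \<in> carrier A \<Longrightarrow> nrm A x = 0 \<longleftrightarrow> x = \<zero>"
      "\<And>x y. \<lbrakk>x \<in> carrier A; y \<in> carrier A\<rbrakk> \<Longrightarrow> nrm A (x \<oplus> y) \<le> nrm A x + nrm A y"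
      "\<And>c x. x \<in> carrier A \<Longrightarrow> nrm A (c \<odot> x) = cmod c * nrm A x"
      "\<And>x y. \<lbrakk>x \<in> carrier A; y \<in> carrier A\<rbrakk> \<Longrightarrow> nrm A (x \<otimes> y) \<le> nrm A x * nrm A y"
      "\<And>x. x \<in> carrier A \<Longrightarrow> nrm A (adj A x \<otimes> x) = (nrm A x)\<^sup>2"
    and compl: "\<And>\<sigma> :: nat \<Rightarrow> 'a. \<lbrakk>\<And>i. \<sigma> i \<in> carrier A;
        \<And>e. e > 0 \<Longrightarrow> \<exists>N. \<forall>i\<ge>N. \<forall>j\<ge>N. nrm A (\<sigma> i \<ominus> \<sigma> j) < e\<rbrakk>
        \<Longrightarrow> \<exists>l\<in>carrier A. \<forall>e>0. \<exists>N. \<forall>i\<ge>N. nrm A (\<sigma> i \<ominus> l) < e"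
  shows "cstar_algebra A"
proof -
  interpret ring A by fact
  have ag: "abelian_group A" by unfold_locales
  interpret Module.module complex_ring A
    by (rule moduleI) (simp_all add: cring_complex_ring sm ag)
  have minus: "\<ominus> x = (-1) \<odot> x" if "x \<in> carrier A" for x
    using smult_l_minus [of 1 x] that sm(5) by simp
  interpret Metric_space "carrier A" "cstar_dist A"
    by (rule cstar_metric) (simp_all add: ag n(1-4) minus)
  have mc: "mcomplete"
    unfolding mcomplete_def
  proof (intro allI impI)
    fix \<sigma> assume \<sigma>: "MCauchy \<sigma>"
    then have c: "\<sigma> i \<in> carrier A" for i by (auto simp: MCauchy_def)
    have "\<exists>l\<in>carrier A. \<forall>e>0. \<exists>N. \<forall>i\<ge>N. nrm A (\<sigma> i \<ominus> l) < e"
    proof (rule compl)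
      show "\<exists>N. \<forall>i\<ge>N. \<forall>j\<ge>N. nrm A (\<sigma> i \<ominus> \<sigma> j) < e" if "e > 0" for e
        using \<sigma> that c unfolding MCauchy_def cstar_dist_def by simp
    qed (rule c)
    then obtain l where "l \<in> carrier A" "\<forall>e>0. \<exists>N. \<forall>i\<ge>N. nrm A (\<sigma> i \<ominus> l) < e" ..
    then show "\<exists>x. limitin mtopology \<sigma> x sequentially"
      using c by (intro exI [of _ l]) (simp add: limit_metric_sequentially cstar_dist_def)
  qed
  show ?thesis
    by intro_locales (rule cstar_algebra_axioms.intro, (fact ax n mc)+)
qed

context cstar_algebra
begin

lemma scalar_closed [simp, intro]: "x \<in> carrier A \<Longrightarrow> c \<odot> x \<in> carrier A"
  using smult_closed by simp

lemma minus_eq_smult: "x \<in> carrier A \<Longrightarrow> \<ominus> x = (-1) \<odot> x"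
  using smult_l_minus [of 1 x] smult_one [of x] by simp

lemma smult_add_left: "x \<in> carrier A \<Longrightarrow> (a + b) \<odot> x = a \<odot> x \<oplus> b \<odot> x"
  using smult_l_distr by simp

lemma smult_add_right:
  "\<lbrakk>x \<in> carrier A; y \<in> carrier A\<rbrakk> \<Longrightarrow> c \<odot> (x \<oplus> y) = c \<odot> x \<oplus> c \<odot> y"
  using smult_r_distr by simp

lemma smult_smult: "x \<in> carrier A \<Longrightarrow> a \<odot> (b \<odot> x) = (a * b) \<odot> x"
  using smult_assoc1 by simp

lemma smult_1 [simp]: "x \<in> carrier A \<Longrightarrow> 1 \<odot> x = x"
  using smult_one by simp

declare adj_closed [simp, intro] adj_adj [simp]

lemma nrm_minus [simp]: "x \<in> carrier A \<Longrightarrow> nrm A (\<ominus> x) = nrm A x"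
  by (simp add: minus_eq_smult nrm_smult)

lemma adj_minus: "x \<in> carrier A \<Longrightarrow> adj A (\<ominus> x) = \<ominus> adj A x"
  by (simp add: minus_eq_smult adj_smult)

lemma adj_diff: "\<lbrakk>x \<in> carrier A; y \<in> carrier A\<rbrakk> \<Longrightarrow> adj A (x \<ominus> y) = adj A x \<ominus> adj A y"
  by (simp add: a_minus_def adj_add adj_minus)

lemma adj_one [simp]: "adj A \<one> = \<one>"
  by (metis adj_adj adj_closed adj_mult l_one one_closed r_one)

lemma nrm_zero [simp]: "nrm A \<zero> = 0"
  using nrm_eq_zero by blast

sublocale metric: Metric_space "carrier A" "cstar_dist A"
proof (rule cstar_metric)
  show "abelian_group A" by unfold_locales
qed (auto simp: nrm_nonneg nrm_eq_zero nrm_triangle)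

lemma nrm_diff_commute: "\<lbrakk>x \<in> carrier A; y \<in> carrier A\<rbrakk> \<Longrightarrow> nrm A (x \<ominus> y) = nrm A (y \<ominus> x)"
  using metric.commute [of x y] by (simp add: cstar_dist_def)

lemma nrm_diff_triangle:
  "\<lbrakk>x \<in> carrier A; y \<in> carrier A; z \<in> carrier A\<rbrakk>
    \<Longrightarrow> nrm A (x \<ominus> z) \<le> nrm A (x \<ominus> y) + nrm A (y \<ominus> z)"
  using metric.triangle [of x y z] by (simp add: cstar_dist_def)

lemma nrm_le_diff_add:
  assumes "x \<in> carrier A" "y \<in> carrier A"
  shows "nrm A x \<le> nrm A (x \<ominus> y) + nrm A y"
  using nrm_diff_triangle [of x y \<zero>] assms by (simp add: a_minus_def)

lemma nrm_adj: "x \<in> carrier A \<Longrightarrow> nrm A (adj A x) = nrm A x"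
proof -
  have *: "nrm A y \<le> nrm A (adj A y)" if y: "y \<in> carrier A" for y
  proof (cases "nrm A y = 0")
    case False
    have "nrm A y * nrm A y \<le> nrm A (adj A y) * nrm A y"
      using cstar_identity [OF y] nrm_mult [of "adj A y" y] y by (simp add: power2_eq_square)
    then show ?thesis
      using False nrm_nonneg [OF y] by simp
  qed (simp add: nrm_nonneg y)
  assume "x \<in> carrier A"
  then show ?thesis using * [of x] * [of "adj A x"] by simp
qed

text \<open>Equality may fail, as \<open>\<one>\<close> has norm zero in the zero algebra.\<close>

lemma nrm_unitary_le_one:
  assumes u: "u \<in> carrier A" and "adj A u \<otimes> u = \<one>"
  shows "nrm A u \<le> 1"
proof -
  have one: "nrm A \<one> = (nrm A \<one>)\<^sup>2"
    using cstar_identity [of \<one>] by simp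
  have "nrm A \<one> \<le> 1"
    using one by (cases "nrm A \<one> = 0") (auto simp: power2_eq_square)
  then have "(nrm A u)\<^sup>2 \<le> 1\<^sup>2"
    using cstar_identity [OF u] assms by simp
  then show ?thesis
    using power2_le_imp_le zero_le_one by blast
qed

lemma eq_zero_if_nrm_le:
  assumes x: "x \<in> carrier A" and le: "\<And>e. e > 0 \<Longrightarrow> nrm A x \<le> C * e"
  shows "x = \<zero>"
proof -
  have "nrm A x \<le> 0"
  proof (rule ccontr)
    assume neg: "\<not> ?thesis"
    define e where "e = nrm A x / (2 * (\<bar>C\<bar> + 1))"
    have "e > 0" using neg by (simp add: e_def)
    then have "nrm A x \<le> C * e" by (rule le)
    also have "\<dots> \<le> (\<bar>C\<bar> + 1) * e" using \<open>e > 0\<close> by (intro mult_right_mono) auto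
    also have "\<dots> = nrm A x / 2" by (simp add: e_def field_simps)
    finally show False using neg by simp
  qed
  then show ?thesis using nrm_eq_zero nrm_nonneg x by force
qed

lemma Cauchy_converges:
  fixes \<sigma> :: "nat \<Rightarrow> 'a"
  assumes \<sigma>: "\<And>n. \<sigma> n \<in> carrier A"
    and Cau: "\<And>e. e > 0 \<Longrightarrow> \<exists>N. \<forall>m\<ge>N. \<forall>n\<ge>N. nrm A (\<sigma> m \<ominus> \<sigma> n) < e"
  obtains l where "l \<in> carrier A" "\<And>e. e > 0 \<Longrightarrow> \<exists>N. \<forall>n\<ge>N. nrm A (\<sigma> n \<ominus> l) < e"
proof -
  have "metric.MCauchy \<sigma>"
    unfolding metric.MCauchy_def
  proof (intro conjI allI impI)
    show "range \<sigma> \<subseteq> carrier A" using \<sigma> by auto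
    fix e :: real assume "e > 0"
    then obtain N where "\<forall>m\<ge>N. \<forall>n\<ge>N. nrm A (\<sigma> m \<ominus> \<sigma> n) < e" using Cau by blast
    then show "\<exists>N. \<forall>n n'. N \<le> n \<longrightarrow> N \<le> n' \<longrightarrow> cstar_dist A (\<sigma> n) (\<sigma> n') < e"
      using \<sigma> by (intro exI [of _ N]) (simp add: cstar_dist_def)
  qed
  then obtain l where l: "limitin metric.mtopology \<sigma> l sequentially"
    using complete unfolding metric.mcomplete_def by blast
  show thesis
  proof (rule that [of l])
    show "l \<in> carrier A" using l by (simp add: metric.limit_metric_sequentially)
    fix e :: real assume "e > 0"
    with l show "\<exists>N. \<forall>n\<ge>N. nrm A (\<sigma> n \<ominus> l) < e"
      using \<sigma> by (auto simp: metric.limit_metric_sequentially cstar_dist_def)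
  qed
qed

lemma closed_if_approximated:
  assumes I: "closedin (cstar_topology A) I" and x: "x \<in> carrier A"
    and approx: "\<And>e. e > 0 \<Longrightarrow> \<exists>y\<in>I. nrm A (x \<ominus> y) < e"
  shows "x \<in> I"
proof (rule ccontr)
  assume "x \<notin> I"
  have I': "closedin metric.mtopology I" using I by (simp add: cstar_topology_def)
  then have sub: "I \<subseteq> carrier A" and "\<forall>x. x \<in> carrier A - I \<longrightarrow> (\<exists>r>0. disjnt I (metric.mball x r))"
    by (auto simp: metric.closedin_metric)
  then obtain r where "r > 0" and r: "disjnt I (metric.mball x r)"
    using \<open>x \<notin> I\<close> x by blast
  then obtain y where "y \<in> I" "nrm A (x \<ominus> y) < r" using approx by blast
  then have "y \<in> metric.mball x r" using sub x by (auto simp: cstar_dist_def)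
  then show False using r \<open>y \<in> I\<close> by (auto simp: disjnt_def)
qed


text \<open>\<open>s = 1 - t\<close> where \<open>t\<close> solves \<open>t = (x\<^sup>2 + t\<^sup>2) / 2\<close>. The right-hand side is a
  contraction of the complete set of all selfadjoint \<open>t\<close> of norm at most \<open>\<parallel>x\<parallel>\<close> that commute
  with \<open>x\<close>.\<close>

lemma ex_sqrt_one_minus_square:
  assumes x: "x \<in> carrier A" "adj A x = x" "nrm A x < 1"
  obtains s where "s \<in> carrier A" "adj A s = s" "s \<otimes> x = x \<otimes> s" "s \<otimes> s = \<one> \<ominus> x \<otimes> x"
proof -
  define q where "q = nrm A x"
  have q: "0 \<le> q" "q < 1" using x nrm_nonneg by (auto simp: q_def)
  define B where "B = {t \<in> carrier A. adj A t = t \<and> t \<otimes> x = x \<otimes> t \<and> nrm A t \<le> q}"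
  define T where "T t = (1/2) \<odot> (x \<otimes> x \<oplus> t \<otimes> t)" for t
  have B_sub: "B \<subseteq> carrier A" by (auto simp: B_def)
  interpret Submetric "carrier A" "cstar_dist A" B
    by unfold_locales (rule B_sub)
  have "sub.mcomplete"
  proof (rule sequentially_closedin_mcomplete_imp_mcomplete)
    show "metric.mcomplete" by (rule complete)
    fix \<sigma> l assume "range \<sigma> \<subseteq> B \<and> limitin metric.mtopology \<sigma> l sequentially"
    then have \<sigma>: "\<And>i. \<sigma> i \<in> B" and l: "l \<in> carrier A"
      and lim: "\<And>e. e > 0 \<Longrightarrow> \<exists>i. nrm A (\<sigma> i \<ominus> l) < e"
      unfolding metric.limit_metric_sequentially
      by (auto simp: cstar_dist_def) (metis order_refl)
    have \<sigma>': "\<And>i. \<sigma> i \<in> carrier A" using \<sigma> B_sub by auto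
    have "adj A l \<ominus> l = \<zero>"
    proof (rule eq_zero_if_nrm_le)
      fix e :: real assume "e > 0"
      then obtain i where i: "nrm A (\<sigma> i \<ominus> l) < e" using lim by blast
      have "nrm A (adj A l \<ominus> l) \<le> nrm A (adj A l \<ominus> \<sigma> i) + nrm A (\<sigma> i \<ominus> l)"
        using l \<sigma>' by (intro nrm_diff_triangle) auto
      also have "adj A l \<ominus> \<sigma> i = adj A (l \<ominus> \<sigma> i)"
        using \<sigma> [of i] l by (simp add: B_def adj_diff)
      also have "nrm A \<dots> = nrm A (\<sigma> i \<ominus> l)"
        using l \<sigma>' by (simp add: nrm_adj nrm_diff_commute)
      finally show "nrm A (adj A l \<ominus> l) \<le> 2 * e" using i by simp
    qed (simp add: l)
    then have adj: "adj A l = l" using l by simp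
    have "l \<otimes> x \<ominus> x \<otimes> l = \<zero>"
    proof (rule eq_zero_if_nrm_le)
      fix e :: real assume "e > 0"
      then obtain i where i: "nrm A (\<sigma> i \<ominus> l) < e" using lim by blast
      have "l \<otimes> x \<ominus> x \<otimes> l = (l \<ominus> \<sigma> i) \<otimes> x \<oplus> x \<otimes> (\<sigma> i \<ominus> l)"
        using \<sigma> [of i] l x by (simp add: B_def a_minus_def l_distr r_distr l_minus r_minus a_assoc r_neg1)
      also have "nrm A \<dots> \<le> nrm A ((l \<ominus> \<sigma> i) \<otimes> x) + nrm A (x \<otimes> (\<sigma> i \<ominus> l))"
        using l x \<sigma>' by (intro nrm_triangle) auto
      also have "\<dots> \<le> nrm A (l \<ominus> \<sigma> i) * q + q * nrm A (\<sigma> i \<ominus> l)"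
        unfolding q_def using l x \<sigma>' by (intro add_mono nrm_mult) auto
      also have "\<dots> = (2 * q) * nrm A (\<sigma> i \<ominus> l)"
        using nrm_diff_commute [of l "\<sigma> i"] l \<sigma>' by simp
      also have "\<dots> \<le> (2 * q) * e" using q i by (intro mult_left_mono) auto
      finally show "nrm A (l \<otimes> x \<ominus> x \<otimes> l) \<le> (2 * q) * e" .
    qed (simp add: l x)
    then have comm: "l \<otimes> x = x \<otimes> l" using l x by simp
    have "nrm A l \<le> q"
    proof (rule field_le_epsilon)
      fix e :: real assume "e > 0"
      then obtain i where i: "nrm A (\<sigma> i \<ominus> l) < e" using lim by blast
      have "nrm A (l \<ominus> \<zero>) \<le> nrm A (l \<ominus> \<sigma> i) + nrm A (\<sigma> i \<ominus> \<zero>)"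
        using l \<sigma>' by (intro nrm_diff_triangle) auto
      then show "nrm A l \<le> q + e"
        using i \<sigma> [of i] l nrm_diff_commute [of l "\<sigma> i"] by (simp add: B_def a_minus_def)
    qed
    with adj comm l show "l \<in> B" by (simp add: B_def)
  qed
  moreover have "B \<noteq> {}"
    using q x by (auto simp: B_def intro!: exI [of _ x] simp: q_def)
  moreover have "T \<in> B \<rightarrow> B"
  proof
    fix t assume t: "t \<in> B"
    then have t': "t \<in> carrier A" "adj A t = t" "t \<otimes> x = x \<otimes> t" "nrm A t \<le> q"
      by (auto simp: B_def)
    have comm: "(t \<otimes> t) \<otimes> x = x \<otimes> (t \<otimes> t)"
      using t' x by (metis m_assoc)
    have le: "nrm A (y \<otimes> y) \<le> q" if "y \<in> carrier A" "nrm A y \<le> q" for y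
    proof -
      have "nrm A (y \<otimes> y) \<le> nrm A y * nrm A y" using that by (intro nrm_mult)
      also have "\<dots> \<le> q * 1" using that q by (intro mult_mono) (auto simp: nrm_nonneg)
      finally show ?thesis by simp
    qed
    have "nrm A (x \<otimes> x \<oplus> t \<otimes> t) \<le> nrm A (x \<otimes> x) + nrm A (t \<otimes> t)"
      using t' x by (intro nrm_triangle) auto
    also have "\<dots> \<le> q + q" using le [of x] le [of t] t' x by (simp add: q_def)
    finally have "nrm A (T t) \<le> q" using t' x by (simp add: T_def nrm_smult)
    then show "T t \<in> B"
      using t' x comm
      by (simp add: B_def T_def adj_smult adj_add adj_mult smult_mult_left smult_mult_right
          l_distr r_distr m_assoc)
  qed
  moreover have "cstar_dist A (T s) (T t) \<le> q * cstar_dist A s t" if st: "s \<in> B" "t \<in> B" for s t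
  proof -
    have c: "s \<in> carrier A" "t \<in> carrier A" "nrm A s \<le> q" "nrm A t \<le> q"
      using st by (auto simp: B_def)
    have "T s \<ominus> T t = (1/2) \<odot> (s \<otimes> (s \<ominus> t) \<oplus> (s \<ominus> t) \<otimes> t)"
    proof -
      have "T s \<ominus> T t = (1/2) \<odot> ((x \<otimes> x \<oplus> s \<otimes> s) \<ominus> (x \<otimes> x \<oplus> t \<otimes> t))"
        using c x by (simp add: T_def a_minus_def smult_add_right minus_eq_smult smult_smult)
      also have "(x \<otimes> x \<oplus> s \<otimes> s) \<ominus> (x \<otimes> x \<oplus> t \<otimes> t) = s \<otimes> s \<ominus> t \<otimes> t"
        using c x by algebra
      also have "s \<otimes> s \<ominus> t \<otimes> t = s \<otimes> (s \<ominus> t) \<oplus> (s \<ominus> t) \<otimes> t"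
        using c by (simp add: a_minus_def l_distr r_distr l_minus r_minus a_assoc r_neg1)
      finally show ?thesis .
    qed
    then have "nrm A (T s \<ominus> T t) = nrm A (s \<otimes> (s \<ominus> t) \<oplus> (s \<ominus> t) \<otimes> t) / 2"
      using c by (simp add: nrm_smult)
    also have "nrm A (s \<otimes> (s \<ominus> t) \<oplus> (s \<ominus> t) \<otimes> t) \<le> nrm A (s \<otimes> (s \<ominus> t)) + nrm A ((s \<ominus> t) \<otimes> t)"
      using c by (intro nrm_triangle) auto
    also have "\<dots> \<le> nrm A s * nrm A (s \<ominus> t) + nrm A (s \<ominus> t) * nrm A t"
      using c by (intro add_mono nrm_mult) auto
    also have "\<dots> \<le> q * nrm A (s \<ominus> t) + nrm A (s \<ominus> t) * q"
      using c by (intro add_mono mult_mono) (auto simp: nrm_nonneg q)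
    finally show ?thesis using c x by (simp add: cstar_dist_def T_def)
  qed
  ultimately obtain t where t: "t \<in> B" and fp: "T t = t"
    using sub.Banach_fixedpoint_thm [of T q] q by metis
  then have t': "t \<in> carrier A" "adj A t = t" "t \<otimes> x = x \<otimes> t" by (auto simp: B_def)
  have "t \<oplus> t = 2 \<odot> t" using smult_add_left [of t 1 1] t' by simp
  also have "\<dots> = 2 \<odot> T t" by (simp add: fp)
  also have "\<dots> = x \<otimes> x \<oplus> t \<otimes> t" using t' x by (simp add: T_def smult_smult)
  finally have tt: "t \<otimes> t = (t \<oplus> t) \<ominus> x \<otimes> x"
    using t' x by (simp add: a_minus_def a_ac r_neg1 r_neg)
  show thesis
  proof (rule that [of "\<one> \<ominus> t"])
    show "(\<one> \<ominus> t) \<otimes> x = x \<otimes> (\<one> \<ominus> t)"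
      using t' x by (simp add: a_minus_def l_distr r_distr l_minus r_minus)
    have "(\<one> \<ominus> t) \<otimes> (\<one> \<ominus> t) = \<one> \<ominus> (t \<oplus> t) \<oplus> t \<otimes> t"
      using t' by (simp add: a_minus_def l_distr r_distr l_minus r_minus a_assoc minus_add)
    also have "\<dots> = \<one> \<ominus> x \<otimes> x"
    proof -
      have "\<one> \<ominus> w \<oplus> (w \<ominus> z) = \<one> \<ominus> z" if "w \<in> carrier A" "z \<in> carrier A" for w z
        using that by (simp add: a_minus_def a_assoc r_neg1)
      then show ?thesis unfolding tt using t' x by simp
    qed
    finally show "(\<one> \<ominus> t) \<otimes> (\<one> \<ominus> t) = \<one> \<ominus> x \<otimes> x" .
  qed (use t' in \<open>auto simp: adj_diff\<close>)
qed

end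

lemma star_homD:
  assumes "h \<in> unital_star_hom A B"
  shows "x \<in> carrier A \<Longrightarrow> h x \<in> carrier B"
    and "\<lbrakk>x \<in> carrier A; y \<in> carrier A\<rbrakk> \<Longrightarrow> h (x \<oplus>\<^bsub>A\<^esub> y) = h x \<oplus>\<^bsub>B\<^esub> h y"
    and "\<lbrakk>x \<in> carrier A; y \<in> carrier A\<rbrakk> \<Longrightarrow> h (x \<otimes>\<^bsub>A\<^esub> y) = h x \<otimes>\<^bsub>B\<^esub> h y"
    and "h \<one>\<^bsub>A\<^esub> = \<one>\<^bsub>B\<^esub>"
    and "x \<in> carrier A \<Longrightarrow> h (c \<odot>\<^bsub>A\<^esub> x) = c \<odot>\<^bsub>B\<^esub> h x"
    and "x \<in> carrier A \<Longrightarrow> h (adj A x) = adj B (h x)"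
  using assms unfolding unital_star_hom_def
  by (auto simp: ring_hom_closed ring_hom_add ring_hom_mult ring_hom_one)

lemma star_hom_diff:
  assumes "cstar_algebra A" "cstar_algebra B" "h \<in> unital_star_hom A B"
    and "x \<in> carrier A" "y \<in> carrier A"
  shows "h (x \<ominus>\<^bsub>A\<^esub> y) = h x \<ominus>\<^bsub>B\<^esub> h y"
proof -
  interpret A: cstar_algebra A by fact
  interpret B: cstar_algebra B by fact
  show ?thesis
    using star_homD [OF assms(3)] assms(4,5)
    by (simp add: a_minus_def A.minus_eq_smult B.minus_eq_smult)
qed

text \<open>A selfadjoint \<open>x\<close> of norm below one is the mean of the unitaries
  \<open>x \<plusminus> \<i> sqrt (1 - x\<^sup>2)\<close>. Homomorphisms map unitaries to unitaries, whose norm is at most one.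
  By the C*-identity the general case reduces to the selfadjoint one.\<close>

theorem star_hom_contractive:
  assumes A: "cstar_algebra A" and B: "cstar_algebra B" and h: "h \<in> unital_star_hom A B"
    and x: "x \<in> carrier A"
  shows "nrm B (h x) \<le> nrm A x"
proof -
  interpret A: cstar_algebra A by (rule A)
  interpret B: cstar_algebra B by (rule B)
  note hD [simp] = star_homD [OF h]
  have unit: "nrm B (h y) \<le> 1" if y: "y \<in> carrier A" "adj A y = y" "nrm A y < 1" for y
  proof -
    obtain s where s: "s \<in> carrier A" "adj A s = s" "s \<otimes>\<^bsub>A\<^esub> y = y \<otimes>\<^bsub>A\<^esub> s"
      "s \<otimes>\<^bsub>A\<^esub> s = \<one>\<^bsub>A\<^esub> \<ominus>\<^bsub>A\<^esub> y \<otimes>\<^bsub>A\<^esub> y"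
      using A.ex_sqrt_one_minus_square [OF y] by metis
    define u where "u = y \<oplus>\<^bsub>A\<^esub> \<i> \<odot>\<^bsub>A\<^esub> s"
    define v where "v = y \<oplus>\<^bsub>A\<^esub> (- \<i>) \<odot>\<^bsub>A\<^esub> s"
    have c: "u \<in> carrier A" "v \<in> carrier A" using y s by (auto simp: u_def v_def)
    have v: "adj A u = v" using y s by (simp add: u_def v_def A.adj_add A.adj_smult)
    have "v \<otimes>\<^bsub>A\<^esub> u = y \<otimes>\<^bsub>A\<^esub> y \<oplus>\<^bsub>A\<^esub> (\<i> \<odot>\<^bsub>A\<^esub> (y \<otimes>\<^bsub>A\<^esub> s) \<oplus>\<^bsub>A\<^esub> ((- \<i>) \<odot>\<^bsub>A\<^esub> (y \<otimes>\<^bsub>A\<^esub> s) \<oplus>\<^bsub>A\<^esub> s \<otimes>\<^bsub>A\<^esub> s))"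
      using y s(1,2) by (simp add: u_def v_def A.l_distr A.r_distr A.smult_mult_left A.smult_mult_right
          A.smult_add_right A.smult_smult A.a_ac s(3))
    also have "\<i> \<odot>\<^bsub>A\<^esub> (y \<otimes>\<^bsub>A\<^esub> s) \<oplus>\<^bsub>A\<^esub> ((- \<i>) \<odot>\<^bsub>A\<^esub> (y \<otimes>\<^bsub>A\<^esub> s) \<oplus>\<^bsub>A\<^esub> s \<otimes>\<^bsub>A\<^esub> s)
        = s \<otimes>\<^bsub>A\<^esub> s"
      using A.smult_add_left [of "y \<otimes>\<^bsub>A\<^esub> s" \<i> "- \<i>"] A.smult_l_null [of "y \<otimes>\<^bsub>A\<^esub> s"] y s(1)
      by (simp add: A.a_assoc [symmetric])
    also have "y \<otimes>\<^bsub>A\<^esub> y \<oplus>\<^bsub>A\<^esub> s \<otimes>\<^bsub>A\<^esub> s = \<one>\<^bsub>A\<^esub>"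
      unfolding s(4) using y by (simp add: a_minus_def A.a_ac A.r_neg1 A.r_neg)
    finally have vu: "v \<otimes>\<^bsub>A\<^esub> u = \<one>\<^bsub>A\<^esub>" .
    have hv: "adj B (h u) = h v" using hD(6) [of u] c v by simp
    have "adj B (h u) \<otimes>\<^bsub>B\<^esub> h u = \<one>\<^bsub>B\<^esub>"
      unfolding hv using hD(3) [of v u] c by (simp add: vu del: hD(3))
    then have "nrm B (h u) \<le> 1" using c by (intro B.nrm_unitary_le_one) auto
    moreover have "nrm B (h v) = nrm B (h u)" using B.nrm_adj [of "h u"] c hv by simp
    moreover have "2 \<odot>\<^bsub>A\<^esub> y = u \<oplus>\<^bsub>A\<^esub> v"
    proof -
      have "u \<oplus>\<^bsub>A\<^esub> v = (y \<oplus>\<^bsub>A\<^esub> y) \<oplus>\<^bsub>A\<^esub> (\<i> \<odot>\<^bsub>A\<^esub> s \<oplus>\<^bsub>A\<^esub> (- \<i>) \<odot>\<^bsub>A\<^esub> s)"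
        using y s(1) by (simp add: u_def v_def A.a_ac)
      also have "\<dots> = 2 \<odot>\<^bsub>A\<^esub> y"
        using A.smult_add_left [of s \<i> "- \<i>"] A.smult_l_null [of s]
          A.smult_add_left [of y 1 1] y s(1) by simp
      finally show ?thesis ..
    qed
    then have "2 \<odot>\<^bsub>B\<^esub> h y = h u \<oplus>\<^bsub>B\<^esub> h v" using y c by (metis hD(2,5))
    then have "2 * nrm B (h y) \<le> nrm B (h u) + nrm B (h v)"
      using B.nrm_smult [of "h y" 2] B.nrm_triangle [of "h u" "h v"] y c by simp
    ultimately show ?thesis by simp
  qed
  have sa: "nrm B (h y) \<le> nrm A y" if y: "y \<in> carrier A" "adj A y = y" for y
  proof (rule dense_ge)
    fix r assume r: "nrm A y < r"
    then have "r > 0" using A.nrm_nonneg [OF y(1)] by simp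
    have "nrm B (h (complex_of_real (1/r) \<odot>\<^bsub>A\<^esub> y)) \<le> 1"
      using y r \<open>r > 0\<close> by (intro unit) (auto simp: A.adj_smult A.nrm_smult norm_divide)
    then show "nrm B (h y) \<le> r"
      using y \<open>r > 0\<close> by (simp add: B.nrm_smult norm_divide field_simps)
  qed
  have "(nrm B (h x))\<^sup>2 = nrm B (h (adj A x \<otimes>\<^bsub>A\<^esub> x))"
    using x by (simp add: B.cstar_identity)
  also have "\<dots> \<le> nrm A (adj A x \<otimes>\<^bsub>A\<^esub> x)"
    using x by (intro sa) (auto simp: A.adj_mult)
  also have "\<dots> = (nrm A x)\<^sup>2" using x by (rule A.cstar_identity)
  finally show ?thesis
    using A.nrm_nonneg [OF x] power2_le_imp_le by blast
qed


lemma star_hom_dist: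
  assumes A: "cstar_algebra A" and B: "cstar_algebra B" and h: "h \<in> unital_star_hom A B"
    and x: "x \<in> carrier A" and y: "y \<in> carrier A"
  shows "nrm B (h x \<ominus>\<^bsub>B\<^esub> h y) \<le> nrm A (x \<ominus>\<^bsub>A\<^esub> y)"
proof -
  interpret A: cstar_algebra A by (rule A)
  show ?thesis
    using star_hom_contractive [OF A B h A.minus_closed [OF x y]] star_hom_diff [OF assms] by simp
qed

section \<open>Subdirect products\<close>

text \<open>The axioms of a C*-algebra are equations, apart from those on the norm and on completeness.
  They are therefore inherited by every structure that embeds into a product of C*-algebras,
  provided that its norm is the supremum of the coordinate norms and that it is closed under
  uniform limits of the coordinates.\<close>

theorem subdirect_cstar_algebra:
  fixes A :: "('a, 'm) cstar_scheme" (structure)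
    and B :: "'i \<Rightarrow> ('b, 'n) cstar_scheme" and \<pi> :: "'i \<Rightarrow> 'a \<Rightarrow> 'b"
  assumes B: "\<And>i. i \<in> J \<Longrightarrow> cstar_algebra (B i)"
    and cl: "\<And>x y. \<lbrakk>x \<in> carrier A; y \<in> carrier A\<rbrakk> \<Longrightarrow> x \<oplus> y \<in> carrier A"
      "\<And>x y. \<lbrakk>x \<in> carrier A; y \<in> carrier A\<rbrakk> \<Longrightarrow> x \<otimes> y \<in> carrier A"
      "\<And>c x. x \<in> carrier A \<Longrightarrow> c \<odot> x \<in> carrier A"
      "\<And>x. x \<in> carrier A \<Longrightarrow> adj A x \<in> carrier A"
      "\<one> \<in> carrier A" "\<zero> \<in> carrier A"
    and hom: "\<And>i x. \<lbrakk>i \<in> J; x \<in> carrier A\<rbrakk> \<Longrightarrow> \<pi> i x \<in> carrier (B i)"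
      "\<And>i x y. \<lbrakk>i \<in> J; x \<in> carrier A; y \<in> carrier A\<rbrakk> \<Longrightarrow> \<pi> i (x \<oplus> y) = \<pi> i x \<oplus>\<^bsub>B i\<^esub> \<pi> i y"
      "\<And>i x y. \<lbrakk>i \<in> J; x \<in> carrier A; y \<in> carrier A\<rbrakk> \<Longrightarrow> \<pi> i (x \<otimes> y) = \<pi> i x \<otimes>\<^bsub>B i\<^esub> \<pi> i y"
      "\<And>i c x. \<lbrakk>i \<in> J; x \<in> carrier A\<rbrakk> \<Longrightarrow> \<pi> i (c \<odot> x) = c \<odot>\<^bsub>B i\<^esub> \<pi> i x"
      "\<And>i x. \<lbrakk>i \<in> J; x \<in> carrier A\<rbrakk> \<Longrightarrow> \<pi> i (adj A x) = adj (B i) (\<pi> i x)"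
      "\<And>i. i \<in> J \<Longrightarrow> \<pi> i \<one> = \<one>\<^bsub>B i\<^esub>"
      "\<And>i. i \<in> J \<Longrightarrow> \<pi> i \<zero> = \<zero>\<^bsub>B i\<^esub>"
    and inj: "\<And>x y. \<lbrakk>x \<in> carrier A; y \<in> carrier A; \<And>i. i \<in> J \<Longrightarrow> \<pi> i x = \<pi> i y\<rbrakk> \<Longrightarrow> x = y"
    and nn: "\<And>x. x \<in> carrier A \<Longrightarrow> 0 \<le> nrm A x"
    and ub: "\<And>i x. \<lbrakk>i \<in> J; x \<in> carrier A\<rbrakk> \<Longrightarrow> nrm (B i) (\<pi> i x) \<le> nrm A x"
    and lub: "\<And>x c. \<lbrakk>x \<in> carrier A; 0 \<le> c; \<And>i. i \<in> J \<Longrightarrow> nrm (B i) (\<pi> i x) \<le> c\<rbrakk> \<Longrightarrow> nrm A x \<le> c"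
    and compl: "\<And>\<sigma> :: nat \<Rightarrow> 'a. \<lbrakk>\<And>n. \<sigma> n \<in> carrier A;
        \<And>e. e > 0 \<Longrightarrow> \<exists>N. \<forall>m\<ge>N. \<forall>n\<ge>N. \<forall>i\<in>J. nrm (B i) (\<pi> i (\<sigma> m) \<ominus>\<^bsub>B i\<^esub> \<pi> i (\<sigma> n)) < e\<rbrakk>
        \<Longrightarrow> \<exists>l\<in>carrier A. \<forall>e>0. \<exists>N. \<forall>n\<ge>N. \<forall>i\<in>J. nrm (B i) (\<pi> i (\<sigma> n) \<ominus>\<^bsub>B i\<^esub> \<pi> i l) \<le> e"
  shows "cstar_algebra A"
proof -
  have rB: "ring (B i)" if "i \<in> J" for i using B [OF that] by (simp add: cstar_algebra_def)
  note ringB = ring.ring_simprules [OF rB] monoid.r_one [OF ring.axioms(2) [OF rB]]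
  have ab: "abelian_group A"
  proof (rule abelian_groupI)
    fix x assume x: "x \<in> carrier A"
    have "(-1) \<odot> x \<oplus> x = \<zero>"
    proof (rule inj)
      fix i assume i: "i \<in> J"
      interpret Bi: cstar_algebra "B i" by (rule B [OF i])
      have "\<pi> i ((-1) \<odot> x \<oplus> x) = (\<ominus>\<^bsub>B i\<^esub> \<pi> i x) \<oplus>\<^bsub>B i\<^esub> \<pi> i x"
        using i x by (simp add: hom cl Bi.minus_eq_smult)
      then show "\<pi> i ((-1) \<odot> x \<oplus> x) = \<pi> i \<zero>"
        using i x by (simp add: hom Bi.l_neg)
    qed (simp_all add: cl x)
    then show "\<exists>y\<in>carrier A. y \<oplus> x = \<zero>" using x cl(3) by blast
  qed ((simp add: cl; fail) | (rule inj; simp add: cl hom ringB))+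
  have mon: "monoid A"
    by (rule monoidI) ((simp add: cl; fail) | (rule inj; simp add: cl hom ringB))+
  interpret ring A
    by (rule ringI [OF ab mon]) (rule inj; simp add: cl hom ringB)+
  have minus: "\<ominus> x = (-1) \<odot> x" if x: "x \<in> carrier A" for x
  proof (rule inj)
    fix i assume i: "i \<in> J"
    interpret Bi: cstar_algebra "B i" by (rule B [OF i])
    have "\<pi> i (\<ominus> x) \<oplus>\<^bsub>B i\<^esub> \<pi> i x = \<zero>\<^bsub>B i\<^esub>"
      using hom(2) [of i "\<ominus> x" x] i x by (simp add: l_neg hom(7))
    then have "\<pi> i (\<ominus> x) = \<ominus>\<^bsub>B i\<^esub> \<pi> i x"
      using Bi.minus_equality [of "\<pi> i (\<ominus> x)" "\<pi> i x"] i x hom(1) by simp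
    then show "\<pi> i (\<ominus> x) = \<pi> i ((-1) \<odot> x)"
      using i x by (simp add: hom Bi.minus_eq_smult)
  qed (use x cl in auto)
  have diff: "\<pi> i (x \<ominus> y) = \<pi> i x \<ominus>\<^bsub>B i\<^esub> \<pi> i y"
    if i: "i \<in> J" and xy: "x \<in> carrier A" "y \<in> carrier A" for i x y
  proof -
    interpret Bi: cstar_algebra "B i" by (rule B [OF i])
    show ?thesis using i xy by (simp add: a_minus_def hom cl minus Bi.minus_eq_smult)
  qed
  show ?thesis
  proof (rule cstar_algebraI)
    show "ring A" by unfold_locales
  next
    fix \<sigma> :: "nat \<Rightarrow> 'a"
    assume \<sigma>: "\<And>n. \<sigma> n \<in> carrier A"
      and Cau: "\<And>e. e > 0 \<Longrightarrow> \<exists>N. \<forall>m\<ge>N. \<forall>n\<ge>N. nrm A (\<sigma> m \<ominus> \<sigma> n) < e"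
    have "\<exists>l\<in>carrier A. \<forall>e>0. \<exists>N. \<forall>n\<ge>N. \<forall>i\<in>J. nrm (B i) (\<pi> i (\<sigma> n) \<ominus>\<^bsub>B i\<^esub> \<pi> i l) \<le> e"
    proof (rule compl)
      fix e :: real assume "e > 0"
      then obtain N where "\<forall>m\<ge>N. \<forall>n\<ge>N. nrm A (\<sigma> m \<ominus> \<sigma> n) < e" using Cau by blast
      then show "\<exists>N. \<forall>m\<ge>N. \<forall>n\<ge>N. \<forall>i\<in>J. nrm (B i) (\<pi> i (\<sigma> m) \<ominus>\<^bsub>B i\<^esub> \<pi> i (\<sigma> n)) < e"
        using \<sigma> by (metis diff minus_closed ub order_le_less_trans)
    qed (rule \<sigma>)
    then obtain l where l: "l \<in> carrier A"
      and lim: "\<And>e. e > 0 \<Longrightarrow> \<exists>N. \<forall>n\<ge>N. \<forall>i\<in>J. nrm (B i) (\<pi> i (\<sigma> n) \<ominus>\<^bsub>B i\<^esub> \<pi> i l) \<le> e"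
      by blast
    have "\<exists>N. \<forall>n\<ge>N. nrm A (\<sigma> n \<ominus> l) < e" if "e > 0" for e
    proof -
      obtain N where N: "\<forall>n\<ge>N. \<forall>i\<in>J. nrm (B i) (\<pi> i (\<sigma> n) \<ominus>\<^bsub>B i\<^esub> \<pi> i l) \<le> e/2"
        using lim [of "e/2"] \<open>e > 0\<close> by auto
      have "nrm A (\<sigma> n \<ominus> l) \<le> e/2" if "n \<ge> N" for n
        using N that \<open>e > 0\<close> \<sigma> l by (intro lub) (auto simp: diff)
      then show ?thesis using \<open>e > 0\<close> by (intro exI [of _ N]) force
    qed
    then show "\<exists>l\<in>carrier A. \<forall>e>0. \<exists>N. \<forall>i\<ge>N. nrm A (\<sigma> i \<ominus> l) < e"
      using l by blast
  next
    fix x assume x: "x \<in> carrier A"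
    show "nrm A x = 0 \<longleftrightarrow> x = \<zero>"
    proof
      assume 0: "nrm A x = 0"
      show "x = \<zero>"
      proof (rule inj)
        fix i assume i: "i \<in> J"
        interpret Bi: cstar_algebra "B i" by (rule B [OF i])
        have "nrm (B i) (\<pi> i x) = 0"
          using ub [OF i x] Bi.nrm_nonneg [OF hom(1) [OF i x]] 0 by simp
        then show "\<pi> i x = \<pi> i \<zero>"
          using Bi.nrm_eq_zero [OF hom(1) [OF i x]] hom(7) [OF i] by simp
      qed (use x in auto)
    next
      assume "x = \<zero>"
      moreover have "nrm A \<zero> \<le> 0"
        by (rule lub) (auto simp: hom(7) cstar_algebra.nrm_zero [OF B])
      ultimately show "nrm A x = 0" using nn [OF x] by simp
    qed
    show "nrm A (adj A x \<otimes> x) = (nrm A x)\<^sup>2"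
    proof (rule antisym)
      show "nrm A (adj A x \<otimes> x) \<le> (nrm A x)\<^sup>2"
      proof (rule lub)
        fix i assume i: "i \<in> J"
        interpret Bi: cstar_algebra "B i" by (rule B [OF i])
        show "nrm (B i) (\<pi> i (adj A x \<otimes> x)) \<le> (nrm A x)\<^sup>2"
          using i x by (simp add: hom cl Bi.cstar_identity ub power_mono Bi.nrm_nonneg)
      qed (use x cl in auto)
      have "nrm A x \<le> sqrt (nrm A (adj A x \<otimes> x))"
      proof (rule lub)
        fix i assume i: "i \<in> J"
        interpret Bi: cstar_algebra "B i" by (rule B [OF i])
        show "nrm (B i) (\<pi> i x) \<le> sqrt (nrm A (adj A x \<otimes> x))"
          using ub [OF i, of "adj A x \<otimes> x"] i x
          by (intro real_le_rsqrt) (simp add: hom cl Bi.cstar_identity)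
      qed (use x cl nn in auto)
      then show "(nrm A x)\<^sup>2 \<le> nrm A (adj A x \<otimes> x)"
        using sqrt_ge_absD [of "nrm A x" "nrm A (adj A x \<otimes> x)"] nn [OF x] by simp
    qed
    have le: "nrm A (c \<odot> y) \<le> cmod c * nrm A y" if y: "y \<in> carrier A" for c y
    proof (rule lub)
      fix i assume i: "i \<in> J"
      interpret Bi: cstar_algebra "B i" by (rule B [OF i])
      show "nrm (B i) (\<pi> i (c \<odot> y)) \<le> cmod c * nrm A y"
        using i y by (simp add: hom Bi.nrm_smult mult_left_mono ub)
    qed (use y cl nn in auto)
    fix c
    have "cmod c * nrm A x \<le> nrm A (c \<odot> x)"
    proof (cases "c = 0")
      case False
      have "nrm A ((1/c) \<odot> (c \<odot> x)) \<le> cmod (1/c) * nrm A (c \<odot> x)"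
        using x cl by (intro le)
      also have "(1/c) \<odot> (c \<odot> x) = x"
      proof (rule inj)
        fix i assume i: "i \<in> J"
        interpret Bi: cstar_algebra "B i" by (rule B [OF i])
        show "\<pi> i ((1/c) \<odot> (c \<odot> x)) = \<pi> i x"
          using i x False by (simp add: hom cl Bi.smult_smult)
      qed (use x cl in auto)
      finally show ?thesis using False by (simp add: norm_divide field_simps)
    qed (simp add: nn x cl)
    then show "nrm A (c \<odot> x) = cmod c * nrm A x" using le [OF x] by (simp add: antisym)
  next
    fix x y assume xy: "x \<in> carrier A" "y \<in> carrier A"
    show "nrm A (x \<oplus> y) \<le> nrm A x + nrm A y"
    proof (rule lub)
      fix i assume i: "i \<in> J"
      interpret Bi: cstar_algebra "B i" by (rule B [OF i])
      show "nrm (B i) (\<pi> i (x \<oplus> y)) \<le> nrm A x + nrm A y"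
        using Bi.nrm_triangle [of "\<pi> i x" "\<pi> i y"] ub [OF i xy(1)] ub [OF i xy(2)] i xy
        by (simp add: hom)
    qed (use xy nn in auto)
    show "nrm A (x \<otimes> y) \<le> nrm A x * nrm A y"
    proof (rule lub)
      fix i assume i: "i \<in> J"
      interpret Bi: cstar_algebra "B i" by (rule B [OF i])
      have "nrm (B i) (\<pi> i x \<otimes>\<^bsub>B i\<^esub> \<pi> i y) \<le> nrm (B i) (\<pi> i x) * nrm (B i) (\<pi> i y)"
        using i xy by (intro Bi.nrm_mult) (auto simp: hom)
      also have "\<dots> \<le> nrm A x * nrm A y"
        using i xy by (intro mult_mono ub) (auto simp: hom nn Bi.nrm_nonneg)
      finally show "nrm (B i) (\<pi> i (x \<otimes> y)) \<le> nrm A x * nrm A y"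
        using i xy by (simp add: hom)
    qed (use xy nn in auto)
  qed ((simp add: nn cl; fail) | (rule inj; simp add: cl hom cstar_algebra.smult_add_left [OF B]
    cstar_algebra.smult_add_right [OF B] cstar_algebra.smult_smult [OF B]
    cstar_algebra.smult_1 [OF B] cstar_algebra.smult_mult_left [OF B]
    cstar_algebra.smult_mult_right [OF B] cstar_algebra.adj_adj [OF B]
    cstar_algebra.adj_add [OF B] cstar_algebra.adj_smult [OF B]
    cstar_algebra.adj_mult [OF B]))+
qed

section \<open>The C*-algebra of n by n matrices\<close>

lemma cscalar_prod_self_eq: "v \<bullet>c v = complex_of_real (\<Sum>i<dim_vec v. (cmod (v $ i))\<^sup>2)"
  by (auto simp: scalar_prod_def complex_norm_square lessThan_atLeast0 simp del: of_real_power intro!: sum.cong)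

lemma vec_l2norm_eq: "vec_l2norm v = L2_set (\<lambda>i. cmod (v $ i)) {..<dim_vec v}"
  by (simp add: vec_l2norm_def L2_set_def cscalar_prod_self_eq del: of_real_sum)

lemma vec_l2norm_nonneg [simp]: "0 \<le> vec_l2norm v"
  by (simp add: vec_l2norm_eq)

lemma vec_l2norm_smult [simp]: "vec_l2norm (c \<cdot>\<^sub>v v) = cmod c * vec_l2norm v"
proof -
  have "vec_l2norm (c \<cdot>\<^sub>v v) = L2_set (\<lambda>i. cmod c * cmod (v $ i)) {..<dim_vec v}"
    unfolding vec_l2norm_eq by (rule L2_set_cong) (auto simp: norm_mult)
  then show ?thesis by (simp only: vec_l2norm_eq L2_set_right_distrib norm_ge_zero)
qed

lemma vec_l2norm_triangle:
  assumes "v \<in> carrier_vec n" "w \<in> carrier_vec n"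
  shows "vec_l2norm (v + w) \<le> vec_l2norm v + vec_l2norm w"
proof -
  have "vec_l2norm (v + w) \<le> L2_set (\<lambda>i. cmod (v $ i) + cmod (w $ i)) {..<n}"
    using assms by (auto simp: vec_l2norm_eq norm_triangle_ineq intro!: L2_set_mono)
  also have "\<dots> \<le> vec_l2norm v + vec_l2norm w"
    using assms L2_set_triangle_ineq [of "\<lambda>i. cmod (v $ i)" "\<lambda>i. cmod (w $ i)" "{..<n}"]
    by (auto simp: vec_l2norm_eq)
  finally show ?thesis .
qed

lemma vec_component_le: "i < dim_vec v \<Longrightarrow> cmod (v $ i) \<le> vec_l2norm v"
  using member_le_L2_set [of "{..<dim_vec v}" i "\<lambda>i. cmod (v $ i)"] by (simp add: vec_l2norm_eq)

lemma vec_l2norm_eq_0: "v \<in> carrier_vec n \<Longrightarrow> vec_l2norm v = 0 \<longleftrightarrow> v = 0\<^sub>v n"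
proof
  assume v: "v \<in> carrier_vec n" "vec_l2norm v = 0"
  show "v = 0\<^sub>v n"
    using v vec_component_le [of _ v] by (intro eq_vecI) force+
qed (simp add: vec_l2norm_eq L2_set_def)

lemma cscalar_prod_self: "v \<bullet>c v = complex_of_real ((vec_l2norm v)\<^sup>2)"
  by (simp add: cscalar_prod_self_eq vec_l2norm_eq L2_set_def sum_nonneg)

lemma cscalar_prod_Cauchy_Schwarz:
  assumes "v \<in> carrier_vec n" "w \<in> carrier_vec n"
  shows "cmod (v \<bullet>c w) \<le> vec_l2norm v * vec_l2norm w"
proof -
  have "cmod (v \<bullet>c w) \<le> (\<Sum>i<n. \<bar>cmod (v $ i)\<bar> * \<bar>cmod (w $ i)\<bar>)"
    using assms by (auto simp: scalar_prod_def norm_mult lessThan_atLeast0 intro!: sum_norm_le)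
  also have "\<dots> \<le> vec_l2norm v * vec_l2norm w"
    using assms L2_set_mult_ineq [of "\<lambda>i. cmod (v $ i)" "\<lambda>i. cmod (w $ i)" "{..<n}"]
    by (auto simp: vec_l2norm_eq)
  finally show ?thesis .
qed

lemma dim_mat_adjoint [simp]: "dim_row (mat_adjoint M) = dim_col M" "dim_col (mat_adjoint M) = dim_row M"
  by (simp_all add: mat_adjoint_def)

lemma index_mat_adjoint [simp]:
  "\<lbrakk>i < dim_col M; j < dim_row M\<rbrakk> \<Longrightarrow> mat_adjoint M $$ (i, j) = cnj (M $$ (j, i))"
  by (simp add: mat_adjoint_def mat_of_rows_def)

lemma mat_adjoint_closed [simp]: "M \<in> carrier_mat n m \<Longrightarrow> mat_adjoint M \<in> carrier_mat m n"
  by (intro carrier_matI) auto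

lemma cscalar_prod_adjoint:
  fixes M :: "complex mat" and v w :: "complex vec"
  assumes M: "M \<in> carrier_mat n n" and v: "v \<in> carrier_vec n" and w: "w \<in> carrier_vec n"
  shows "(M *\<^sub>v v) \<bullet>c w = v \<bullet>c (mat_adjoint M *\<^sub>v w)"
proof -
  have "(M *\<^sub>v v) \<bullet>c w = (\<Sum>i<n. \<Sum>j<n. M $$ (i, j) * v $ j * cnj (w $ i))"
    using assms by (auto simp: scalar_prod_def lessThan_atLeast0 sum_distrib_right intro!: sum.cong)
  also have "\<dots> = (\<Sum>j<n. \<Sum>i<n. M $$ (i, j) * v $ j * cnj (w $ i))"
    by (rule sum.swap)
  also have "\<dots> = v \<bullet>c (mat_adjoint M *\<^sub>v w)"
    using assms by (auto simp: scalar_prod_def lessThan_atLeast0 sum_distrib_left mult_ac intro!: sum.cong)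
  finally show ?thesis .
qed

text \<open>A bound for the operator norm that is visibly continuous in the entries.\<close>

definition entry_sum :: "nat \<Rightarrow> complex mat \<Rightarrow> real" where
  "entry_sum n M = (\<Sum>i<n. \<Sum>j<n. cmod (M $$ (i, j)))"

lemma vec_l2norm_mult_le_entry_sum:
  assumes M: "M \<in> carrier_mat n n" and v: "v \<in> carrier_vec n" and le: "vec_l2norm v \<le> 1"
  shows "vec_l2norm (M *\<^sub>v v) \<le> entry_sum n M"
proof -
  have "vec_l2norm (M *\<^sub>v v) \<le> (\<Sum>i<n. cmod ((M *\<^sub>v v) $ i))"
    using M by (simp add: vec_l2norm_eq L2_set_le_sum del: index_mult_mat_vec)
  also have "\<dots> \<le> entry_sum n M"
    unfolding entry_sum_def
  proof (rule sum_mono)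
    fix i assume "i \<in> {..<n}"
    then have "(M *\<^sub>v v) $ i = (\<Sum>j<n. M $$ (i, j) * v $ j)"
      using M v by (auto simp: scalar_prod_def lessThan_atLeast0 intro!: sum.cong)
    also have "cmod \<dots> \<le> (\<Sum>j<n. cmod (M $$ (i, j)))"
    proof (rule sum_norm_le)
      fix j assume "j \<in> {..<n}"
      then have "cmod (v $ j) \<le> 1" using vec_component_le [of j v] v le by auto
      then show "cmod (M $$ (i, j) * v $ j) \<le> cmod (M $$ (i, j))"
        by (simp add: norm_mult mult_left_le)
    qed
    finally show "cmod ((M *\<^sub>v v) $ i) \<le> (\<Sum>j<n. cmod (M $$ (i, j)))" .
  qed
  finally show ?thesis .
qed

lemma mat_opnorm_le:
  assumes M: "M \<in> carrier_mat n n" and "0 \<le> c"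
    and le: "\<And>v. v \<in> carrier_vec n \<Longrightarrow> vec_l2norm (M *\<^sub>v v) \<le> c * vec_l2norm v"
  shows "mat_opnorm M \<le> c"
  unfolding mat_opnorm_def
proof (rule cSUP_least)
  have "0\<^sub>v n \<in> {v \<in> carrier_vec (dim_col M). vec_l2norm v \<le> 1}"
    using M vec_l2norm_eq_0 [of "0\<^sub>v n" n] by auto
  then show "{v \<in> carrier_vec (dim_col M). vec_l2norm v \<le> 1} \<noteq> {}" by blast
  fix v assume "v \<in> {v \<in> carrier_vec (dim_col M). vec_l2norm v \<le> 1}"
  then show "vec_l2norm (M *\<^sub>v v) \<le> c"
    using le [of v] mult_left_le [of "vec_l2norm v" c] M \<open>0 \<le> c\<close> by auto
qed

lemma mat_opnorm_apply:
  assumes M: "M \<in> carrier_mat n n" and v: "v \<in> carrier_vec n"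
  shows "vec_l2norm (M *\<^sub>v v) \<le> mat_opnorm M * vec_l2norm v"
proof -
  have unit: "vec_l2norm (M *\<^sub>v w) \<le> mat_opnorm M" if "w \<in> carrier_vec n" "vec_l2norm w \<le> 1" for w
    unfolding mat_opnorm_def
    by (rule cSUP_upper) (use M that vec_l2norm_mult_le_entry_sum [OF M] in
        \<open>auto intro!: bdd_aboveI [of _ "entry_sum n M"]\<close>)
  show ?thesis
  proof (cases "vec_l2norm v = 0")
    case True
    then have "M *\<^sub>v v = 0\<^sub>v n" using vec_l2norm_eq_0 [OF v] M by (auto intro!: eq_vecI)
    then show ?thesis using True vec_l2norm_eq_0 [of "M *\<^sub>v v" n] by simp
  next
    case False
    define c where "c = complex_of_real (1 / vec_l2norm v)"
    have c: "cmod c = 1 / vec_l2norm v" by (simp add: c_def norm_divide)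
    have "vec_l2norm (M *\<^sub>v (c \<cdot>\<^sub>v v)) \<le> mat_opnorm M"
      using v False by (intro unit) (auto simp: c)
    also have "M *\<^sub>v (c \<cdot>\<^sub>v v) = c \<cdot>\<^sub>v (M *\<^sub>v v)"
      using M v by (rule mult_mat_vec)
    finally show ?thesis using False vec_l2norm_nonneg [of v] by (simp add: c field_simps)
  qed
qed

lemma mat_opnorm_le_entry_sum:
  assumes M: "M \<in> carrier_mat n n" shows "mat_opnorm M \<le> entry_sum n M"
  unfolding mat_opnorm_def
proof (rule cSUP_least)
  have "0\<^sub>v n \<in> {v \<in> carrier_vec (dim_col M). vec_l2norm v \<le> 1}"
    using M vec_l2norm_eq_0 [of "0\<^sub>v n" n] by auto
  then show "{v \<in> carrier_vec (dim_col M). vec_l2norm v \<le> 1} \<noteq> {}" by blast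
qed (use M in \<open>auto intro: vec_l2norm_mult_le_entry_sum\<close>)

lemma mat_entry_le_opnorm:
  assumes M: "M \<in> carrier_mat n n" and ij: "i < n" "j < n"
  shows "cmod (M $$ (i, j)) \<le> mat_opnorm M"
proof -
  have e: "vec_l2norm (unit_vec n j) = 1"
  proof -
    have "(\<Sum>k<n. (cmod (unit_vec n j $ k))\<^sup>2) = (\<Sum>k<n. if k = j then 1 else 0)"
      using ij by (intro sum.cong) auto
    then show ?thesis using ij by (simp add: vec_l2norm_eq L2_set_def)
  qed
  have "cmod ((M *\<^sub>v unit_vec n j) $ i) \<le> vec_l2norm (M *\<^sub>v unit_vec n j)"
    using M ij by (intro vec_component_le) auto
  also have "\<dots> \<le> mat_opnorm M"
    using mat_opnorm_apply [OF M unit_vec_carrier, of j] e by simp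
  also have "(M *\<^sub>v unit_vec n j) $ i = M $$ (i, j)"
    using M ij by (simp add: scalar_prod_right_unit)
  finally show ?thesis .
qed

lemma mat_opnorm_nonneg [simp]: "M \<in> carrier_mat n n \<Longrightarrow> 0 \<le> mat_opnorm M"
proof -
  assume M: "M \<in> carrier_mat n n"
  have "vec_l2norm (M *\<^sub>v 0\<^sub>v n) \<le> mat_opnorm M"
    unfolding mat_opnorm_def
    by (rule cSUP_upper) (use M vec_l2norm_mult_le_entry_sum [OF M] vec_l2norm_eq_0 [of "0\<^sub>v n" n] in
        \<open>auto intro!: bdd_aboveI [of _ "entry_sum n M"]\<close>)
  then show ?thesis using vec_l2norm_nonneg order_trans by blast
qed

lemma mat_opnorm_zero [simp]: "mat_opnorm (0\<^sub>m n n) = 0"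
proof (rule antisym)
  show "mat_opnorm (0\<^sub>m n n) \<le> 0"
    using mat_opnorm_le_entry_sum [of "0\<^sub>m n n" n] by (simp add: entry_sum_def)
qed (rule mat_opnorm_nonneg [of _ n], simp)

lemma mat_opnorm_eq_0:
  assumes M: "M \<in> carrier_mat n n" shows "mat_opnorm M = 0 \<longleftrightarrow> M = 0\<^sub>m n n"
proof
  assume "mat_opnorm M = 0"
  then show "M = 0\<^sub>m n n"
    using mat_entry_le_opnorm [OF M] M by (intro eq_matI) force+
qed simp

lemma mat_opnorm_triangle:
  assumes M: "M \<in> carrier_mat n n" and N: "N \<in> carrier_mat n n"
  shows "mat_opnorm (M + N) \<le> mat_opnorm M + mat_opnorm N"
proof (rule mat_opnorm_le [where n = n])
  fix v :: "complex vec" assume v: "v \<in> carrier_vec n"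
  have "vec_l2norm ((M + N) *\<^sub>v v) = vec_l2norm (M *\<^sub>v v + N *\<^sub>v v)"
    using M N v by (simp add: add_mult_distrib_mat_vec)
  also have "\<dots> \<le> vec_l2norm (M *\<^sub>v v) + vec_l2norm (N *\<^sub>v v)"
    using M N v by (intro vec_l2norm_triangle [where n = n]) auto
  also have "\<dots> \<le> mat_opnorm M * vec_l2norm v + mat_opnorm N * vec_l2norm v"
    using M N v by (intro add_mono mat_opnorm_apply)
  finally show "vec_l2norm ((M + N) *\<^sub>v v) \<le> (mat_opnorm M + mat_opnorm N) * vec_l2norm v"
    by (simp add: distrib_right)
qed (use M N in auto)

lemma mat_opnorm_mult:
  assumes M: "M \<in> carrier_mat n n" and N: "N \<in> carrier_mat n n"
  shows "mat_opnorm (M * N) \<le> mat_opnorm M * mat_opnorm N"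
proof (rule mat_opnorm_le [where n = n])
  fix v :: "complex vec" assume v: "v \<in> carrier_vec n"
  have "vec_l2norm ((M * N) *\<^sub>v v) = vec_l2norm (M *\<^sub>v (N *\<^sub>v v))"
    using M N v by (simp add: assoc_mult_mat_vec)
  also have "\<dots> \<le> mat_opnorm M * vec_l2norm (N *\<^sub>v v)"
    using M N v by (intro mat_opnorm_apply) auto
  also have "\<dots> \<le> mat_opnorm M * (mat_opnorm N * vec_l2norm v)"
    using M N v by (intro mult_left_mono mat_opnorm_apply) auto
  finally show "vec_l2norm ((M * N) *\<^sub>v v) \<le> mat_opnorm M * mat_opnorm N * vec_l2norm v"
    by simp
qed (use M N in auto)

lemma mat_opnorm_smult:
  assumes M: "M \<in> carrier_mat n n"
  shows "mat_opnorm (c \<cdot>\<^sub>m M) = cmod c * mat_opnorm M"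
proof -
  have le: "mat_opnorm (c \<cdot>\<^sub>m N) \<le> cmod c * mat_opnorm N" if N: "N \<in> carrier_mat n n" for c N
  proof (rule mat_opnorm_le [where n = n])
    fix v :: "complex vec" assume v: "v \<in> carrier_vec n"
    have "(c \<cdot>\<^sub>m N) *\<^sub>v v = c \<cdot>\<^sub>v (N *\<^sub>v v)"
      using N v by (intro eq_vecI) (auto simp: scalar_prod_def sum_distrib_left mult_ac)
    then show "vec_l2norm ((c \<cdot>\<^sub>m N) *\<^sub>v v) \<le> cmod c * mat_opnorm N * vec_l2norm v"
      using mat_opnorm_apply [OF N v] by (simp add: mult.assoc mult_left_mono)
  qed (use N in auto)
  show ?thesis
  proof (cases "c = 0")
    case True
    then have "c \<cdot>\<^sub>m M = 0\<^sub>m n n" using M by (intro eq_matI) auto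
    then show ?thesis using True by simp
  next
    case False
    have "(1/c) \<cdot>\<^sub>m (c \<cdot>\<^sub>m M) = M" using M False by (intro eq_matI) auto
    then have "mat_opnorm M \<le> cmod (1/c) * mat_opnorm (c \<cdot>\<^sub>m M)"
      using le [of "c \<cdot>\<^sub>m M" "1/c"] M by simp
    then show ?thesis using le [OF M, of c] False by (simp add: norm_divide field_simps)
  qed
qed

text \<open>The Cauchy-Schwarz inequality applied to
  \<open>\<parallel>M\<^sup>* v\<parallel>\<^sup>2 = \<langle>M M\<^sup>* v, v\<rangle>\<close>; the next lemma uses \<open>\<parallel>M v\<parallel>\<^sup>2 = \<langle>M\<^sup>* M v, v\<rangle>\<close>.\<close>

lemma mat_opnorm_adjoint_le:
  assumes M: "M \<in> carrier_mat n n"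
  shows "mat_opnorm (mat_adjoint M) \<le> mat_opnorm M"
proof (rule mat_opnorm_le [where n = n])
  fix v :: "complex vec" assume v: "v \<in> carrier_vec n"
  define w where "w = mat_adjoint M *\<^sub>v v"
  have w: "w \<in> carrier_vec n" using M v unfolding w_def by (intro mult_mat_vec_carrier [of _ n n]) auto
  have "complex_of_real ((vec_l2norm w)\<^sup>2) = w \<bullet>c (mat_adjoint M *\<^sub>v v)"
    by (simp add: cscalar_prod_self flip: w_def)
  also have "\<dots> = (M *\<^sub>v w) \<bullet>c v" using cscalar_prod_adjoint [OF M w v] by simp
  finally have "(vec_l2norm w)\<^sup>2 = cmod ((M *\<^sub>v w) \<bullet>c v)"
    by (metis abs_of_nonneg norm_of_real zero_le_power2)
  also have "\<dots> \<le> vec_l2norm (M *\<^sub>v w) * vec_l2norm v"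
    using M v w by (intro cscalar_prod_Cauchy_Schwarz [where n = n]) (auto intro: mult_mat_vec_carrier)
  also have "\<dots> \<le> mat_opnorm M * vec_l2norm w * vec_l2norm v"
    using mat_opnorm_apply [OF M w] by (intro mult_right_mono) auto
  finally have *: "vec_l2norm w * vec_l2norm w \<le> (mat_opnorm M * vec_l2norm v) * vec_l2norm w"
    by (simp add: power2_eq_square mult_ac)
  show "vec_l2norm (mat_adjoint M *\<^sub>v v) \<le> mat_opnorm M * vec_l2norm v"
  proof (cases "vec_l2norm w = 0")
    case True then show ?thesis using M by (simp add: w_def)
  next
    case False
    then have "vec_l2norm w > 0" using vec_l2norm_nonneg [of w] by linarith
    then show ?thesis using mult_right_le_imp_le [OF *] by (simp add: w_def)
  qed
qed (use M in auto)

lemma mat_opnorm_cstar_identity: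
  assumes M: "M \<in> carrier_mat n n"
  shows "mat_opnorm (mat_adjoint M * M) = (mat_opnorm M)\<^sup>2"
proof (rule antisym)
  have "mat_opnorm (mat_adjoint M * M) \<le> mat_opnorm (mat_adjoint M) * mat_opnorm M"
    using M by (intro mat_opnorm_mult [where n = n]) auto
  also have "\<dots> \<le> mat_opnorm M * mat_opnorm M"
    using mat_opnorm_adjoint_le [OF M] mat_opnorm_nonneg [OF M] by (rule mult_right_mono)
  finally show "mat_opnorm (mat_adjoint M * M) \<le> (mat_opnorm M)\<^sup>2"
    by (simp add: power2_eq_square)
  let ?N = "mat_adjoint M * M"
  have N: "?N \<in> carrier_mat n n" using M by auto
  have "mat_opnorm M \<le> sqrt (mat_opnorm ?N)"
  proof (rule mat_opnorm_le [OF M])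
    fix v :: "complex vec" assume v: "v \<in> carrier_vec n"
    have Mv: "M *\<^sub>v v \<in> carrier_vec n" using M v by (intro mult_mat_vec_carrier)
    have "mat_adjoint (mat_adjoint M) = M" using M by (intro eq_matI) auto
    then have "(?N *\<^sub>v v) \<bullet>c v = (M *\<^sub>v v) \<bullet>c (M *\<^sub>v v)"
      using cscalar_prod_adjoint [of "mat_adjoint M" n "M *\<^sub>v v" v] M v Mv
        assoc_mult_mat_vec [of "mat_adjoint M" n n M n v] by simp
    then have "(vec_l2norm (M *\<^sub>v v))\<^sup>2 = cmod ((?N *\<^sub>v v) \<bullet>c v)"
      by (metis abs_of_nonneg cscalar_prod_self norm_of_real zero_le_power2)
    also have "\<dots> \<le> vec_l2norm (?N *\<^sub>v v) * vec_l2norm v"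
      using N v by (intro cscalar_prod_Cauchy_Schwarz [where n = n]) (auto intro: mult_mat_vec_carrier)
    also have "\<dots> \<le> mat_opnorm ?N * vec_l2norm v * vec_l2norm v"
      using mat_opnorm_apply [OF N v] by (intro mult_right_mono) auto
    finally have "vec_l2norm (M *\<^sub>v v) \<le> sqrt (mat_opnorm ?N * (vec_l2norm v)\<^sup>2)"
      by (intro real_le_rsqrt) (simp add: power2_eq_square mult_ac)
    then show "vec_l2norm (M *\<^sub>v v) \<le> sqrt (mat_opnorm ?N) * vec_l2norm v"
      by (simp add: real_sqrt_mult)
  qed (use N in simp)
  then have "(mat_opnorm M)\<^sup>2 \<le> (sqrt (mat_opnorm ?N))\<^sup>2"
    using mat_opnorm_nonneg [OF M] by (rule power_mono)
  then show "(mat_opnorm M)\<^sup>2 \<le> mat_opnorm ?N"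
    using mat_opnorm_nonneg [OF N] by simp
qed

definition mat_alg :: "nat \<Rightarrow> complex mat cstar" where
  "mat_alg n = \<lparr>carrier = carrier_mat n n, mult = (*), one = 1\<^sub>m n, zero = 0\<^sub>m n n, add = (+),
     smult = (\<cdot>\<^sub>m), adj = mat_adjoint, nrm = mat_opnorm\<rparr>"

lemma mat_alg_simps [simp]:
  "carrier (mat_alg n) = carrier_mat n n" "mult (mat_alg n) = (*)" "one (mat_alg n) = 1\<^sub>m n"
  "zero (mat_alg n) = 0\<^sub>m n n" "add (mat_alg n) = (+)" "smult (mat_alg n) = (\<cdot>\<^sub>m)"
  "adj (mat_alg n) = mat_adjoint" "nrm (mat_alg n) = mat_opnorm"
  by (simp_all add: mat_alg_def)

lemma ring_mat_alg: "ring (mat_alg n)"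
proof (rule ringI)
  show "abelian_group (mat_alg n)"
  proof (rule abelian_groupI)
    fix x assume x: "x \<in> carrier (mat_alg n)"
    show "\<exists>y\<in>carrier (mat_alg n). y \<oplus>\<^bsub>mat_alg n\<^esub> x = \<zero>\<^bsub>mat_alg n\<^esub>"
    proof (rule bexI [of _ "- x"])
      show "(- x) \<oplus>\<^bsub>mat_alg n\<^esub> x = \<zero>\<^bsub>mat_alg n\<^esub>"
        using x uminus_l_inv_mat [of x n n] by simp
    qed (use x in simp)
    fix y assume "y \<in> carrier (mat_alg n)"
    with x show "x \<oplus>\<^bsub>mat_alg n\<^esub> y = y \<oplus>\<^bsub>mat_alg n\<^esub> x"
      unfolding mat_alg_simps by (rule comm_add_mat)
  qed (simp_all only: mat_alg_simps add_carrier_mat zero_carrier_mat assoc_add_mat left_add_zero_mat)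
  show "monoid (mat_alg n)"
    by (rule monoidI) (simp_all only: mat_alg_simps mult_carrier_mat one_carrier_mat
        assoc_mult_mat left_mult_one_mat right_mult_one_mat)
qed (simp_all only: mat_alg_simps add_mult_distrib_mat mult_add_distrib_mat)

lemma mat_alg_diff:
  assumes "M \<in> carrier_mat n n" "N \<in> carrier_mat n n"
  shows "M \<ominus>\<^bsub>mat_alg n\<^esub> N = M - N"
proof -
  interpret ring "mat_alg n" by (rule ring_mat_alg)
  have "\<ominus>\<^bsub>mat_alg n\<^esub> N = - N"
    using assms uminus_l_inv_mat [of N n n] minus_equality [of "- N" N] by auto
  then show ?thesis using assms by (simp add: a_minus_def add_uminus_minus_mat)
qed

lemma cstar_algebra_mat_alg: "cstar_algebra (mat_alg n)"
proof (rule cstar_algebraI)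
  fix \<sigma> :: "nat \<Rightarrow> complex mat"
  assume \<sigma>0: "\<And>i. \<sigma> i \<in> carrier (mat_alg n)"
    and Cau: "\<And>e. e > 0 \<Longrightarrow> \<exists>N. \<forall>i\<ge>N. \<forall>j\<ge>N. nrm (mat_alg n) (\<sigma> i \<ominus>\<^bsub>mat_alg n\<^esub> \<sigma> j) < e"
  from \<sigma>0 have \<sigma>: "\<And>i. \<sigma> i \<in> carrier_mat n n" by simp
  have "\<exists>l. (\<lambda>k. \<sigma> k $$ (i, j)) \<longlonglongrightarrow> l" if ij: "i < n" "j < n" for i j
  proof -
    have "Cauchy (\<lambda>k. \<sigma> k $$ (i, j))"
    proof (rule metric_CauchyI)
      fix e :: real assume "e > 0"
      then obtain N where N: "\<forall>k\<ge>N. \<forall>m\<ge>N. mat_opnorm (\<sigma> k - \<sigma> m) < e"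
        using Cau [of e] by (auto simp: mat_alg_diff \<sigma>)
      have "dist (\<sigma> k $$ (i, j)) (\<sigma> m $$ (i, j)) < e" if "k \<ge> N" "m \<ge> N" for k m
      proof -
        have "dist (\<sigma> k $$ (i, j)) (\<sigma> m $$ (i, j)) = cmod ((\<sigma> k - \<sigma> m) $$ (i, j))"
          using ij carrier_matD [OF \<sigma> [of m]] by (simp add: dist_norm)
        also have "\<dots> \<le> mat_opnorm (\<sigma> k - \<sigma> m)"
          using ij \<sigma> by (intro mat_entry_le_opnorm [where n = n]) (auto simp: minus_carrier_mat)
        also have "\<dots> < e" using N that by blast
        finally show ?thesis .
      qed
      then show "\<exists>N. \<forall>k\<ge>N. \<forall>m\<ge>N. dist (\<sigma> k $$ (i, j)) (\<sigma> m $$ (i, j)) < e" by blast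
    qed
    then show ?thesis by (simp add: Cauchy_convergent_iff convergent_def)
  qed
  then obtain L where L: "\<And>i j. \<lbrakk>i < n; j < n\<rbrakk> \<Longrightarrow> (\<lambda>k. \<sigma> k $$ (i, j)) \<longlonglongrightarrow> L i j" by metis
  define l where "l = mat n n (\<lambda>(i, j). L i j)"
  have l: "l \<in> carrier_mat n n" by (simp add: l_def)
  have "(\<lambda>k. entry_sum n (\<sigma> k - l)) \<longlonglongrightarrow> (\<Sum>i<n. \<Sum>j<n. 0)"
    unfolding entry_sum_def
  proof (intro tendsto_sum)
    fix i j assume "i \<in> {..<n}" "j \<in> {..<n}"
    then have ij: "i < n" "j < n" by auto
    have "(\<lambda>k. cmod (\<sigma> k $$ (i, j) - L i j)) \<longlonglongrightarrow> 0"
      using L [OF ij] LIM_zero tendsto_norm_zero by blast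
    then show "(\<lambda>k. cmod ((\<sigma> k - l) $$ (i, j))) \<longlonglongrightarrow> 0"
      using ij l \<sigma> by (simp add: l_def)
  qed
  then have lim: "(\<lambda>k. entry_sum n (\<sigma> k - l)) \<longlonglongrightarrow> 0" by simp
  have "\<exists>N. \<forall>k\<ge>N. mat_opnorm (\<sigma> k - l) < e" if "e > 0" for e
  proof -
    obtain N where "\<forall>k\<ge>N. entry_sum n (\<sigma> k - l) < e"
      using order_tendstoD(2) [OF lim \<open>e > 0\<close>] by (auto simp: eventually_sequentially)
    moreover have "mat_opnorm (\<sigma> k - l) \<le> entry_sum n (\<sigma> k - l)" for k
      using \<sigma> l by (intro mat_opnorm_le_entry_sum) (auto simp: minus_carrier_mat)
    ultimately show ?thesis using order_le_less_trans by blast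
  qed
  then show "\<exists>l\<in>carrier (mat_alg n). \<forall>e>0. \<exists>N. \<forall>k\<ge>N. nrm (mat_alg n) (\<sigma> k \<ominus>\<^bsub>mat_alg n\<^esub> l) < e"
    using l \<sigma> by (intro bexI [of _ l]) (auto simp: mat_alg_diff)
next
  show "ring (mat_alg n)" by (rule ring_mat_alg)
next
  fix x y assume xy: "x \<in> carrier (mat_alg n)" "y \<in> carrier (mat_alg n)"
  then show "adj (mat_alg n) (x \<otimes>\<^bsub>mat_alg n\<^esub> y) = adj (mat_alg n) y \<otimes>\<^bsub>mat_alg n\<^esub> adj (mat_alg n) x"
    by (intro eq_matI) (auto simp: scalar_prod_def mult.commute)
  show "adj (mat_alg n) (x \<oplus>\<^bsub>mat_alg n\<^esub> y) = adj (mat_alg n) x \<oplus>\<^bsub>mat_alg n\<^esub> adj (mat_alg n) y"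
    using xy by (intro eq_matI) auto
  fix c
  show "c \<odot>\<^bsub>mat_alg n\<^esub> (x \<oplus>\<^bsub>mat_alg n\<^esub> y) = c \<odot>\<^bsub>mat_alg n\<^esub> x \<oplus>\<^bsub>mat_alg n\<^esub> c \<odot>\<^bsub>mat_alg n\<^esub> y"
    using xy by (intro eq_matI) (auto simp: algebra_simps)
next
  fix x assume x: "x \<in> carrier (mat_alg n)"
  then show "adj (mat_alg n) (adj (mat_alg n) x) = x" by (intro eq_matI) auto
  show "1 \<odot>\<^bsub>mat_alg n\<^esub> x = x" using x by (intro eq_matI) auto
  fix a b :: complex
  show "adj (mat_alg n) (a \<odot>\<^bsub>mat_alg n\<^esub> x) = cnj a \<odot>\<^bsub>mat_alg n\<^esub> adj (mat_alg n) x"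
    using x by (intro eq_matI) auto
  show "(a + b) \<odot>\<^bsub>mat_alg n\<^esub> x = a \<odot>\<^bsub>mat_alg n\<^esub> x \<oplus>\<^bsub>mat_alg n\<^esub> b \<odot>\<^bsub>mat_alg n\<^esub> x"
    using x by (intro eq_matI) (auto simp: algebra_simps)
  show "(a * b) \<odot>\<^bsub>mat_alg n\<^esub> x = a \<odot>\<^bsub>mat_alg n\<^esub> (b \<odot>\<^bsub>mat_alg n\<^esub> x)"
    using x by (intro eq_matI) auto
qed (simp_all add: mult_smult_assoc_mat [of _ n n _ n] mult_smult_distrib [of _ n n _ n]
    mat_opnorm_eq_0 mat_opnorm_triangle mat_opnorm_smult mat_opnorm_mult mat_opnorm_cstar_identity)

section \<open>Matrix-valued continuous functions\<close>

lemma continuous_map_complex_mult: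
  fixes f g :: "'x \<Rightarrow> complex"
  shows "\<lbrakk>continuous_map X euclidean f; continuous_map X euclidean g\<rbrakk>
    \<Longrightarrow> continuous_map X euclidean (\<lambda>x. f x * g x)"
  by (simp add: continuous_map_atin tendsto_mult)

lemma continuous_map_of_real:
  "continuous_map X euclideanreal f \<Longrightarrow> continuous_map X euclidean (\<lambda>x. complex_of_real (f x))"
  by (simp add: continuous_map_atin tendsto_of_real)

lemma continuous_map_cnj:
  "continuous_map X euclidean f \<Longrightarrow> continuous_map X euclidean (\<lambda>x. cnj (f x))"
  by (simp add: continuous_map_atin tendsto_cnj)

text \<open>Unlike membership in the algebra of functions, this does not demand extensionality, so that
  functions can be combined first and restricted to the space at the end.\<close>

definition mat_continuous :: "'x topology \<Rightarrow> nat \<Rightarrow> ('x \<Rightarrow> complex mat) \<Rightarrow> bool" where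
  "mat_continuous X n f \<longleftrightarrow> (\<forall>x\<in>topspace X. f x \<in> carrier_mat n n) \<and>
     (\<forall>i<n. \<forall>j<n. continuous_map X euclidean (\<lambda>x. f x $$ (i, j)))"

lemma mat_continuousD:
  assumes "mat_continuous X n f"
  shows "x \<in> topspace X \<Longrightarrow> f x \<in> carrier_mat n n"
    and "\<lbrakk>i < n; j < n\<rbrakk> \<Longrightarrow> continuous_map X euclidean (\<lambda>x. f x $$ (i, j))"
  using assms by (auto simp: mat_continuous_def)

lemma mat_continuous_cong:
  assumes "mat_continuous X n f" "\<And>x. x \<in> topspace X \<Longrightarrow> f x = g x"
  shows "mat_continuous X n g"
  unfolding mat_continuous_def
proof (intro conjI ballI allI impI)
  fix i j assume "i < n" "j < n"
  then have "continuous_map X euclidean (\<lambda>x. f x $$ (i, j))" using assms by (simp add: mat_continuous_def)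
  then show "continuous_map X euclidean (\<lambda>x. g x $$ (i, j))"
    by (rule continuous_map_eq) (simp add: assms)
next
  fix x assume "x \<in> topspace X"
  then show "g x \<in> carrier_mat n n"
    using mat_continuousD(1) [OF assms(1)] assms(2) by fastforce
qed

lemma mat_continuous_subtopology:
  "mat_continuous X n f \<Longrightarrow> mat_continuous (subtopology X S) n f"
  by (auto simp: mat_continuous_def continuous_map_from_subtopology)

lemma mat_continuous_entrywise:
  assumes "\<And>x. x \<in> topspace X \<Longrightarrow> f x \<in> carrier_mat n n"
    and c: "\<And>i j. \<lbrakk>i < n; j < n\<rbrakk> \<Longrightarrow> continuous_map X euclidean (g i j)"
    and e: "\<And>x i j. \<lbrakk>x \<in> topspace X; i < n; j < n\<rbrakk> \<Longrightarrow> g i j x = f x $$ (i, j)"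
  shows "mat_continuous X n f"
  unfolding mat_continuous_def
proof (intro conjI ballI allI impI)
  fix i j assume ij: "i < n" "j < n"
  show "continuous_map X euclidean (\<lambda>x. f x $$ (i, j))"
    by (rule continuous_map_eq [OF c [OF ij]]) (simp add: e ij)
qed (simp add: assms)

lemma mat_continuous_add:
  assumes f: "mat_continuous X n f" and g: "mat_continuous X n g"
  shows "mat_continuous X n (\<lambda>x. f x + g x)"
proof (rule mat_continuous_entrywise [where g = "\<lambda>i j x. f x $$ (i, j) + g x $$ (i, j)"])
  note C = mat_continuousD [OF f] mat_continuousD [OF g]
  show "continuous_map X euclidean (\<lambda>x. f x $$ (i, j) + g x $$ (i, j))"
    if "i < n" "j < n" for i j
    by (intro continuous_map_add C that)
  fix x i j assume "x \<in> topspace X" and ij: "i < n" "j < n"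
  then show "f x $$ (i, j) + g x $$ (i, j) = (f x + g x) $$ (i, j)"
    using carrier_matD [OF C(1)] carrier_matD [OF C(3)] ij by simp
qed (use mat_continuousD(1) [OF f] mat_continuousD(1) [OF g] in simp)

lemma mat_continuous_mult:
  assumes f: "mat_continuous X n f" and g: "mat_continuous X n g"
  shows "mat_continuous X n (\<lambda>x. f x * g x)"
proof (rule mat_continuous_entrywise [where g = "\<lambda>i j x. \<Sum>k\<in>{0..<n}. f x $$ (i, k) * g x $$ (k, j)"])
  note C = mat_continuousD [OF f] mat_continuousD [OF g]
  show "continuous_map X euclidean (\<lambda>x. \<Sum>k\<in>{0..<n}. f x $$ (i, k) * g x $$ (k, j))"
    if "i < n" "j < n" for i j
    by (intro continuous_map_sum continuous_map_complex_mult C) (auto simp: that)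
  fix x i j assume "x \<in> topspace X" and ij: "i < n" "j < n"
  then show "(\<Sum>k\<in>{0..<n}. f x $$ (i, k) * g x $$ (k, j)) = (f x * g x) $$ (i, j)"
    using carrier_matD [OF C(1)] carrier_matD [OF C(3)] ij by (simp add: scalar_prod_def)
qed (use mat_continuousD(1) [OF f] mat_continuousD(1) [OF g] in \<open>simp add: mult_carrier_mat [of _ n n]\<close>)

lemma mat_continuous_smult:
  assumes c: "continuous_map X euclidean c" and f: "mat_continuous X n f"
  shows "mat_continuous X n (\<lambda>x. c x \<cdot>\<^sub>m f x)"
proof (rule mat_continuous_entrywise [where g = "\<lambda>i j x. c x * f x $$ (i, j)"])
  note C = mat_continuousD [OF f]
  show "continuous_map X euclidean (\<lambda>x. c x * f x $$ (i, j))"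
    if "i < n" "j < n" for i j
    by (intro continuous_map_complex_mult c C that)
  fix x i j assume "x \<in> topspace X" and ij: "i < n" "j < n"
  then show "c x * f x $$ (i, j) = (c x \<cdot>\<^sub>m f x) $$ (i, j)"
    using carrier_matD [OF C(1)] ij by simp
qed (use mat_continuousD(1) [OF f] in simp)

lemma mat_continuous_adjoint:
  assumes f: "mat_continuous X n f"
  shows "mat_continuous X n (\<lambda>x. mat_adjoint (f x))"
proof (rule mat_continuous_entrywise [where g = "\<lambda>i j x. cnj (f x $$ (j, i))"])
  note C = mat_continuousD [OF f]
  show "continuous_map X euclidean (\<lambda>x. cnj (f x $$ (j, i)))"
    if "i < n" "j < n" for i j
    by (intro continuous_map_cnj C that)
  fix x i j assume "x \<in> topspace X" and ij: "i < n" "j < n"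
  then show "cnj (f x $$ (j, i)) = mat_adjoint (f x) $$ (i, j)"
    using carrier_matD [OF C(1)] ij by simp
qed (use mat_continuousD(1) [OF f] in simp)

lemma mat_continuous_const: "M \<in> carrier_mat n n \<Longrightarrow> mat_continuous X n (\<lambda>x. M)"
  by (simp add: mat_continuous_def)

lemma mat_continuous_diff:
  assumes f: "mat_continuous X n f" and g: "mat_continuous X n g"
  shows "mat_continuous X n (\<lambda>x. f x - g x)"
proof (rule mat_continuous_entrywise [where g = "\<lambda>i j x. f x $$ (i, j) - g x $$ (i, j)"])
  note C = mat_continuousD [OF f] mat_continuousD [OF g]
  show "continuous_map X euclidean (\<lambda>x. f x $$ (i, j) - g x $$ (i, j))"
    if "i < n" "j < n" for i j
    by (intro continuous_map_diff C that)
  fix x i j assume "x \<in> topspace X" and ij: "i < n" "j < n"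
  then show "f x $$ (i, j) - g x $$ (i, j) = (f x - g x) $$ (i, j)"
    using carrier_matD [OF C(1)] carrier_matD [OF C(3)] ij by simp
qed (use mat_continuousD(1) [OF f] mat_continuousD(1) [OF g] in \<open>simp add: minus_carrier_mat\<close>)

text \<open>Differences of operator norms are bounded by the sum of the absolute values of the entries of
  the difference.\<close>

lemma continuous_map_opnorm:
  assumes f: "mat_continuous X n f"
  shows "continuous_map X euclideanreal (\<lambda>x. mat_opnorm (f x))"
proof -
  interpret M: cstar_algebra "mat_alg n" by (rule cstar_algebra_mat_alg)
  have "\<exists>U. openin X U \<and> x \<in> U \<and> (\<forall>y\<in>U. mat_opnorm (f y) \<in> Met_TC.mball (mat_opnorm (f x)) e)"
    if x: "x \<in> topspace X" and "e > 0" for x and e :: real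
  proof -
    let ?g = "\<lambda>y. entry_sum n (f y - f x)"
    have fx: "f x \<in> carrier_mat n n" using f x by (rule mat_continuousD)
    have "mat_continuous X n (\<lambda>y. f y - f x)"
      by (intro mat_continuous_diff f mat_continuous_const fx)
    then have "continuous_map X euclideanreal ?g"
      unfolding entry_sum_def
      by (intro continuous_map_sum continuous_map_norm mat_continuousD) auto
    then have "openin X {y \<in> topspace X. ?g y \<in> {..<e}}"
      by (rule openin_continuous_map_preimage) simp
    moreover have "?g x = 0"
      using carrier_matD [OF fx] by (simp add: entry_sum_def)
    moreover have "mat_opnorm (f y) \<in> Met_TC.mball (mat_opnorm (f x)) e"
      if y: "y \<in> topspace X" and le: "?g y < e" for y
    proof -
      have fy: "f y \<in> carrier_mat n n" using f y by (rule mat_continuousD)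
      have "mat_opnorm (f y - f x) \<le> ?g y"
        using fx fy by (intro mat_opnorm_le_entry_sum) (simp add: minus_carrier_mat)
      moreover have "mat_opnorm (f y) \<le> mat_opnorm (f y - f x) + mat_opnorm (f x)"
        using M.nrm_le_diff_add [of "f y" "f x"] fx fy
        by (simp add: mat_alg_diff)
      moreover have "mat_opnorm (f x) \<le> mat_opnorm (f y - f x) + mat_opnorm (f y)"
        using M.nrm_le_diff_add [of "f x" "f y"] M.nrm_diff_commute [of "f x" "f y"] fx fy
        by (simp add: mat_alg_diff)
      ultimately show ?thesis using le by (simp add: dist_real_def)
    qed
    ultimately show ?thesis
      using x \<open>e > 0\<close> by (intro exI [of _ "{y \<in> topspace X. ?g y \<in> {..<e}}"]) auto
  qed
  then show ?thesis
    using Met_TC.continuous_map_to_metric [of X "\<lambda>x. mat_opnorm (f x)"] by simp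
qed

lemma cont_mat_simps [simp]:
  "f \<otimes>\<^bsub>cont_mat X n\<^esub> g = (\<lambda>x\<in>topspace X. f x * g x)"
  "\<one>\<^bsub>cont_mat X n\<^esub> = (\<lambda>x\<in>topspace X. 1\<^sub>m n)"
  "\<zero>\<^bsub>cont_mat X n\<^esub> = (\<lambda>x\<in>topspace X. 0\<^sub>m n n)"
  "f \<oplus>\<^bsub>cont_mat X n\<^esub> g = (\<lambda>x\<in>topspace X. f x + g x)"
  "c \<odot>\<^bsub>cont_mat X n\<^esub> f = (\<lambda>x\<in>topspace X. c \<cdot>\<^sub>m f x)"
  "adj (cont_mat X n) f = (\<lambda>x\<in>topspace X. mat_adjoint (f x))"
  by (simp_all add: cont_mat_def)

lemma cont_mat_carrier_iff:
  "f \<in> carrier (cont_mat X n) \<longleftrightarrow> mat_continuous X n f \<and> f \<in> extensional (topspace X)"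
  by (auto simp: cont_mat_def mat_continuous_def PiE_iff)

lemma cont_mat_restrict:
  assumes "mat_continuous X n f" shows "restrict f (topspace X) \<in> carrier (cont_mat X n)"
  using mat_continuous_cong [OF assms, of "restrict f (topspace X)"] by (simp add: cont_mat_carrier_iff)

lemma cont_mat_carrierD:
  assumes "f \<in> carrier (cont_mat X n)"
  shows "mat_continuous X n f" "f \<in> extensional (topspace X)" "x \<in> topspace X \<Longrightarrow> f x \<in> carrier_mat n n"
  using assms by (auto simp: cont_mat_carrier_iff mat_continuous_def)

lemma cont_mat_eqI:
  assumes "f \<in> carrier (cont_mat X n)" "g \<in> carrier (cont_mat X n)"
    and "\<And>x. x \<in> topspace X \<Longrightarrow> f x = g x"
  shows "f = g"
  using assms by (auto simp: cont_mat_carrier_iff intro: extensionalityI)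

lemma cont_mat_nrm_le:
  assumes "0 \<le> c" "\<And>x. x \<in> topspace X \<Longrightarrow> mat_opnorm (f x) \<le> c"
  shows "nrm (cont_mat X n) f \<le> c"
  using assms by (auto simp: cont_mat_def intro!: cSup_least)

lemma cont_mat_bdd_above:
  assumes X: "compact_space X" and f: "mat_continuous X n f"
  shows "bdd_above (insert 0 ((\<lambda>x. mat_opnorm (f x)) ` topspace X))"
proof -
  have "compactin euclideanreal ((\<lambda>x. mat_opnorm (f x)) ` topspace X)"
    using X continuous_map_opnorm [OF f] unfolding compact_space_def by (rule image_compactin)
  then have "bounded ((\<lambda>x. mat_opnorm (f x)) ` topspace X)" by (simp add: compact_imp_bounded)
  then show ?thesis by (simp add: bounded_imp_bdd_above)
qed

lemma cont_mat_nrm_ub: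
  assumes "compact_space X" "f \<in> carrier (cont_mat X n)" "x \<in> topspace X"
  shows "mat_opnorm (f x) \<le> nrm (cont_mat X n) f"
  using cont_mat_bdd_above [OF assms(1) cont_mat_carrierD(1) [OF assms(2)]] assms(3)
  by (auto simp: cont_mat_def intro!: cSup_upper)

lemma cont_mat_nrm_nonneg:
  assumes "compact_space X" "f \<in> carrier (cont_mat X n)"
  shows "0 \<le> nrm (cont_mat X n) f"
  using cont_mat_bdd_above [OF assms(1) cont_mat_carrierD(1) [OF assms(2)]]
  by (auto simp: cont_mat_def intro!: cSup_upper)

text \<open>The evaluations at the points of the space embed the functions into a product of matrix
  algebras. A uniform limit is found pointwise and is continuous in each entry.\<close>

theorem cstar_algebra_cont_mat:
  assumes X: "compact_space X"
  shows "cstar_algebra (cont_mat X n)"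
proof (rule subdirect_cstar_algebra [where J = "topspace X" and B = "\<lambda>_. mat_alg n" and \<pi> = "\<lambda>x f. f x"])
  interpret M: cstar_algebra "mat_alg n" by (rule cstar_algebra_mat_alg)
  fix \<sigma> :: "nat \<Rightarrow> 'a \<Rightarrow> complex mat"
  assume \<sigma>: "\<And>k. \<sigma> k \<in> carrier (cont_mat X n)"
    and Cau: "\<And>e. e > 0 \<Longrightarrow> \<exists>N. \<forall>k\<ge>N. \<forall>m\<ge>N. \<forall>x\<in>topspace X.
      nrm (mat_alg n) (\<sigma> k x \<ominus>\<^bsub>mat_alg n\<^esub> \<sigma> m x) < e"
  have \<sigma>x: "\<sigma> k x \<in> carrier (mat_alg n)" if "x \<in> topspace X" for k x
    using cont_mat_carrierD(3) [OF \<sigma> that] by simp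
  have "\<exists>l\<in>carrier (mat_alg n). \<forall>e>0. \<exists>N. \<forall>k\<ge>N. nrm (mat_alg n) (\<sigma> k x \<ominus>\<^bsub>mat_alg n\<^esub> l) < e"
    if x: "x \<in> topspace X" for x
  proof (rule M.Cauchy_converges [of "\<lambda>k. \<sigma> k x"])
    show "\<sigma> k x \<in> carrier (mat_alg n)" for k using x by (rule \<sigma>x)
    show "\<exists>N. \<forall>k\<ge>N. \<forall>m\<ge>N. nrm (mat_alg n) (\<sigma> k x \<ominus>\<^bsub>mat_alg n\<^esub> \<sigma> m x) < e" if "e > 0" for e
      using Cau [OF that] x by blast
  qed blast
  then obtain l where l: "\<And>x. x \<in> topspace X \<Longrightarrow> l x \<in> carrier (mat_alg n)"
    and lim: "\<And>x e. \<lbrakk>x \<in> topspace X; e > 0\<rbrakk> \<Longrightarrow> \<exists>N. \<forall>k\<ge>N. nrm (mat_alg n) (\<sigma> k x \<ominus>\<^bsub>mat_alg n\<^esub> l x) < e"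
    by metis
  have unif: "\<exists>N. \<forall>k\<ge>N. \<forall>x\<in>topspace X. nrm (mat_alg n) (\<sigma> k x \<ominus>\<^bsub>mat_alg n\<^esub> l x) \<le> e" if "e > 0" for e
  proof -
    obtain N where N: "\<forall>k\<ge>N. \<forall>m\<ge>N. \<forall>x\<in>topspace X. nrm (mat_alg n) (\<sigma> k x \<ominus>\<^bsub>mat_alg n\<^esub> \<sigma> m x) < e"
      using Cau [OF \<open>e > 0\<close>] by blast
    have "nrm (mat_alg n) (\<sigma> k x \<ominus>\<^bsub>mat_alg n\<^esub> l x) \<le> e" if k: "k \<ge> N" and x: "x \<in> topspace X" for k x
    proof (rule field_le_epsilon)
      fix d :: real assume "d > 0"
      then obtain N' where N': "\<forall>k\<ge>N'. nrm (mat_alg n) (\<sigma> k x \<ominus>\<^bsub>mat_alg n\<^esub> l x) < d"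
        using lim [OF x] by blast
      define m where "m = max N N'"
      have "nrm (mat_alg n) (\<sigma> k x \<ominus>\<^bsub>mat_alg n\<^esub> l x)
          \<le> nrm (mat_alg n) (\<sigma> k x \<ominus>\<^bsub>mat_alg n\<^esub> \<sigma> m x) + nrm (mat_alg n) (\<sigma> m x \<ominus>\<^bsub>mat_alg n\<^esub> l x)"
        by (intro M.nrm_diff_triangle \<sigma>x l x)
      also have "\<dots> \<le> e + d"
        using N N' k x by (intro add_mono less_imp_le) (auto simp: m_def)
      finally show "nrm (mat_alg n) (\<sigma> k x \<ominus>\<^bsub>mat_alg n\<^esub> l x) \<le> e + d" .
    qed
    then show ?thesis by blast
  qed
  have "mat_continuous X n l"
    unfolding mat_continuous_def
  proof (intro conjI allI impI)
    fix i j assume ij: "i < n" "j < n"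
    have "continuous_map X Met_TC.mtopology (\<lambda>x. l x $$ (i, j))"
    proof (rule Met_TC.continuous_map_uniform_limit_alt)
      show "\<forall>\<^sub>F k in sequentially. continuous_map X Met_TC.mtopology (\<lambda>x. \<sigma> k x $$ (i, j))"
        using mat_continuousD(2) [OF cont_mat_carrierD(1) [OF \<sigma>] ij] by simp
      fix e :: real assume "e > 0"
      then obtain N where N: "\<forall>k\<ge>N. \<forall>x\<in>topspace X. nrm (mat_alg n) (\<sigma> k x \<ominus>\<^bsub>mat_alg n\<^esub> l x) \<le> e/2"
        using unif [of "e/2"] by auto
      have "dist (\<sigma> k x $$ (i, j)) (l x $$ (i, j)) < e" if k: "k \<ge> N" and x: "x \<in> topspace X" for k x
      proof -
        have c: "\<sigma> k x \<in> carrier_mat n n" "l x \<in> carrier_mat n n"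
          using \<sigma>x [OF x] l [OF x] by auto
        have "dist (\<sigma> k x $$ (i, j)) (l x $$ (i, j)) = cmod ((\<sigma> k x - l x) $$ (i, j))"
          using ij carrier_matD [OF c(2)] by (simp add: dist_norm)
        also have "\<dots> \<le> mat_opnorm (\<sigma> k x - l x)"
          using ij c by (intro mat_entry_le_opnorm [where n = n]) (auto simp: minus_carrier_mat)
        also have "\<dots> \<le> e/2" using N [rule_format, OF k x] mat_alg_diff [OF c] by simp
        also have "\<dots> < e" using \<open>e > 0\<close> by simp
        finally show ?thesis .
      qed
      then show "\<forall>\<^sub>F k in sequentially. \<forall>x\<in>topspace X. dist (\<sigma> k x $$ (i, j)) (l x $$ (i, j)) < e"
        unfolding eventually_sequentially by blast
    qed auto
    then show "continuous_map X euclidean (\<lambda>x. l x $$ (i, j))" by simp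
  qed (use l in simp)
  then have "restrict l (topspace X) \<in> carrier (cont_mat X n)" by (rule cont_mat_restrict)
  then show "\<exists>l\<in>carrier (cont_mat X n). \<forall>e>0. \<exists>N. \<forall>k\<ge>N. \<forall>x\<in>topspace X.
      nrm (mat_alg n) (\<sigma> k x \<ominus>\<^bsub>mat_alg n\<^esub> l x) \<le> e"
    using unif by (intro bexI [of _ "restrict l (topspace X)"]) auto
next
  fix f g assume "f \<in> carrier (cont_mat X n)" "g \<in> carrier (cont_mat X n)"
  then have fg: "mat_continuous X n f" "mat_continuous X n g" by (auto simp: cont_mat_carrier_iff)
  show "f \<oplus>\<^bsub>cont_mat X n\<^esub> g \<in> carrier (cont_mat X n)"
    using cont_mat_restrict [OF mat_continuous_add [OF fg]] by simp
  show "f \<otimes>\<^bsub>cont_mat X n\<^esub> g \<in> carrier (cont_mat X n)"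
    using cont_mat_restrict [OF mat_continuous_mult [OF fg]] by simp
  show "adj (cont_mat X n) f \<in> carrier (cont_mat X n)"
    using cont_mat_restrict [OF mat_continuous_adjoint [OF fg(1)]] by simp
  fix c
  show "c \<odot>\<^bsub>cont_mat X n\<^esub> f \<in> carrier (cont_mat X n)"
    using cont_mat_restrict [OF mat_continuous_smult [OF _ fg(1), of "\<lambda>_. c"]] by simp
next
  show "\<one>\<^bsub>cont_mat X n\<^esub> \<in> carrier (cont_mat X n)"
    using cont_mat_restrict [OF mat_continuous_const [of "1\<^sub>m n" n X]] by simp
  show "\<zero>\<^bsub>cont_mat X n\<^esub> \<in> carrier (cont_mat X n)"
    using cont_mat_restrict [OF mat_continuous_const [of "0\<^sub>m n n" n X]] by simp
next
  show "cstar_algebra (mat_alg n)" by (rule cstar_algebra_mat_alg)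
next
  fix f c assume "f \<in> carrier (cont_mat X n)" "0 \<le> c"
    "\<And>x. x \<in> topspace X \<Longrightarrow> nrm (mat_alg n) (f x) \<le> c"
  then show "nrm (cont_mat X n) f \<le> c" by (intro cont_mat_nrm_le) auto
next
  fix f g assume "f \<in> carrier (cont_mat X n)" "g \<in> carrier (cont_mat X n)"
    "\<And>x. x \<in> topspace X \<Longrightarrow> f x = g x"
  then show "f = g" by (rule cont_mat_eqI)
qed (simp_all add: cont_mat_nrm_nonneg [OF X] cont_mat_nrm_ub [OF X] cont_mat_carrierD)

lemma cont_mat_diff:
  assumes X: "compact_space X" and f: "f \<in> carrier (cont_mat X n)" and g: "g \<in> carrier (cont_mat X n)"
  shows "f \<ominus>\<^bsub>cont_mat X n\<^esub> g = (\<lambda>x\<in>topspace X. f x - g x)"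
proof -
  interpret cstar_algebra "cont_mat X n" using X by (rule cstar_algebra_cont_mat)
  show ?thesis
  proof (rule cont_mat_eqI)
    show "f \<ominus>\<^bsub>cont_mat X n\<^esub> g \<in> carrier (cont_mat X n)" using f g by simp
    show "(\<lambda>x\<in>topspace X. f x - g x) \<in> carrier (cont_mat X n)"
      using f g by (intro cont_mat_restrict mat_continuous_diff cont_mat_carrierD)
    fix x assume x: "x \<in> topspace X"
    have c: "f x \<in> carrier_mat n n" "g x \<in> carrier_mat n n"
      using x f g by (auto intro: cont_mat_carrierD)
    have "f x + (-1) \<cdot>\<^sub>m g x = f x - g x"
      using carrier_matD [OF c(1)] carrier_matD [OF c(2)] by (intro eq_matI) auto
    then show "(f \<ominus>\<^bsub>cont_mat X n\<^esub> g) x = (\<lambda>x\<in>topspace X. f x - g x) x"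
      using x g by (simp add: a_minus_def minus_eq_smult)
  qed
qed

lemma restrict_star_hom:
  assumes "S \<subseteq> topspace X"
  shows "(\<lambda>f. restrict f S) \<in> unital_star_hom (cont_mat X n) (cont_mat (subtopology X S) n)"
proof -
  have S: "topspace (subtopology X S) = S" using assms by auto
  have "restrict f S \<in> carrier (cont_mat (subtopology X S) n)" if "f \<in> carrier (cont_mat X n)" for f
    using cont_mat_restrict [OF mat_continuous_subtopology [OF cont_mat_carrierD(1) [OF that], of S]]
    by (simp only: S)
  then show ?thesis
    using assms unfolding unital_star_hom_def
    by (auto simp: S subset_iff intro!: ring_hom_memI restrict_ext)
qed

section \<open>Recursive subhomogeneous algebras are C*-algebras\<close>

lemma stage_carrier_length: "a \<in> stage_carrier D k \<Longrightarrow> length a = Suc k"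
  by (induction k arbitrary: a) auto

lemma stage_carrier_nth:
  "\<lbrakk>a \<in> stage_carrier D k; i \<le> k\<rbrakk> \<Longrightarrow> a ! i \<in> carrier (level_alg D i)"
proof (induction k arbitrary: a)
  case (Suc k)
  then obtain b f where b: "a = b @ [f]" "b \<in> stage_carrier D k" "f \<in> carrier (level_alg D (Suc k))"
    by auto
  then show ?case
    using Suc stage_carrier_length [OF b(2)] by (cases "i = Suc k") (auto simp: nth_append)
qed auto

lemma stage_carrier_nthI:
  assumes "a \<in> stage_carrier D k" "b \<in> stage_carrier D k" "\<And>i. i \<le> k \<Longrightarrow> a ! i = b ! i"
  shows "a = b"
  using assms stage_carrier_length [OF assms(1)] stage_carrier_length [OF assms(2)]
  by (intro nth_equalityI) auto

lemma stage_alg_carrier [simp]: "carrier (stage_alg D k) = stage_carrier D k"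
  by (simp add: stage_alg_def)

lemma stage_alg_nth:
  assumes "i \<le> k"
  shows "(a \<otimes>\<^bsub>stage_alg D k\<^esub> b) ! i = a ! i \<otimes>\<^bsub>level_alg D i\<^esub> b ! i"
    and "(a \<oplus>\<^bsub>stage_alg D k\<^esub> b) ! i = a ! i \<oplus>\<^bsub>level_alg D i\<^esub> b ! i"
    and "(c \<odot>\<^bsub>stage_alg D k\<^esub> a) ! i = c \<odot>\<^bsub>level_alg D i\<^esub> a ! i"
    and "adj (stage_alg D k) a ! i = adj (level_alg D i) (a ! i)"
    and "\<one>\<^bsub>stage_alg D k\<^esub> ! i = \<one>\<^bsub>level_alg D i\<^esub>"
    and "\<zero>\<^bsub>stage_alg D k\<^esub> ! i = \<zero>\<^bsub>level_alg D i\<^esub>"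
  using assms by (simp_all add: stage_alg_def nth_append del: upt_Suc)

lemma stage_alg_append:
  assumes "length a = Suc k" "length b = Suc k"
  shows "(a @ [f]) \<otimes>\<^bsub>stage_alg D (Suc k)\<^esub> (b @ [g]) = (a \<otimes>\<^bsub>stage_alg D k\<^esub> b) @ [f \<otimes>\<^bsub>level_alg D (Suc k)\<^esub> g]"
    and "(a @ [f]) \<oplus>\<^bsub>stage_alg D (Suc k)\<^esub> (b @ [g]) = (a \<oplus>\<^bsub>stage_alg D k\<^esub> b) @ [f \<oplus>\<^bsub>level_alg D (Suc k)\<^esub> g]"
    and "c \<odot>\<^bsub>stage_alg D (Suc k)\<^esub> (a @ [f]) = (c \<odot>\<^bsub>stage_alg D k\<^esub> a) @ [c \<odot>\<^bsub>level_alg D (Suc k)\<^esub> f]"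
    and "adj (stage_alg D (Suc k)) (a @ [f]) = adj (stage_alg D k) a @ [adj (level_alg D (Suc k)) f]"
    and "\<one>\<^bsub>stage_alg D (Suc k)\<^esub> = \<one>\<^bsub>stage_alg D k\<^esub> @ [\<one>\<^bsub>level_alg D (Suc k)\<^esub>]"
    and "\<zero>\<^bsub>stage_alg D (Suc k)\<^esub> = \<zero>\<^bsub>stage_alg D k\<^esub> @ [\<zero>\<^bsub>level_alg D (Suc k)\<^esub>]"
  using assms by (auto simp: stage_alg_def nth_append)

lemma stage_alg_0:
  "[f] \<otimes>\<^bsub>stage_alg D 0\<^esub> [g] = [f \<otimes>\<^bsub>level_alg D 0\<^esub> g]"
  "[f] \<oplus>\<^bsub>stage_alg D 0\<^esub> [g] = [f \<oplus>\<^bsub>level_alg D 0\<^esub> g]"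
  "c \<odot>\<^bsub>stage_alg D 0\<^esub> [f] = [c \<odot>\<^bsub>level_alg D 0\<^esub> f]"
  "adj (stage_alg D 0) [f] = [adj (level_alg D 0) f]"
  "\<one>\<^bsub>stage_alg D 0\<^esub> = [\<one>\<^bsub>level_alg D 0\<^esub>]"
  "\<zero>\<^bsub>stage_alg D 0\<^esub> = [\<zero>\<^bsub>level_alg D 0\<^esub>]"
  by (simp_all add: stage_alg_def)

lemma stage_nrm_le_iff: "nrm (stage_alg D k) a \<le> c \<longleftrightarrow> (\<forall>i\<le>k. nrm (level_alg D i) (a ! i) \<le> c)"
  by (auto simp: stage_alg_def)

lemma stage_nrm_ub: "i \<le> k \<Longrightarrow> nrm (level_alg D i) (a ! i) \<le> nrm (stage_alg D k) a"
  using stage_nrm_le_iff [of D k a "nrm (stage_alg D k) a"] by simp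

locale rsh =
  fixes D :: "'x rsh_data"
  assumes valid: "rsh_data_valid D"
begin

lemma level:
  assumes "k \<le> len D"
  shows compact_base: "compact_space (base D k)" and Hausdorff_base: "Hausdorff_space (base D k)"
    and msize_pos: "1 \<le> msize D k"
  using valid assms by (auto simp: rsh_data_valid_def)

lemma normal_base: "k \<le> len D \<Longrightarrow> normal_space (base D k)"
  by (simp add: level compact_Hausdorff_or_regular_imp_normal_space)

lemma attach_closed: "Suc k \<le> len D \<Longrightarrow> closedin (base D (Suc k)) (attach D (Suc k))"
  using valid by (auto simp: rsh_data_valid_def)

lemma attach_subset: "Suc k \<le> len D \<Longrightarrow> attach D (Suc k) \<subseteq> topspace (base D (Suc k))"
  using attach_closed closedin_subset by blast

lemma topspace_attach:
  "Suc k \<le> len D \<Longrightarrow> topspace (subtopology (base D (Suc k)) (attach D (Suc k))) = attach D (Suc k)"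
  using attach_subset by fastforce

lemma glue_hom:
  "Suc k \<le> len D \<Longrightarrow> glue D (Suc k) \<in> unital_star_hom (stage_alg D k) (attach_alg D (Suc k))"
  using valid by (auto simp: rsh_data_valid_def)

lemma restrict_attach_hom:
  "Suc k \<le> len D \<Longrightarrow>
    (\<lambda>f. restrict f (attach D (Suc k))) \<in> unital_star_hom (level_alg D (Suc k)) (attach_alg D (Suc k))"
  unfolding level_alg_def attach_alg_def by (intro restrict_star_hom attach_subset)

lemma cstar_level: "k \<le> len D \<Longrightarrow> cstar_algebra (level_alg D k)"
  by (simp add: level_alg_def cstar_algebra_cont_mat level)

lemma compact_attach:
  "Suc k \<le> len D \<Longrightarrow> compact_space (subtopology (base D (Suc k)) (attach D (Suc k)))"
  by (simp add: closedin_compact_space compact_space_subtopology attach_closed level)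

lemma cstar_attach: "Suc k \<le> len D \<Longrightarrow> cstar_algebra (attach_alg D (Suc k))"
  by (simp add: attach_alg_def cstar_algebra_cont_mat compact_attach)

text \<open>Both the gluing map and the restriction are homomorphisms, so the condition defining the
  pullback is preserved by all operations.\<close>

lemma stage_closed:
  assumes "k \<le> len D"
  shows "\<one>\<^bsub>stage_alg D k\<^esub> \<in> stage_carrier D k \<and> \<zero>\<^bsub>stage_alg D k\<^esub> \<in> stage_carrier D k \<and>
    (\<forall>a\<in>stage_carrier D k. \<forall>b\<in>stage_carrier D k. \<forall>c.
      a \<otimes>\<^bsub>stage_alg D k\<^esub> b \<in> stage_carrier D k \<and> a \<oplus>\<^bsub>stage_alg D k\<^esub> b \<in> stage_carrier D k \<and>
      c \<odot>\<^bsub>stage_alg D k\<^esub> a \<in> stage_carrier D k \<and> adj (stage_alg D k) a \<in> stage_carrier D k)"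
  using assms
proof (induction k)
  case 0
  interpret L: cstar_algebra "level_alg D 0" by (rule cstar_level) simp
  show ?case by (auto simp: stage_alg_0)
next
  case (Suc k)
  let ?S' = "stage_alg D (Suc k)" and ?S = "stage_alg D k" and ?L = "level_alg D (Suc k)" and ?B = "attach_alg D (Suc k)"
  interpret L: cstar_algebra ?L by (rule cstar_level) (rule Suc.prems)
  interpret B: cstar_algebra ?B by (rule cstar_attach) (rule Suc.prems)
  note h = star_homD [OF glue_hom [OF Suc.prems]]
  note r = star_homD [OF restrict_attach_hom [OF Suc.prems]]
  have k: "k \<le> len D" using Suc.prems by simp
  note IH = Suc.IH [OF k]
  show ?case
  proof (intro conjI ballI allI)
    have "length (replicate (Suc k) undefined) = Suc k" by simp
    note app = stage_alg_append(5,6) [OF this this]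
    show "\<one>\<^bsub>?S'\<^esub> \<in> stage_carrier D (Suc k)"
      unfolding app using IH h(4) r(4) by auto
    have "glue D (Suc k) (0 \<odot>\<^bsub>?S\<^esub> \<one>\<^bsub>?S\<^esub>) = 0 \<odot>\<^bsub>?B\<^esub> \<one>\<^bsub>?B\<^esub>"
      using h(4) h(5) [of "\<one>\<^bsub>?S\<^esub>" 0] IH by simp
    moreover have "0 \<odot>\<^bsub>?S\<^esub> \<one>\<^bsub>?S\<^esub> = \<zero>\<^bsub>?S\<^esub>"
    proof (rule stage_carrier_nthI [of _ D k])
      fix i assume i: "i \<le> k"
      interpret Li: cstar_algebra "level_alg D i" by (rule cstar_level) (use i k in simp)
      show "(0 \<odot>\<^bsub>?S\<^esub> \<one>\<^bsub>?S\<^esub>) ! i = \<zero>\<^bsub>?S\<^esub> ! i"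
        using i Li.smult_l_null [of "\<one>\<^bsub>level_alg D i\<^esub>"] by (simp add: stage_alg_nth)
    qed (use IH in auto)
    moreover have "0 \<odot>\<^bsub>?B\<^esub> \<one>\<^bsub>?B\<^esub> = \<zero>\<^bsub>?B\<^esub>"
      using B.smult_l_null [of "\<one>\<^bsub>?B\<^esub>"] by simp
    moreover have "restrict \<zero>\<^bsub>?L\<^esub> (attach D (Suc k)) = \<zero>\<^bsub>?B\<^esub>"
      using r(5) [of "\<one>\<^bsub>?L\<^esub>" 0] r(4) L.smult_l_null [of "\<one>\<^bsub>?L\<^esub>"]
        B.smult_l_null [of "\<one>\<^bsub>?B\<^esub>"] by simp
    ultimately show "\<zero>\<^bsub>?S'\<^esub> \<in> stage_carrier D (Suc k)"
      unfolding app using IH by auto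
  next
    fix a b c assume a: "a \<in> stage_carrier D (Suc k)" and b: "b \<in> stage_carrier D (Suc k)"
    obtain a' f where a: "a = a' @ [f]" and a': "a' \<in> stage_carrier D k" "f \<in> carrier ?L"
      "glue D (Suc k) a' = restrict f (attach D (Suc k))" using a by auto
    obtain b' g where b: "b = b' @ [g]" and b': "b' \<in> stage_carrier D k" "g \<in> carrier ?L"
      "glue D (Suc k) b' = restrict g (attach D (Suc k))" using b by auto
    note app = stage_alg_append [OF stage_carrier_length [OF a'(1)] stage_carrier_length [OF b'(1)]]
    have IH': "a' \<otimes>\<^bsub>?S\<^esub> b' \<in> stage_carrier D k" "a' \<oplus>\<^bsub>?S\<^esub> b' \<in> stage_carrier D k"
      "c \<odot>\<^bsub>?S\<^esub> a' \<in> stage_carrier D k" "adj ?S a' \<in> stage_carrier D k"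
      using IH a' b' by auto
    show "a \<otimes>\<^bsub>?S'\<^esub> b \<in> stage_carrier D (Suc k)"
      unfolding a b app using IH' a' b' h(3) r(3) by auto
    show "a \<oplus>\<^bsub>?S'\<^esub> b \<in> stage_carrier D (Suc k)"
      unfolding a b app using IH' a' b' h(2) r(2) by auto
    show "c \<odot>\<^bsub>?S'\<^esub> a \<in> stage_carrier D (Suc k)"
      unfolding a app using IH' a' h(5) r(5) by auto
    show "adj ?S' a \<in> stage_carrier D (Suc k)"
      unfolding a app using IH' a' h(6) r(6) by auto
  qed
qed

lemma cstar_stageI:
  assumes k: "k \<le> len D"
    and compl: "\<And>\<sigma> :: nat \<Rightarrow> ('x \<Rightarrow> complex mat) list. \<lbrakk>\<And>m. \<sigma> m \<in> stage_carrier D k;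
        \<And>e. e > 0 \<Longrightarrow> \<exists>N. \<forall>m\<ge>N. \<forall>n\<ge>N. \<forall>i\<in>{..k}.
          nrm (level_alg D i) (\<sigma> m ! i \<ominus>\<^bsub>level_alg D i\<^esub> \<sigma> n ! i) < e\<rbrakk>
        \<Longrightarrow> \<exists>l\<in>stage_carrier D k. \<forall>e>0. \<exists>N. \<forall>n\<ge>N. \<forall>i\<in>{..k}.
          nrm (level_alg D i) (\<sigma> n ! i \<ominus>\<^bsub>level_alg D i\<^esub> l ! i) \<le> e"
  shows "cstar_algebra (stage_alg D k)"
proof (rule subdirect_cstar_algebra [where J = "{..k}" and B = "level_alg D" and \<pi> = "\<lambda>i a. a ! i"])
  show "cstar_algebra (level_alg D i)" if "i \<in> {..k}" for i
    using that k by (intro cstar_level) auto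
  show "0 \<le> nrm (stage_alg D k) a" if "a \<in> carrier (stage_alg D k)" for a
  proof -
    have "0 \<le> nrm (level_alg D 0) (a ! 0)"
      using that stage_carrier_nth [of a D k 0] cont_mat_nrm_nonneg level(1) [of 0]
      by (auto simp: level_alg_def)
    then show ?thesis using stage_nrm_ub [of 0 k D a] by simp
  qed
  show "x = y" if "x \<in> carrier (stage_alg D k)" "y \<in> carrier (stage_alg D k)"
    "\<And>i. i \<in> {..k} \<Longrightarrow> x ! i = y ! i" for x y
    using that by (intro stage_carrier_nthI [of x D k]) auto
qed (use stage_closed [OF k] compl in \<open>auto simp: stage_alg_nth stage_nrm_ub stage_nrm_le_iff stage_carrier_nth\<close>)

lemma nth_star_hom:
  assumes "k \<le> len D" "i \<le> k"
  shows "(\<lambda>a. a ! i) \<in> unital_star_hom (stage_alg D k) (level_alg D i)"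
  using assms unfolding unital_star_hom_def
  by (auto simp: stage_alg_nth intro!: ring_hom_memI stage_carrier_nth)

text \<open>Completeness of a pullback needs that the gluing maps are continuous, which
  \<open>star_hom_contractive\<close> supplies from the completeness of the previous stage.\<close>

theorem cstar_stage: "k \<le> len D \<Longrightarrow> cstar_algebra (stage_alg D k)"
proof (induction k)
  case 0
  show ?case
  proof (rule cstar_stageI)
    interpret L: cstar_algebra "level_alg D 0" by (rule cstar_level) simp
    fix \<sigma> :: "nat \<Rightarrow> ('x \<Rightarrow> complex mat) list"
    assume \<sigma>: "\<And>m. \<sigma> m \<in> stage_carrier D 0"
      and Cau: "\<And>e. e > 0 \<Longrightarrow> \<exists>N. \<forall>m\<ge>N. \<forall>n\<ge>N. \<forall>i\<in>{..0}.
          nrm (level_alg D i) (\<sigma> m ! i \<ominus>\<^bsub>level_alg D i\<^esub> \<sigma> n ! i) < e"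
    obtain l where l: "l \<in> carrier (level_alg D 0)"
      and lim: "\<And>e. e > 0 \<Longrightarrow> \<exists>N. \<forall>n\<ge>N. nrm (level_alg D 0) (\<sigma> n ! 0 \<ominus>\<^bsub>level_alg D 0\<^esub> l) < e"
    proof (rule L.Cauchy_converges [of "\<lambda>n. \<sigma> n ! 0"])
      show "\<sigma> n ! 0 \<in> carrier (level_alg D 0)" for n
        using stage_carrier_nth [OF \<sigma>] by simp
      show "\<exists>N. \<forall>m\<ge>N. \<forall>n\<ge>N. nrm (level_alg D 0) (\<sigma> m ! 0 \<ominus>\<^bsub>level_alg D 0\<^esub> \<sigma> n ! 0) < e"
        if "e > 0" for e using Cau [OF that] by simp
    qed (blast intro: that)
    have "\<exists>N. \<forall>n\<ge>N. nrm (level_alg D 0) (\<sigma> n ! 0 \<ominus>\<^bsub>level_alg D 0\<^esub> l) \<le> e" if "e > 0" for e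
      using lim [OF that] by (meson less_imp_le)
    then show "\<exists>l\<in>stage_carrier D 0. \<forall>e>0. \<exists>N. \<forall>n\<ge>N. \<forall>i\<in>{..0}.
          nrm (level_alg D i) (\<sigma> n ! i \<ominus>\<^bsub>level_alg D i\<^esub> l ! i) \<le> e"
      using l by (intro bexI [of _ "[l]"]) auto
  qed simp
next
  case (Suc k)
  let ?S = "stage_alg D k" and ?L = "level_alg D (Suc k)" and ?B = "attach_alg D (Suc k)"
  have k: "Suc k \<le> len D" by (rule Suc.prems)
  then have "k \<le> len D" by simp
  interpret S: cstar_algebra ?S using Suc by simp
  interpret L: cstar_algebra ?L using k by (rule cstar_level)
  interpret B: cstar_algebra ?B using k by (rule cstar_attach)
  show ?case
  proof (rule cstar_stageI [OF k])
    fix \<sigma> :: "nat \<Rightarrow> ('x \<Rightarrow> complex mat) list"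
    assume \<sigma>: "\<And>m. \<sigma> m \<in> stage_carrier D (Suc k)"
      and Cau: "\<And>e. e > 0 \<Longrightarrow> \<exists>N. \<forall>m\<ge>N. \<forall>n\<ge>N. \<forall>i\<in>{..Suc k}.
          nrm (level_alg D i) (\<sigma> m ! i \<ominus>\<^bsub>level_alg D i\<^esub> \<sigma> n ! i) < e"
    have "\<forall>m. \<exists>a f. \<sigma> m = a @ [f] \<and> a \<in> stage_carrier D k \<and> f \<in> carrier ?L \<and>
        glue D (Suc k) a = restrict f (attach D (Suc k))"
      using \<sigma> by auto
    then obtain \<tau> \<phi> where eq: "\<And>m. \<sigma> m = \<tau> m @ [\<phi> m]" and \<tau>: "\<And>m. \<tau> m \<in> stage_carrier D k"
      and \<phi>: "\<And>m. \<phi> m \<in> carrier ?L"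
      and glue: "\<And>m. glue D (Suc k) (\<tau> m) = restrict (\<phi> m) (attach D (Suc k))"
      by metis
    have nth: "\<sigma> m ! i = \<tau> m ! i" if "i \<le> k" for i m
      using stage_carrier_length [OF \<tau> [of m]] that by (simp add: eq nth_append)
    have last: "\<sigma> m ! Suc k = \<phi> m" for m
      using stage_carrier_length [OF \<tau> [of m]] by (simp add: eq nth_append)
    have diff_nth: "(a \<ominus>\<^bsub>?S\<^esub> b) ! i = a ! i \<ominus>\<^bsub>level_alg D i\<^esub> b ! i"
      if "i \<le> k" "a \<in> stage_carrier D k" "b \<in> stage_carrier D k" for a b i
    proof -
      have "cstar_algebra (level_alg D i)" using that \<open>k \<le> len D\<close> by (intro cstar_level) simp
      from star_hom_diff [OF S.cstar_algebra_axioms this nth_star_hom [OF \<open>k \<le> len D\<close> that(1)], of a b]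
      show ?thesis using that by simp
    qed
    obtain a where a: "a \<in> carrier ?S" and lim_a:
      "\<And>e. e > 0 \<Longrightarrow> \<exists>N. \<forall>n\<ge>N. nrm ?S (\<tau> n \<ominus>\<^bsub>?S\<^esub> a) < e"
    proof (rule S.Cauchy_converges [of \<tau>])
      show "\<tau> n \<in> carrier ?S" for n using \<tau> by simp
      fix e :: real assume "e > 0"
      then obtain N where "\<forall>m\<ge>N. \<forall>n\<ge>N. \<forall>i\<in>{..Suc k}.
          nrm (level_alg D i) (\<sigma> m ! i \<ominus>\<^bsub>level_alg D i\<^esub> \<sigma> n ! i) < e/2"
        using Cau [of "e/2"] half_gt_zero by blast
      then have N: "\<And>m n i. \<lbrakk>m \<ge> N; n \<ge> N; i \<le> k\<rbrakk>
          \<Longrightarrow> nrm (level_alg D i) (\<tau> m ! i \<ominus>\<^bsub>level_alg D i\<^esub> \<tau> n ! i) < e/2"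
        by (metis atMost_iff le_SucI nth)
      have "nrm ?S (\<tau> m \<ominus>\<^bsub>?S\<^esub> \<tau> n) \<le> e/2" if "m \<ge> N" "n \<ge> N" for m n
        unfolding stage_nrm_le_iff using N that \<tau> by (auto simp: diff_nth intro: less_imp_le)
      then show "\<exists>N. \<forall>m\<ge>N. \<forall>n\<ge>N. nrm ?S (\<tau> m \<ominus>\<^bsub>?S\<^esub> \<tau> n) < e"
        using \<open>e > 0\<close> by (intro exI [of _ N]) force
    qed (blast intro: that)
    obtain f where f: "f \<in> carrier ?L" and lim_f:
      "\<And>e. e > 0 \<Longrightarrow> \<exists>N. \<forall>n\<ge>N. nrm ?L (\<phi> n \<ominus>\<^bsub>?L\<^esub> f) < e"
    proof (rule L.Cauchy_converges [of \<phi>, OF \<phi>])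
      fix e :: real assume "e > 0"
      then show "\<exists>N. \<forall>m\<ge>N. \<forall>n\<ge>N. nrm ?L (\<phi> m \<ominus>\<^bsub>?L\<^esub> \<phi> n) < e"
        using Cau [of e] by (simp add: last flip: atMost_iff) (metis atMost_iff last order_refl)
    qed (blast intro: that)
    let ?r = "\<lambda>f. restrict f (attach D (Suc k))"
    let ?g = "glue D (Suc k)"
    note gl = star_homD [OF glue_hom [OF k]] star_homD [OF restrict_attach_hom [OF k]]
    have "?g a \<ominus>\<^bsub>?B\<^esub> ?r f = \<zero>\<^bsub>?B\<^esub>"
    proof (rule B.eq_zero_if_nrm_le)
      fix e :: real assume "e > 0"
      obtain N where N: "\<forall>n\<ge>N. nrm ?S (\<tau> n \<ominus>\<^bsub>?S\<^esub> a) < e"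
        using lim_a [OF \<open>e > 0\<close>] by blast
      obtain N' where N': "\<forall>n\<ge>N'. nrm ?L (\<phi> n \<ominus>\<^bsub>?L\<^esub> f) < e"
        using lim_f [OF \<open>e > 0\<close>] by blast
      define n where "n = max N N'"
      have n: "nrm ?S (\<tau> n \<ominus>\<^bsub>?S\<^esub> a) < e"
        "nrm ?L (\<phi> n \<ominus>\<^bsub>?L\<^esub> f) < e"
        using N N' by (auto simp: n_def)
      have "nrm ?B (?g (\<tau> n) \<ominus>\<^bsub>?B\<^esub> ?g a)
          \<le> nrm ?S (\<tau> n \<ominus>\<^bsub>?S\<^esub> a)"
        using \<tau> [of n] a
        by (intro star_hom_dist [OF S.cstar_algebra_axioms B.cstar_algebra_axioms glue_hom [OF k]]) auto
      moreover have "nrm ?B (?r (\<phi> n) \<ominus>\<^bsub>?B\<^esub> ?r f)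
          \<le> nrm ?L (\<phi> n \<ominus>\<^bsub>?L\<^esub> f)"
        using \<phi> [of n] f
        by (intro star_hom_dist [OF L.cstar_algebra_axioms B.cstar_algebra_axioms restrict_attach_hom [OF k]]) auto
      moreover have "nrm ?B (?g a \<ominus>\<^bsub>?B\<^esub> ?r f)
          \<le> nrm ?B (?g a \<ominus>\<^bsub>?B\<^esub> ?g (\<tau> n))
            + nrm ?B (?g (\<tau> n) \<ominus>\<^bsub>?B\<^esub> ?r f)"
        using gl(1) [of a] gl(1) [of "\<tau> n"] gl(7) [OF f] a \<tau> by (intro B.nrm_diff_triangle) auto
      moreover have "nrm ?B (?g a \<ominus>\<^bsub>?B\<^esub> ?g (\<tau> n))
          = nrm ?B (?g (\<tau> n) \<ominus>\<^bsub>?B\<^esub> ?g a)"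
        using gl(1) [of a] gl(1) [of "\<tau> n"] a \<tau> by (intro B.nrm_diff_commute) auto
      ultimately show "nrm ?B (?g a \<ominus>\<^bsub>?B\<^esub> ?r f) \<le> 2 * e"
        using n by (simp add: glue)
    qed (use gl(1) [of a] gl(7) [OF f] a in auto)
    then have "?g a = ?r f" using gl(1) [of a] gl(7) [OF f] a by simp
    then have mem: "a @ [f] \<in> stage_carrier D (Suc k)" using a f by auto
    have "\<exists>N. \<forall>n\<ge>N. \<forall>i\<in>{..Suc k}.
          nrm (level_alg D i) (\<sigma> n ! i \<ominus>\<^bsub>level_alg D i\<^esub> (a @ [f]) ! i) \<le> e" if "e > 0" for e
    proof -
      obtain N where N: "\<forall>n\<ge>N. nrm ?S (\<tau> n \<ominus>\<^bsub>?S\<^esub> a) < e"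
        using lim_a [OF \<open>e > 0\<close>] by blast
      obtain N' where N': "\<forall>n\<ge>N'. nrm ?L (\<phi> n \<ominus>\<^bsub>?L\<^esub> f) < e"
        using lim_f [OF \<open>e > 0\<close>] by blast
      have la: "length a = Suc k" using a stage_carrier_length by auto
      have "nrm (level_alg D i) (\<sigma> n ! i \<ominus>\<^bsub>level_alg D i\<^esub> (a @ [f]) ! i) \<le> e"
        if n: "n \<ge> max N N'" and i: "i \<le> Suc k" for n i
      proof (cases "i = Suc k")
        case True
        then show ?thesis using N' n la by (simp add: last nth_append less_imp_le)
      next
        case False
        then have i: "i \<le> k" using i by simp
        have "nrm ?S (\<tau> n \<ominus>\<^bsub>?S\<^esub> a) \<le> e" using N n by (simp add: less_imp_le)
        then have "nrm (level_alg D i) ((\<tau> n \<ominus>\<^bsub>?S\<^esub> a) ! i) \<le> e"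
          using i by (simp add: stage_nrm_le_iff)
        then show ?thesis using i la \<tau> a by (simp add: nth nth_append diff_nth)
      qed
      then show ?thesis by (intro exI [of _ "max N N'"]) auto
    qed
    then show "\<exists>l\<in>stage_carrier D (Suc k). \<forall>e>0. \<exists>N. \<forall>n\<ge>N. \<forall>i\<in>{..Suc k}.
          nrm (level_alg D i) (\<sigma> n ! i \<ominus>\<^bsub>level_alg D i\<^esub> l ! i) \<le> e"
      using mem by blast
  qed
qed

end

section \<open>Extension of matrix-valued functions\<close>

lemma continuous_map_Un_closed:
  assumes S: "closedin X S" and T: "closedin X T"
    and f: "continuous_map (subtopology X S) Y f" and g: "continuous_map (subtopology X T) Y g"
    and eq: "\<And>x. x \<in> S \<inter> T \<Longrightarrow> f x = g x"
  shows "continuous_map (subtopology X (S \<union> T)) Y (\<lambda>x. if x \<in> S then f x else g x)"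
proof (rule pasting_lemma_closed [where I = "{True, False}" and T = "\<lambda>b. if b then S else T"
      and f = "\<lambda>b. if b then f else g"])
  show "closedin (subtopology X (S \<union> T)) (if b then S else T)" for b
    using S T by (auto simp: closedin_subset_topspace)
  have "subtopology (subtopology X (S \<union> T)) S = subtopology X S"
    "subtopology (subtopology X (S \<union> T)) T = subtopology X T"
    by (simp_all add: subtopology_subtopology Int_absorb1)
  then show "continuous_map (subtopology (subtopology X (S \<union> T)) (if b then S else T)) Y (if b then f else g)" for b
    using f g by simp
qed (use eq in \<open>auto split: if_splits\<close>)

lemma mat_continuous_Un_closed:
  assumes "closedin X S" "closedin X T"
    and f: "mat_continuous (subtopology X S) n f" and g: "mat_continuous (subtopology X T) n g"
    and eq: "\<And>x. x \<in> S \<inter> T \<Longrightarrow> f x = g x"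
  shows "mat_continuous (subtopology X (S \<union> T)) n (\<lambda>x. if x \<in> S then f x else g x)"
proof (rule mat_continuous_entrywise [where g = "\<lambda>i j x. if x \<in> S then f x $$ (i, j) else g x $$ (i, j)"])
  show "continuous_map (subtopology X (S \<union> T)) euclidean (\<lambda>x. if x \<in> S then f x $$ (i, j) else g x $$ (i, j))"
    if "i < n" "j < n" for i j
    using assms that by (intro continuous_map_Un_closed) (auto intro: mat_continuousD)
qed (use mat_continuousD(1) [OF f] mat_continuousD(1) [OF g] in auto)

lemma Tietze_complex:
  fixes f :: "'x \<Rightarrow> complex"
  assumes X: "normal_space X" "closedin X S" and f: "continuous_map (subtopology X S) euclidean f"
  obtains g where "continuous_map X euclidean g" "\<And>x. x \<in> S \<Longrightarrow> g x = f x"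
proof -
  have ext: "\<exists>g. continuous_map X euclideanreal g \<and> (\<forall>x\<in>S. g x = h x)"
    if h: "continuous_map (subtopology X S) euclideanreal h" for h
  proof -
    have "is_interval (UNIV :: real set)" "(UNIV :: real set) \<noteq> {}" "h ` S \<subseteq> UNIV" by auto
    from Tietze_extension_realinterval [OF X this(1,2) h this(3)] show ?thesis by metis
  qed
  have "continuous_map (subtopology X S) euclideanreal (\<lambda>x. Re (f x))"
    "continuous_map (subtopology X S) euclideanreal (\<lambda>x. Im (f x))"
    using f by (simp_all add: continuous_map_atin tendsto_Re tendsto_Im)
  then obtain u v where u: "continuous_map X euclideanreal u" "\<forall>x\<in>S. u x = Re (f x)"
    and v: "continuous_map X euclideanreal v" "\<forall>x\<in>S. v x = Im (f x)"
    using ext by metis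
  show thesis
  proof (rule that [of "\<lambda>x. Complex (u x) (v x)"])
    show "continuous_map X euclidean (\<lambda>x. Complex (u x) (v x))"
      using u v by (simp add: continuous_map_atin tendsto_Complex)
  qed (use u v in auto)
qed

text \<open>Entrywise extension spoils the bound; composing with the radial retraction of the
  matrices onto the ball of radius \<open>M\<close> restores it.\<close>

lemma mat_Tietze_bounded:
  assumes X: "normal_space X" "closedin X S" and f: "mat_continuous (subtopology X S) n f"
    and M: "0 \<le> M" "\<And>x. x \<in> S \<Longrightarrow> mat_opnorm (f x) \<le> M"
  obtains g where "mat_continuous X n g" "\<And>x. x \<in> S \<Longrightarrow> g x = f x"
    "\<And>x. x \<in> topspace X \<Longrightarrow> mat_opnorm (g x) \<le> M"
proof (cases "M = 0")
  case True
  have S: "topspace (subtopology X S) = S" using X closedin_subset by fastforce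
  show thesis
  proof (rule that [of "\<lambda>_. 0\<^sub>m n n"])
    fix x assume x: "x \<in> S"
    have fx: "f x \<in> carrier_mat n n" using mat_continuousD(1) [OF f] x S by auto
    then have "mat_opnorm (f x) = 0" using M(2) [OF x] True mat_opnorm_nonneg [OF fx] by simp
    then show "0\<^sub>m n n = f x" using mat_opnorm_eq_0 [OF fx] by simp
  qed (auto simp: mat_continuous_const M)
next
  case False
  then have "M > 0" using M by simp
  have S: "topspace (subtopology X S) = S" using X closedin_subset by fastforce
  have "\<exists>g. continuous_map X euclidean g \<and> (\<forall>x\<in>S. g x = f x $$ (i, j))" if "i < n" "j < n" for i j
    using Tietze_complex [OF X mat_continuousD(2) [OF f that]] by metis
  then obtain G where G: "\<And>i j. \<lbrakk>i < n; j < n\<rbrakk> \<Longrightarrow> continuous_map X euclidean (G i j)"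
    "\<And>i j x. \<lbrakk>i < n; j < n; x \<in> S\<rbrakk> \<Longrightarrow> G i j x = f x $$ (i, j)"
    by metis
  define h where "h x = mat n n (\<lambda>(i, j). G i j x)" for x
  have h: "mat_continuous X n h"
    by (rule mat_continuous_entrywise [where g = G]) (auto simp: h_def G)
  have hf: "h x = f x" if "x \<in> S" for x
  proof -
    have "f x \<in> carrier_mat n n" using mat_continuousD(1) [OF f] that S by auto
    then show ?thesis using that by (intro eq_matI) (auto simp: h_def G)
  qed
  define c where "c x = M / max M (mat_opnorm (h x))" for x
  show thesis
  proof (rule that [of "\<lambda>x. complex_of_real (c x) \<cdot>\<^sub>m h x"])
    have "continuous_map X euclideanreal c"
      unfolding c_def using \<open>M > 0\<close>
      by (intro continuous_map_real_divide continuous_map_real_max continuous_map_opnorm [OF h]) auto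
    then show "mat_continuous X n (\<lambda>x. complex_of_real (c x) \<cdot>\<^sub>m h x)"
      by (intro mat_continuous_smult continuous_map_of_real h)
  next
    fix x assume x: "x \<in> S"
    then have "c x = 1" using M(2) [OF x] \<open>M > 0\<close> by (simp add: c_def hf max_absorb1)
    moreover have "f x \<in> carrier_mat n n" using mat_continuousD(1) [OF f] x S by auto
    ultimately show "complex_of_real (c x) \<cdot>\<^sub>m h x = f x"
      using x by (intro eq_matI) (auto simp: hf)
  next
    fix x assume x: "x \<in> topspace X"
    have hx: "h x \<in> carrier_mat n n" using h x by (rule mat_continuousD)
    have "M * (mat_opnorm (h x) / max M (mat_opnorm (h x))) \<le> M * 1"
      using \<open>M > 0\<close> by (intro mult_left_mono) auto
    then have "\<bar>c x\<bar> * mat_opnorm (h x) \<le> M"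
      using \<open>M > 0\<close> by (simp add: c_def)
    then show "mat_opnorm (complex_of_real (c x) \<cdot>\<^sub>m h x) \<le> M"
      using mat_opnorm_smult [OF hx] by simp
  qed
qed

section \<open>Ideals and their zero sets\<close>

lemma ideal_surj_image:
  assumes A: "cstar_algebra A" and B: "cstar_algebra B" and h: "h \<in> unital_star_hom A B"
    and surj: "carrier B \<subseteq> h ` carrier A" and I: "ideal I A"
  shows "ideal (h ` I) B"
proof -
  interpret A: cstar_algebra A by (rule A)
  interpret B: cstar_algebra B by (rule B)
  interpret I: ideal I A by (rule I)
  note hD = star_homD [OF h]
  show ?thesis
  proof (rule idealI)
    show "ring B" by unfold_locales
    have mem: "h a \<in> carrier B" if "a \<in> I" for a using that hD(1) I.Icarr by blast
    show left: "x \<otimes>\<^bsub>B\<^esub> b \<in> h ` I" if bx: "b \<in> h ` I" "x \<in> carrier B" for b x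
    proof -
      obtain a y where "a \<in> I" "y \<in> carrier A" "b = h a" "x = h y" using bx surj by blast
      then show ?thesis using hD(3) [of y a] I.Icarr I.I_l_closed [of a y] by (metis image_eqI)
    qed
    show "b \<otimes>\<^bsub>B\<^esub> x \<in> h ` I" if bx: "b \<in> h ` I" "x \<in> carrier B" for b x
    proof -
      obtain a y where "a \<in> I" "y \<in> carrier A" "b = h a" "x = h y" using bx surj by blast
      then show ?thesis using hD(3) [of a y] I.Icarr I.I_r_closed [of a y] by (metis image_eqI)
    qed
    show "subgroup (h ` I) (add_monoid B)"
    proof (rule B.add.subgroupI)
      show "h ` I \<subseteq> carrier B" using mem by blast
      show "h ` I \<noteq> {}" using I.zero_closed by blast
      show "\<ominus>\<^bsub>B\<^esub> b \<in> h ` I" if "b \<in> h ` I" for b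
        using left [of b "\<ominus>\<^bsub>B\<^esub> \<one>\<^bsub>B\<^esub>"] that mem by (auto simp: B.l_minus)
      show "b \<oplus>\<^bsub>B\<^esub> c \<in> h ` I" if bc: "b \<in> h ` I" "c \<in> h ` I" for b c
      proof -
        obtain a a' where "a \<in> I" "a' \<in> I" "b = h a" "c = h a'" using bc by blast
        then show ?thesis using hD(2) [of a a'] I.Icarr I.a_closed [of a a'] by (metis image_eqI)
      qed
    qed
  qed
qed

text \<open>For the given ideal these sets are the spaces of the decomposition of the quotient.\<close>

definition zero_set :: "'x rsh_data \<Rightarrow> ('x \<Rightarrow> complex mat) list set \<Rightarrow> nat \<Rightarrow> 'x set" where
  "zero_set D J i = {x \<in> topspace (base D i). \<forall>a\<in>J. (a ! i) x = 0\<^sub>m (msize D i) (msize D i)}"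

definition mat_unit :: "nat \<Rightarrow> nat \<Rightarrow> nat \<Rightarrow> complex mat" where
  "mat_unit n i j = mat n n (\<lambda>(r, c). if r = i \<and> c = j then 1 else 0)"

lemma mat_unit_closed [simp]: "mat_unit n i j \<in> carrier_mat n n"
  by (simp add: mat_unit_def)

lemma index_mult_mat_sum:
  fixes A B :: "complex mat"
  assumes "A \<in> carrier_mat n n" "B \<in> carrier_mat n n" "r < n" "c < n"
  shows "(A * B) $$ (r, c) = (\<Sum>k\<in>{0..<n}. A $$ (r, k) * B $$ (k, c))"
  using assms(3,4) carrier_matD [OF assms(1)] carrier_matD [OF assms(2)]
  by (simp add: scalar_prod_def)

lemma mat_unit_mult_mult:
  assumes M: "M \<in> carrier_mat n n" and "i < n" "p < n" "q < n" "j < n"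
  shows "mat_unit n i p * M * mat_unit n q j = M $$ (p, q) \<cdot>\<^sub>m mat_unit n i j"
proof (rule eq_matI)
  fix r c assume "r < dim_row (M $$ (p, q) \<cdot>\<^sub>m mat_unit n i j)" "c < dim_col (M $$ (p, q) \<cdot>\<^sub>m mat_unit n i j)"
  then have rc: "r < n" "c < n" by (auto simp: mat_unit_def)
  have EM: "(mat_unit n i p * M) $$ (r, k) = (if r = i then M $$ (p, k) else 0)" if k: "k < n" for k
  proof -
    have "(mat_unit n i p * M) $$ (r, k) = (\<Sum>m\<in>{0..<n}. (if r = i \<and> m = p then 1 else 0) * M $$ (m, k))"
      using M rc k by (simp add: scalar_prod_def mat_unit_def)
    also have "\<dots> = (\<Sum>m\<in>{0..<n}. if m = p then (if r = i then M $$ (m, k) else 0) else 0)"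
      by (intro sum.cong) auto
    finally show ?thesis using \<open>p < n\<close> by simp
  qed
  have "(mat_unit n i p * M * mat_unit n q j) $$ (r, c)
      = (\<Sum>k\<in>{0..<n}. (mat_unit n i p * M) $$ (r, k) * mat_unit n q j $$ (k, c))"
    using M rc by (intro index_mult_mat_sum mult_carrier_mat) auto
  also have "\<dots> = (\<Sum>k\<in>{0..<n}. if k = q then (if c = j then (mat_unit n i p * M) $$ (r, k) else 0) else 0)"
    using rc by (intro sum.cong) (auto simp: mat_unit_def)
  also have "\<dots> = (M $$ (p, q) \<cdot>\<^sub>m mat_unit n i j) $$ (r, c)"
    using rc \<open>q < n\<close> EM by (simp add: mat_unit_def)
  finally show "(mat_unit n i p * M * mat_unit n q j) $$ (r, c) = (M $$ (p, q) \<cdot>\<^sub>m mat_unit n i j) $$ (r, c)" .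
qed (use M in \<open>auto simp: mat_unit_def\<close>)

context rsh
begin

lemma zero_set_closed:
  assumes k: "k \<le> len D" and i: "i \<le> k" and J: "J \<subseteq> stage_carrier D k"
  shows "closedin (base D i) (zero_set D J i)"
proof -
  let ?X = "base D i" and ?n = "msize D i"
  have "closedin ?X {x \<in> topspace ?X. mat_opnorm ((a ! i) x) \<in> {..0}}" if "a \<in> J" for a
  proof (rule closedin_continuous_map_preimage)
    have "a ! i \<in> carrier (level_alg D i)" using J that i stage_carrier_nth by blast
    then show "continuous_map ?X euclideanreal (\<lambda>x. mat_opnorm ((a ! i) x))"
      by (intro continuous_map_opnorm [where n = ?n] cont_mat_carrierD) (simp add: level_alg_def)
  qed simp
  moreover have "{x \<in> topspace ?X. mat_opnorm ((a ! i) x) \<in> {..0}} = {x \<in> topspace ?X. (a ! i) x = 0\<^sub>m ?n ?n}"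
    if "a \<in> J" for a
  proof -
    have "a ! i \<in> carrier (level_alg D i)" using J that i stage_carrier_nth by blast
    then have "(a ! i) x \<in> carrier_mat ?n ?n" if "x \<in> topspace ?X" for x
      using that by (auto simp: level_alg_def intro: cont_mat_carrierD)
    then have "mat_opnorm ((a ! i) x) \<le> 0 \<longleftrightarrow> (a ! i) x = 0\<^sub>m ?n ?n" if "x \<in> topspace ?X" for x
      using that mat_opnorm_eq_0 mat_opnorm_nonneg by (metis antisym order_refl)
    then show ?thesis by auto
  qed
  ultimately have "closedin ?X (\<Inter> (insert (topspace ?X) ((\<lambda>a. {x \<in> topspace ?X. (a ! i) x = 0\<^sub>m ?n ?n}) ` J)))"
    by (intro closedin_Inter) auto
  moreover have "\<Inter> (insert (topspace ?X) ((\<lambda>a. {x \<in> topspace ?X. (a ! i) x = 0\<^sub>m ?n ?n}) ` J)) = zero_set D J i"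
    by (auto simp: zero_set_def)
  ultimately show ?thesis by simp
qed

text \<open>The part of the \<open>k\<close>-th space on which the last component of an element of stage \<open>k\<close> is
  determined by the others.\<close>

definition attached :: "nat \<Rightarrow> 'x set" where
  "attached k = (case k of 0 \<Rightarrow> {} | Suc _ \<Rightarrow> attach D k)"

text \<open>The tuple \<open>(0, \<dots>, 0, f)\<close>, which belongs to the pullback as soon as \<open>f\<close> vanishes on the
  attached part.\<close>

definition top_elt :: "nat \<Rightarrow> ('x \<Rightarrow> complex mat) \<Rightarrow> ('x \<Rightarrow> complex mat) list" where
  "top_elt k f = map (\<lambda>i. if i = k then f else \<zero>\<^bsub>level_alg D i\<^esub>) [0..<Suc k]"

lemma top_elt_nth: "i \<le> k \<Longrightarrow> top_elt k f ! i = (if i = k then f else \<zero>\<^bsub>level_alg D i\<^esub>)"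
  by (simp add: top_elt_def nth_append)

lemma top_elt_closed:
  assumes k: "k \<le> len D" and f: "f \<in> carrier (level_alg D k)"
    and zero: "\<And>x. x \<in> attached k \<Longrightarrow> f x = 0\<^sub>m (msize D k) (msize D k)"
  shows "top_elt k f \<in> stage_carrier D k"
proof (cases k)
  case 0
  then show ?thesis using f by (simp add: top_elt_def)
next
  case (Suc m)
  have m: "Suc m \<le> len D" using k Suc by simp
  then interpret S: cstar_algebra "stage_alg D m" by (intro cstar_stage) simp
  have eq: "top_elt k f = \<zero>\<^bsub>stage_alg D m\<^esub> @ [f]"
    by (simp add: top_elt_def Suc stage_alg_def)
  have "glue D (Suc m) \<zero>\<^bsub>stage_alg D m\<^esub> = \<zero>\<^bsub>attach_alg D (Suc m)\<^esub>"
    by (rule ring_hom_zero [OF _ S.ring_axioms cstar_algebra.axioms(2) [OF cstar_attach [OF m]]])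
      (use glue_hom [OF m] in \<open>simp add: unital_star_hom_def\<close>)
  also have "\<dots> = restrict f (attach D (Suc m))"
  proof -
    have "topspace (base D (Suc m)) \<inter> attach D (Suc m) = attach D (Suc m)"
      using attach_subset [OF m] by auto
    then show ?thesis
      using zero by (auto simp: attach_alg_def attached_def Suc intro!: restrict_ext)
  qed
  finally show ?thesis using f S.zero_closed by (auto simp: eq [unfolded Suc] Suc)
qed

lemma level_mult: "f \<otimes>\<^bsub>level_alg D k\<^esub> g = (\<lambda>x\<in>topspace (base D k). f x * g x)"
  by (simp add: level_alg_def)

lemma level_add: "f \<oplus>\<^bsub>level_alg D k\<^esub> g = (\<lambda>x\<in>topspace (base D k). f x + g x)"
  by (simp add: level_alg_def)

lemma top_elt_mult_mult:
  assumes k: "k \<le> len D" and f: "top_elt k f \<in> stage_carrier D k" and g: "top_elt k g \<in> stage_carrier D k"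
    and d: "d \<in> stage_carrier D k"
  shows "top_elt k f \<otimes>\<^bsub>stage_alg D k\<^esub> d \<otimes>\<^bsub>stage_alg D k\<^esub> top_elt k g
    = top_elt k (\<lambda>x\<in>topspace (base D k). f x * (d ! k) x * g x)"
proof -
  let ?S = "stage_alg D k"
  have "(top_elt k f \<otimes>\<^bsub>?S\<^esub> d \<otimes>\<^bsub>?S\<^esub> top_elt k g) ! i
      = top_elt k (\<lambda>x\<in>topspace (base D k). f x * (d ! k) x * g x) ! i" if i: "i \<le> k" for i
  proof -
    interpret L: cstar_algebra "level_alg D i" by (rule cstar_level) (use i k in simp)
    have "d ! i \<in> carrier (level_alg D i)" using d i by (rule stage_carrier_nth)
    note di = this
    show ?thesis
    proof (cases "i = k")
      case True
      then show ?thesis using i by (simp add: stage_alg_nth top_elt_nth level_mult cong: restrict_cong)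
    next
      case False
      then show ?thesis using i L.l_null [OF di] L.l_null [OF L.zero_closed]
        by (simp add: stage_alg_nth top_elt_nth)
    qed
  qed
  moreover have "length (top_elt k f \<otimes>\<^bsub>?S\<^esub> d \<otimes>\<^bsub>?S\<^esub> top_elt k g) = Suc k"
    by (simp add: stage_alg_def)
  ultimately show ?thesis by (intro nth_equalityI) (auto simp: top_elt_def)
qed

lemma top_elt_mult:
  assumes k: "k \<le> len D"
  shows "top_elt k f \<otimes>\<^bsub>stage_alg D k\<^esub> top_elt k g = top_elt k (\<lambda>x\<in>topspace (base D k). f x * g x)"
proof -
  let ?S = "stage_alg D k"
  have "(top_elt k f \<otimes>\<^bsub>?S\<^esub> top_elt k g) ! i
      = top_elt k (\<lambda>x\<in>topspace (base D k). f x * g x) ! i" if i: "i \<le> k" for i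
  proof -
    interpret L: cstar_algebra "level_alg D i" by (rule cstar_level) (use i k in simp)
    show ?thesis
    proof (cases "i = k")
      case True
      then show ?thesis using i by (simp add: stage_alg_nth top_elt_nth level_mult)
    next
      case False
      then show ?thesis using i L.l_null [OF L.zero_closed] by (simp add: stage_alg_nth top_elt_nth)
    qed
  qed
  moreover have "length (top_elt k f \<otimes>\<^bsub>?S\<^esub> top_elt k g) = Suc k"
    by (simp add: stage_alg_def)
  ultimately show ?thesis by (intro nth_equalityI) (auto simp: top_elt_def)
qed

lemma top_elt_add:
  assumes k: "k \<le> len D"
  shows "top_elt k f \<oplus>\<^bsub>stage_alg D k\<^esub> top_elt k g = top_elt k (\<lambda>x\<in>topspace (base D k). f x + g x)"
proof -
  let ?S = "stage_alg D k"
  have "(top_elt k f \<oplus>\<^bsub>?S\<^esub> top_elt k g) ! i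
      = top_elt k (\<lambda>x\<in>topspace (base D k). f x + g x) ! i" if i: "i \<le> k" for i
  proof -
    interpret L: cstar_algebra "level_alg D i" by (rule cstar_level) (use i k in simp)
    show ?thesis
    proof (cases "i = k")
      case True
      then show ?thesis using i by (simp add: stage_alg_nth top_elt_nth level_add)
    next
      case False
      then show ?thesis using i L.l_zero [OF L.zero_closed] by (simp add: stage_alg_nth top_elt_nth)
    qed
  qed
  moreover have "length (top_elt k f \<oplus>\<^bsub>?S\<^esub> top_elt k g) = Suc k"
    by (simp add: stage_alg_def)
  ultimately show ?thesis by (intro nth_equalityI) (auto simp: top_elt_def)
qed

lemma attached_closed: "k \<le> len D \<Longrightarrow> closedin (base D k) (attached k)"
  by (cases k) (auto simp: attached_def attach_closed)

lemma attached_subset: "k \<le> len D \<Longrightarrow> attached k \<subseteq> topspace (base D k)"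
  using attached_closed closedin_subset by blast

lemma level_carrierI:
  "mat_continuous (base D k) (msize D k) f \<Longrightarrow> restrict f (topspace (base D k)) \<in> carrier (level_alg D k)"
  unfolding level_alg_def by (rule cont_mat_restrict)

lemma level_carrierD:
  assumes "f \<in> carrier (level_alg D k)"
  shows "mat_continuous (base D k) (msize D k) f"
    and "x \<in> topspace (base D k) \<Longrightarrow> f x \<in> carrier_mat (msize D k) (msize D k)"
  using assms unfolding level_alg_def by (auto intro: cont_mat_carrierD)

lemma top_elt_zero:
  "top_elt k (\<lambda>x\<in>topspace (base D k). 0\<^sub>m (msize D k) (msize D k)) = \<zero>\<^bsub>stage_alg D k\<^esub>"
  by (auto simp: top_elt_def stage_alg_def level_alg_def)

text \<open>Multiplying an element of the ideal on both sides by matrix units, weighted with a function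
  that vanishes on the attached part, isolates one of its entries on the last space. The diagonal
  sum of such products is a scalar function.\<close>

lemma scalar_in_ideal:
  assumes k: "k \<le> len D" and J: "ideal J (stage_alg D k)"
    and x0: "x0 \<in> topspace (base D k)" "x0 \<notin> zero_set D J k"
    and \<eta>: "continuous_map (base D k) euclideanreal \<eta>" "\<And>x. x \<in> attached k \<Longrightarrow> \<eta> x = 0" "\<eta> x0 > 0"
  obtains s where "continuous_map (base D k) euclideanreal s" "\<And>x. 0 \<le> s x" "s x0 > 0"
    "top_elt k (\<lambda>x\<in>topspace (base D k). complex_of_real (s x) \<cdot>\<^sub>m 1\<^sub>m (msize D k)) \<in> J"
proof -
  let ?X = "base D k" and ?n = "msize D k" and ?S = "stage_alg D k"
  interpret J: ideal J ?S by (rule J)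
  note J_zero = additive_subgroup.zero_closed [OF ideal.axioms(1) [OF J]]
    and J_add = additive_subgroup.a_closed [OF ideal.axioms(1) [OF J]]
  obtain d where d: "d \<in> J" "(d ! k) x0 \<noteq> 0\<^sub>m ?n ?n" using x0 by (auto simp: zero_set_def)
  have dS: "d \<in> stage_carrier D k" using J.Icarr [OF d(1)] by simp
  have dL: "d ! k \<in> carrier (level_alg D k)" using stage_carrier_nth [OF dS] by simp
  have "\<exists>p q. p < ?n \<and> q < ?n \<and> (d ! k) x0 $$ (p, q) \<noteq> 0"
  proof (rule ccontr)
    assume "\<not> ?thesis"
    then have "(d ! k) x0 = 0\<^sub>m ?n ?n"
      using carrier_matD [OF level_carrierD(2) [OF dL x0(1)]] by (intro eq_matI) auto
    then show False using d by simp
  qed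
  then obtain p q where pq: "p < ?n" "q < ?n" "(d ! k) x0 $$ (p, q) \<noteq> 0" by blast
  let ?d = "\<lambda>x. (d ! k) x $$ (p, q)"
  have d_cont: "continuous_map ?X euclidean ?d"
    using mat_continuousD(2) [OF level_carrierD(1) [OF dL]] pq by simp
  define s where "s x = \<eta> x * \<eta> x * (cmod (?d x))\<^sup>2" for x
  have s_cont: "continuous_map ?X euclideanreal s"
    unfolding s_def by (intro continuous_map_real_mult continuous_map_real_pow continuous_map_norm \<eta> d_cont)
  define F where "F i x = complex_of_real (\<eta> x) \<cdot>\<^sub>m mat_unit ?n i p" for i x
  define G where "G i x = (complex_of_real (\<eta> x) * cnj (?d x)) \<cdot>\<^sub>m mat_unit ?n q i" for i x
  have F: "top_elt k (restrict (F i) (topspace ?X)) \<in> stage_carrier D k" for i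
  proof (rule top_elt_closed [OF k])
    show "restrict (F i) (topspace ?X) \<in> carrier (level_alg D k)"
      unfolding F_def by (intro level_carrierI mat_continuous_smult continuous_map_of_real \<eta>
          mat_continuous_const mat_unit_closed)
    show "restrict (F i) (topspace ?X) x = 0\<^sub>m ?n ?n" if "x \<in> attached k" for x
      using that attached_subset [OF k] by (auto simp: F_def \<eta> mat_unit_def)
  qed
  have G: "top_elt k (restrict (G i) (topspace ?X)) \<in> stage_carrier D k" for i
  proof (rule top_elt_closed [OF k])
    show "restrict (G i) (topspace ?X) \<in> carrier (level_alg D k)"
      unfolding G_def by (intro level_carrierI mat_continuous_smult continuous_map_complex_mult
          continuous_map_of_real continuous_map_cnj \<eta> d_cont mat_continuous_const mat_unit_closed)
    show "restrict (G i) (topspace ?X) x = 0\<^sub>m ?n ?n" if "x \<in> attached k" for x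
      using that attached_subset [OF k] by (auto simp: G_def \<eta> mat_unit_def)
  qed
  let ?E = "\<lambda>i. \<lambda>x\<in>topspace ?X. complex_of_real (s x) \<cdot>\<^sub>m mat_unit ?n i i"
  have E: "top_elt k (?E i) \<in> J" if i: "i < ?n" for i
  proof -
    have "F i x * (d ! k) x * G i x = complex_of_real (s x) \<cdot>\<^sub>m mat_unit ?n i i" if x: "x \<in> topspace ?X" for x
    proof -
      have dx: "(d ! k) x \<in> carrier_mat ?n ?n" using level_carrierD(2) [OF dL x] .
      have "F i x * (d ! k) x * G i x = complex_of_real (\<eta> x) \<cdot>\<^sub>m
          ((complex_of_real (\<eta> x) * cnj (?d x)) \<cdot>\<^sub>m (mat_unit ?n i p * (d ! k) x * mat_unit ?n q i))"
        unfolding F_def G_def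
        by (simp only: mult_smult_assoc_mat [OF mat_unit_closed dx]
            mult_smult_assoc_mat [OF mult_carrier_mat [OF mat_unit_closed dx] smult_carrier_mat [OF mat_unit_closed]]
            mult_smult_distrib [OF mult_carrier_mat [OF mat_unit_closed dx] mat_unit_closed])
      also have "\<dots> = complex_of_real (\<eta> x) \<cdot>\<^sub>m
          ((complex_of_real (\<eta> x) * cnj (?d x)) \<cdot>\<^sub>m (?d x \<cdot>\<^sub>m mat_unit ?n i i))"
        using mat_unit_mult_mult [OF dx i pq(1,2) i] by simp
      also have "\<dots> = complex_of_real (s x) \<cdot>\<^sub>m mat_unit ?n i i"
        by (intro eq_matI) (auto simp: s_def complex_norm_square mult_ac simp del: of_real_power)
      finally show ?thesis .
    qed
    then have "top_elt k (restrict (F i) (topspace ?X)) \<otimes>\<^bsub>?S\<^esub> d \<otimes>\<^bsub>?S\<^esub>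
        top_elt k (restrict (G i) (topspace ?X)) = top_elt k (?E i)"
      unfolding top_elt_mult_mult [OF k F G dS] by (simp cong: restrict_cong)
    moreover have "top_elt k (restrict (F i) (topspace ?X)) \<otimes>\<^bsub>?S\<^esub> d \<otimes>\<^bsub>?S\<^esub>
        top_elt k (restrict (G i) (topspace ?X)) \<in> J"
      using F G d by (intro J.I_r_closed J.I_l_closed) auto
    ultimately show ?thesis by simp
  qed
  \<comment> \<open>The partial sums of the diagonal matrix units, up to the identity matrix.\<close>
  define P where "P m = (mat ?n ?n (\<lambda>(r, c). if r = c \<and> r < m then 1 else 0) :: complex mat)" for m
  have "top_elt k (\<lambda>x\<in>topspace ?X. complex_of_real (s x) \<cdot>\<^sub>m P m) \<in> J" if "m \<le> ?n" for m
    using that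
  proof (induction m)
    case 0
    have "complex_of_real (s x) \<cdot>\<^sub>m P 0 = 0\<^sub>m ?n ?n" for x by (intro eq_matI) (auto simp: P_def)
    then have "(\<lambda>x\<in>topspace ?X. complex_of_real (s x) \<cdot>\<^sub>m P 0) = (\<lambda>x\<in>topspace ?X. 0\<^sub>m ?n ?n)"
      by (intro restrict_ext)
    then show ?case by (simp only: top_elt_zero J_zero)
  next
    case (Suc m)
    have "complex_of_real (s x) \<cdot>\<^sub>m P m + complex_of_real (s x) \<cdot>\<^sub>m mat_unit ?n m m
        = complex_of_real (s x) \<cdot>\<^sub>m P (Suc m)" for x
      by (intro eq_matI) (auto simp: P_def mat_unit_def)
    then have eq: "top_elt k (\<lambda>x\<in>topspace ?X. complex_of_real (s x) \<cdot>\<^sub>m P (Suc m))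
        = top_elt k (\<lambda>x\<in>topspace ?X. complex_of_real (s x) \<cdot>\<^sub>m P m) \<oplus>\<^bsub>?S\<^esub> top_elt k (?E m)"
      by (simp add: top_elt_add [OF k] cong: restrict_cong)
    show ?case
      unfolding eq by (rule J_add [OF Suc.IH [OF Suc_leD [OF Suc.prems]] E [OF Suc_le_lessD [OF Suc.prems]]])
  qed
  from this [of ?n] have "top_elt k (\<lambda>x\<in>topspace ?X. complex_of_real (s x) \<cdot>\<^sub>m P ?n) \<in> J" by simp
  moreover have "P ?n = 1\<^sub>m ?n" by (intro eq_matI) (auto simp: P_def)
  ultimately show thesis
    using pq \<eta> s_cont by (intro that [of s]) (auto simp: s_def)
qed

text \<open>By compactness finitely many of these scalar functions have a sum that is positive on the
  support of \<open>h\<close>; a multiple of that sum is \<open>h\<close>.\<close>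

lemma supported_in_ideal:
  assumes k: "k \<le> len D" and J: "ideal J (stage_alg D k)"
    and h: "h \<in> carrier (level_alg D k)"
    and u: "continuous_map (base D k) euclideanreal u" and \<delta>: "\<delta> > 0"
    and u0: "\<And>x. x \<in> attached k \<Longrightarrow> u x \<le> 0" "\<And>x. x \<in> zero_set D J k \<Longrightarrow> u x \<le> 0"
    and supp: "\<And>x. \<lbrakk>x \<in> topspace (base D k); u x < \<delta>\<rbrakk> \<Longrightarrow> h x = 0\<^sub>m (msize D k) (msize D k)"
  shows "top_elt k h \<in> J"
proof -
  let ?X = "base D k" and ?n = "msize D k" and ?S = "stage_alg D k"
  interpret J: ideal J ?S by (rule J)
  note J_zero = additive_subgroup.zero_closed [OF ideal.axioms(1) [OF J]]
    and J_add = additive_subgroup.a_closed [OF ideal.axioms(1) [OF J]]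
  define C where "C = {x \<in> topspace ?X. u x \<in> {\<delta>..}}"
  have C: "closedin ?X C" unfolding C_def using u by (rule closedin_continuous_map_preimage) simp
  have C_sub: "C \<subseteq> topspace ?X" by (auto simp: C_def)
  have Ccomp: "compactin ?X C" using C level(1) [OF k] by (simp add: closedin_compact_space)
  \<comment> \<open>The positive part of \<open>u\<close> is a weight that vanishes on the attached part and is positive on
    the support \<open>C\<close>.\<close>
  let ?sc = "\<lambda>s. \<lambda>x\<in>topspace ?X. complex_of_real (s x) \<cdot>\<^sub>m 1\<^sub>m ?n"
  have "\<exists>s. continuous_map ?X euclideanreal s \<and> (\<forall>x. 0 \<le> s x) \<and> s y > 0 \<and> top_elt k (?sc s) \<in> J"
    if y: "y \<in> C" for y
  proof -
    have "y \<in> topspace ?X" "y \<notin> zero_set D J k" using y u0(2) \<delta> by (force simp: C_def)+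
    moreover have "continuous_map ?X euclideanreal (\<lambda>x. max 0 (u x))"
      by (intro continuous_map_real_max u) simp
    moreover have "max 0 (u x) = 0" if "x \<in> attached k" for x using u0(1) [OF that] by simp
    moreover have "max 0 (u y) > 0" using y \<delta> by (auto simp: C_def)
    ultimately show ?thesis using scalar_in_ideal [OF k J, of y "\<lambda>x. max 0 (u x)"] by metis
  qed
  then obtain s where s: "\<And>y. y \<in> C \<Longrightarrow> continuous_map ?X euclideanreal (s y)"
    "\<And>y x. y \<in> C \<Longrightarrow> 0 \<le> s y x" "\<And>y. y \<in> C \<Longrightarrow> s y y > 0"
    "\<And>y. y \<in> C \<Longrightarrow> top_elt k (?sc (s y)) \<in> J"
    by metis
  let ?U = "\<lambda>y. {x \<in> topspace ?X. s y x \<in> {0<..}}"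
  have "\<exists>\<F>. finite \<F> \<and> \<F> \<subseteq> ?U ` C \<and> C \<subseteq> \<Union>\<F>"
  proof (rule compactinD [OF Ccomp])
    show "openin ?X U" if U: "U \<in> ?U ` C" for U
    proof -
      obtain y where "y \<in> C" "U = ?U y" using U by blast
      then show ?thesis using openin_continuous_map_preimage [OF s(1), of y "{0<..}"] by simp
    qed
    show "C \<subseteq> \<Union> (?U ` C)" using s(3) C_sub by auto
  qed
  then obtain F where F: "finite F" "F \<subseteq> C" "C \<subseteq> \<Union> (?U ` F)"
    by (metis (no_types, lifting) finite_subset_image)
  define \<sigma> where "\<sigma> x = (\<Sum>y\<in>F. s y x)" for x
  have \<sigma>_cont: "continuous_map ?X euclideanreal \<sigma>"
    unfolding \<sigma>_def using F s(1) by (intro continuous_map_sum) auto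
  have \<sigma>_pos: "\<sigma> x > 0" if x: "x \<in> C" for x
  proof -
    obtain y where "y \<in> F" "s y x > 0" using F x by auto
    then show ?thesis unfolding \<sigma>_def using F s(2) by (intro sum_pos2) auto
  qed
  have "top_elt k (?sc (\<lambda>x. \<Sum>y\<in>F'. s y x)) \<in> J" if "finite F'" "F' \<subseteq> C" for F'
    using that
  proof (induction F')
    case empty
    have "complex_of_real 0 \<cdot>\<^sub>m 1\<^sub>m ?n = 0\<^sub>m ?n ?n" by (intro eq_matI) auto
    then have "?sc (\<lambda>x. \<Sum>y\<in>{}. s y x) = (\<lambda>x\<in>topspace ?X. 0\<^sub>m ?n ?n)"
      by (intro restrict_ext) (simp only: sum.empty)
    then show ?case by (simp only: top_elt_zero J_zero)
  next
    case (insert y F')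
    have "complex_of_real (a + b) \<cdot>\<^sub>m 1\<^sub>m ?n = complex_of_real a \<cdot>\<^sub>m 1\<^sub>m ?n + complex_of_real b \<cdot>\<^sub>m 1\<^sub>m ?n"
      for a b by (intro eq_matI) auto
    then have eq: "top_elt k (?sc (\<lambda>x. \<Sum>y\<in>insert y F'. s y x))
        = top_elt k (?sc (s y)) \<oplus>\<^bsub>?S\<^esub> top_elt k (?sc (\<lambda>x. \<Sum>y\<in>F'. s y x))"
      using insert(1,2) by (simp add: top_elt_add [OF k] cong: restrict_cong del: of_real_add)
    have "y \<in> C" "F' \<subseteq> C" using insert.prems by auto
    then show ?case unfolding eq by (intro J_add s(4) insert.IH)
  qed
  then have \<sigma>J: "top_elt k (?sc \<sigma>) \<in> J" using F unfolding \<sigma>_def by blast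
  have "continuous_map (subtopology ?X C) euclidean (\<lambda>x. complex_of_real (1 / \<sigma> x))"
  proof (intro continuous_map_of_real continuous_map_real_divide)
    show "continuous_map (subtopology ?X C) euclideanreal \<sigma>"
      using \<sigma>_cont by (rule continuous_map_from_subtopology)
    show "\<sigma> x \<noteq> 0" if "x \<in> topspace (subtopology ?X C)" for x
      using that \<sigma>_pos [of x] by simp
  qed simp
  \<comment> \<open>Only the values of \<open>1 / \<sigma>\<close> on \<open>C\<close> matter, so any continuous extension \<open>r\<close> will do.\<close>
  note Tietze = Tietze_complex [OF normal_base [OF k] C this]
  obtain r where r: "continuous_map ?X euclidean r" "\<And>x. x \<in> C \<Longrightarrow> r x = complex_of_real (1 / \<sigma> x)"
    by (rule Tietze) (rule that)
  let ?g = "\<lambda>x\<in>topspace ?X. r x \<cdot>\<^sub>m h x"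
  have "top_elt k ?g \<in> stage_carrier D k"
  proof (rule top_elt_closed [OF k])
    show "?g \<in> carrier (level_alg D k)"
      by (intro level_carrierI mat_continuous_smult r level_carrierD h)
    fix x assume x: "x \<in> attached k"
    then have "x \<in> topspace ?X" using attached_subset [OF k] by auto
    moreover from this have "h x = 0\<^sub>m ?n ?n" using supp u0(1) [OF x] \<delta> by simp
    ultimately show "?g x = 0\<^sub>m ?n ?n" by simp
  qed
  then have "top_elt k (?sc \<sigma>) \<otimes>\<^bsub>?S\<^esub> top_elt k ?g \<in> J"
    using \<sigma>J by (intro J.I_r_closed) auto
  moreover have "?sc \<sigma> x * ?g x = h x" if x: "x \<in> topspace ?X" for x
  proof -
    have hx: "h x \<in> carrier_mat ?n ?n" using level_carrierD(2) [OF h x] .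
    have "complex_of_real (\<sigma> x) \<cdot>\<^sub>m (r x \<cdot>\<^sub>m h x) = (complex_of_real (\<sigma> x) * r x) \<cdot>\<^sub>m h x"
      by (intro eq_matI) auto
    then have "?sc \<sigma> x * ?g x = (complex_of_real (\<sigma> x) * r x) \<cdot>\<^sub>m h x"
      using x hx mult_smult_assoc_mat [OF one_carrier_mat smult_carrier_mat [OF hx], of "complex_of_real (\<sigma> x)" "r x"]
        left_mult_one_mat [OF smult_carrier_mat [OF hx]] by simp
    also have "\<dots> = h x"
    proof (cases "x \<in> C")
      case True
      then show ?thesis using r(2) [OF True] \<sigma>_pos [OF True] hx by (intro eq_matI) auto
    next
      case False
      then have "h x = 0\<^sub>m ?n ?n" using x supp by (auto simp: C_def)
      then show ?thesis by simp
    qed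
    finally show ?thesis .
  qed
  then have "(\<lambda>x\<in>topspace ?X. ?sc \<sigma> x * ?g x) = h"
    using h by (intro extensionalityI [of _ "topspace ?X"]) (auto simp: level_alg_def cont_mat_carrier_iff)
  ultimately show ?thesis by (simp only: top_elt_mult [OF k])
qed


lemma stage_diff_nth:
  assumes k: "k \<le> len D" "i \<le> k" and ab: "a \<in> stage_carrier D k" "b \<in> stage_carrier D k"
  shows "(a \<ominus>\<^bsub>stage_alg D k\<^esub> b) ! i = a ! i \<ominus>\<^bsub>level_alg D i\<^esub> b ! i"
proof -
  have "cstar_algebra (level_alg D i)" using k by (intro cstar_level) simp
  from star_hom_diff [OF cstar_stage [OF k(1)] this nth_star_hom [OF k], of a b]
  show ?thesis using ab by simp
qed

lemma level_diff:
  "\<lbrakk>k \<le> len D; f \<in> carrier (level_alg D k); g \<in> carrier (level_alg D k)\<rbrakk>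
    \<Longrightarrow> f \<ominus>\<^bsub>level_alg D k\<^esub> g = (\<lambda>x\<in>topspace (base D k). f x - g x)"
  unfolding level_alg_def by (intro cont_mat_diff level)

lemma level_nrm_le:
  "\<lbrakk>0 \<le> c; \<And>x. x \<in> topspace (base D k) \<Longrightarrow> mat_opnorm (f x) \<le> c\<rbrakk> \<Longrightarrow> nrm (level_alg D k) f \<le> c"
  unfolding level_alg_def by (rule cont_mat_nrm_le)

text \<open>If \<open>c\<close> approximates \<open>a\<close> below the last level and on the attached part, then the error
  \<open>g = a - c\<close> is at most \<open>e\<close> on the attached part and on the zero set. Multiplying \<open>g\<close> by
  \<open>max 0 (1 - 2e / \<parallel>g\<parallel>)\<close> changes it by at most \<open>2e\<close> and gives a function supported where
  \<open>\<parallel>g\<parallel> \<ge> 2e\<close>, so the previous lemma applies.\<close>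

lemma approximation_step:
  assumes k: "k \<le> len D" and J: "ideal J (stage_alg D k)" and a: "a \<in> stage_carrier D k"
    and van: "\<And>x. x \<in> zero_set D J k \<Longrightarrow> (a ! k) x = 0\<^sub>m (msize D k) (msize D k)"
    and c: "c \<in> J" and e: "e > 0"
    and low: "\<And>i. i < k \<Longrightarrow> nrm (level_alg D i) (a ! i \<ominus>\<^bsub>level_alg D i\<^esub> c ! i) \<le> e"
    and att: "\<And>x. x \<in> attached k \<Longrightarrow> mat_opnorm ((a ! k) x - (c ! k) x) \<le> e"
  shows "\<exists>c'\<in>J. nrm (stage_alg D k) (a \<ominus>\<^bsub>stage_alg D k\<^esub> c') \<le> 2 * e"
proof -
  let ?X = "base D k" and ?n = "msize D k" and ?S = "stage_alg D k" and ?L = "level_alg D k"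
  interpret J: ideal J ?S by (rule J)
  note J_add = additive_subgroup.a_closed [OF ideal.axioms(1) [OF J]]
  have cS: "c \<in> stage_carrier D k" using J.Icarr [OF c] by simp
  have L: "a ! k \<in> carrier ?L" "c ! k \<in> carrier ?L"
    using stage_carrier_nth a cS by auto
  define g where "g x = (a ! k) x - (c ! k) x" for x
  have g: "mat_continuous ?X ?n g"
    unfolding g_def by (intro mat_continuous_diff level_carrierD L)
  note g_cont = continuous_map_opnorm [OF g]
  define \<eta> where "\<eta> x = max 0 (mat_opnorm (g x) - 2 * e) / max (2 * e) (mat_opnorm (g x))" for x
  have \<eta>: "continuous_map ?X euclideanreal \<eta>"
    unfolding \<eta>_def using e
    by (intro continuous_map_real_divide continuous_map_real_max continuous_map_diff g_cont) auto
  define h where "h = (\<lambda>x\<in>topspace ?X. complex_of_real (\<eta> x) \<cdot>\<^sub>m g x)"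
  have h: "h \<in> carrier ?L"
    unfolding h_def by (intro level_carrierI mat_continuous_smult continuous_map_of_real \<eta> g)
  have top: "top_elt k h \<in> J"
  proof (rule supported_in_ideal [OF k J h, of "\<lambda>x. mat_opnorm (g x) - e" e])
    show "continuous_map ?X euclideanreal (\<lambda>x. mat_opnorm (g x) - e)"
      by (intro continuous_map_diff g_cont) simp
    show "mat_opnorm (g x) - e \<le> 0" if "x \<in> attached k" for x
      using att [OF that] by (simp add: g_def)
    show "mat_opnorm (g x) - e \<le> 0" if x: "x \<in> zero_set D J k" for x
    proof -
      have "(c ! k) x = 0\<^sub>m ?n ?n" using x c by (auto simp: zero_set_def)
      then have "g x = 0\<^sub>m ?n ?n" using van [OF x] by (simp add: g_def)
      then show ?thesis using e by simp
    qed
    show "h x = 0\<^sub>m ?n ?n" if "x \<in> topspace ?X" "mat_opnorm (g x) - e < e" for x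
    proof -
      have "\<eta> x = 0" using that by (simp add: \<eta>_def)
      moreover have "0 \<cdot>\<^sub>m g x = 0\<^sub>m ?n ?n"
        using carrier_matD [OF mat_continuousD(1) [OF g that(1)]] by (intro eq_matI) auto
      ultimately show ?thesis using that by (simp add: h_def)
    qed
  qed (rule e)
  define c' where "c' = c \<oplus>\<^bsub>?S\<^esub> top_elt k h"
  have c': "c' \<in> J" unfolding c'_def using c top by (rule J_add)
  have c'S: "c' \<in> stage_carrier D k" using J.Icarr [OF c'] by simp
  have "nrm (level_alg D i) ((a \<ominus>\<^bsub>?S\<^esub> c') ! i) \<le> 2 * e" if i: "i \<le> k" for i
  proof (cases "i = k")
    case False
    have "i \<le> len D" using i k by simp
    then interpret L: cstar_algebra "level_alg D i" by (rule cstar_level)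
    have "c' ! i = c ! i"
      using False i stage_carrier_nth [OF cS i] by (simp add: c'_def stage_alg_nth top_elt_nth)
    then show ?thesis using low [of i] False i e by (simp add: stage_diff_nth [OF k i a c'S])
  next
    case True
    have c'k: "c' ! k = (\<lambda>x\<in>topspace ?X. (c ! k) x + h x)"
      by (simp add: c'_def stage_alg_nth top_elt_nth level_add)
    have "nrm ?L (a ! k \<ominus>\<^bsub>?L\<^esub> c' ! k) \<le> 2 * e"
    proof (rule level_nrm_le)
      fix x assume x: "x \<in> topspace ?X"
      let ?t = "mat_opnorm (g x)"
      have gx: "g x \<in> carrier_mat ?n ?n" using g x by (rule mat_continuousD)
      have "(a ! k \<ominus>\<^bsub>?L\<^esub> c' ! k) x = complex_of_real (1 - \<eta> x) \<cdot>\<^sub>m g x"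
      proof -
        have "(a ! k \<ominus>\<^bsub>?L\<^esub> c' ! k) x = (a ! k) x - ((c ! k) x + complex_of_real (\<eta> x) \<cdot>\<^sub>m g x)"
          using x stage_carrier_nth [OF c'S, of k] L by (simp add: level_diff [OF k] c'k h_def)
        also have "\<dots> = complex_of_real (1 - \<eta> x) \<cdot>\<^sub>m g x"
          using carrier_matD [OF level_carrierD(2) [OF L(1) x]] carrier_matD [OF level_carrierD(2) [OF L(2) x]]
          by (intro eq_matI) (auto simp: g_def algebra_simps)
        finally show ?thesis .
      qed
      then have "mat_opnorm ((a ! k \<ominus>\<^bsub>?L\<^esub> c' ! k) x) = \<bar>1 - \<eta> x\<bar> * ?t"
        using mat_opnorm_smult [OF gx, of "complex_of_real (1 - \<eta> x)"] by (simp only: norm_of_real)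
      also have "\<dots> \<le> 2 * e"
      proof (cases "?t \<le> 2 * e")
        case True
        then show ?thesis by (simp add: \<eta>_def)
      next
        case False
        then have "\<eta> x = (?t - 2 * e) / ?t" by (simp add: \<eta>_def)
        then have "1 - \<eta> x = 2 * e / ?t" using False e by (simp add: field_simps)
        then show ?thesis using False e by simp
      qed
      finally show "mat_opnorm ((a ! k \<ominus>\<^bsub>?L\<^esub> c' ! k) x) \<le> 2 * e" .
    qed (use e in simp)
    then show ?thesis using True by (simp add: stage_diff_nth [OF k _ a c'S])
  qed
  then show ?thesis using c' by (intro bexI [of _ c']) (auto simp: stage_nrm_le_iff)
qed

lemma stage_SucE:
  assumes "a \<in> stage_carrier D (Suc k)"
  obtains b f where "a = b @ [f]" "b \<in> stage_carrier D k" "f \<in> carrier (level_alg D (Suc k))"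
    "glue D (Suc k) b = restrict f (attach D (Suc k))"
  using assms by auto

lemma attach_carrierD:
  assumes k: "Suc k \<le> len D" and f: "f \<in> carrier (attach_alg D (Suc k))"
  shows "mat_continuous (subtopology (base D (Suc k)) (attach D (Suc k))) (msize D (Suc k)) f"
    and "f \<in> extensional (attach D (Suc k))"
    and "x \<in> attach D (Suc k) \<Longrightarrow> mat_opnorm (f x) \<le> nrm (attach_alg D (Suc k)) f"
    and "x \<in> attach D (Suc k) \<Longrightarrow> f x \<in> carrier_mat (msize D (Suc k)) (msize D (Suc k))"
  using cont_mat_carrierD [OF f [unfolded attach_alg_def]]
    cont_mat_nrm_ub [OF compact_attach [OF k] f [unfolded attach_alg_def]]
  by (simp_all only: topspace_attach [OF k] attach_alg_def)

text \<open>By the Tietze theorem the projection from one stage to the previous one is onto. Hence it maps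
  ideals to ideals.\<close>

lemma stage_extend:
  assumes k: "Suc k \<le> len D" and a: "a \<in> stage_carrier D k"
  obtains f where "a @ [f] \<in> stage_carrier D (Suc k)"
proof -
  let ?X = "base D (Suc k)" and ?S = "attach D (Suc k)" and ?n = "msize D (Suc k)"
  have ga: "glue D (Suc k) a \<in> carrier (attach_alg D (Suc k))"
    using star_homD(1) [OF glue_hom [OF k]] a by simp
  interpret B: cstar_algebra "attach_alg D (Suc k)" by (rule cstar_attach [OF k])
  obtain g where g: "mat_continuous ?X ?n g" "\<And>x. x \<in> ?S \<Longrightarrow> g x = glue D (Suc k) a x"
    using mat_Tietze_bounded [OF normal_base [OF k] attach_closed [OF k] attach_carrierD(1) [OF k ga]
        B.nrm_nonneg [OF ga] attach_carrierD(3) [OF k ga]] by metis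
  have "glue D (Suc k) a = restrict (restrict g (topspace ?X)) ?S"
    using g(2) attach_carrierD(2) [OF k ga] attach_subset [OF k]
    by (intro extensionalityI [of _ ?S]) auto
  then show thesis using a level_carrierI [OF g(1)] by (intro that [of "restrict g (topspace ?X)"]) auto
qed

lemma butlast_hom:
  assumes k: "Suc k \<le> len D"
  shows "butlast \<in> unital_star_hom (stage_alg D (Suc k)) (stage_alg D k)"
proof -
  have one: "butlast \<one>\<^bsub>stage_alg D (Suc k)\<^esub> = \<one>\<^bsub>stage_alg D k\<^esub>"
    by (simp add: stage_alg_def butlast_append)
  show ?thesis
    unfolding unital_star_hom_def
  proof (intro CollectI conjI ring_hom_memI ballI allI)
    fix a c assume "a \<in> carrier (stage_alg D (Suc k))"
    then obtain a' f where a: "a = a' @ [f]" "a' \<in> stage_carrier D k" by (auto elim: stage_SucE)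
    note l = stage_carrier_length [OF a(2)]
    show "butlast a \<in> carrier (stage_alg D k)" using a by simp
    show "butlast (c \<odot>\<^bsub>stage_alg D (Suc k)\<^esub> a) = c \<odot>\<^bsub>stage_alg D k\<^esub> butlast a"
      "butlast (adj (stage_alg D (Suc k)) a) = adj (stage_alg D k) (butlast a)"
      using a stage_alg_append(3,4) [OF l l] by simp_all
    fix b assume "b \<in> carrier (stage_alg D (Suc k))"
    then obtain b' g where b: "b = b' @ [g]" "b' \<in> stage_carrier D k" by (auto elim: stage_SucE)
    note l' = stage_carrier_length [OF b(2)]
    show "butlast (a \<otimes>\<^bsub>stage_alg D (Suc k)\<^esub> b) = butlast a \<otimes>\<^bsub>stage_alg D k\<^esub> butlast b"
      "butlast (a \<oplus>\<^bsub>stage_alg D (Suc k)\<^esub> b) = butlast a \<oplus>\<^bsub>stage_alg D k\<^esub> butlast b"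
      using a b stage_alg_append(1,2) [OF l l'] by simp_all
  qed (rule one)
qed

lemma ideal_butlast:
  assumes k: "Suc k \<le> len D" and J: "ideal J (stage_alg D (Suc k))"
  shows "ideal (butlast ` J) (stage_alg D k)"
proof (rule ideal_surj_image [OF _ _ butlast_hom [OF k] _ J])
  show "carrier (stage_alg D k) \<subseteq> butlast ` carrier (stage_alg D (Suc k))"
  proof
    fix a assume "a \<in> carrier (stage_alg D k)"
    then obtain f where "a @ [f] \<in> stage_carrier D (Suc k)" using stage_extend [OF k] by auto
    then show "a \<in> butlast ` carrier (stage_alg D (Suc k))" by (metis butlast_snoc image_eqI stage_alg_carrier)
  qed
qed (use k in \<open>auto intro: cstar_stage\<close>)

lemma zero_set_butlast:
  assumes "J \<subseteq> stage_carrier D (Suc k)" "i \<le> k"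
  shows "zero_set D (butlast ` J) i = zero_set D J i"
proof -
  have "butlast a ! i = a ! i" if "a \<in> J" for a
  proof -
    have "length a = Suc (Suc k)" using assms(1) that by (intro stage_carrier_length) blast
    then show ?thesis using assms(2) by (simp add: nth_butlast)
  qed
  then show ?thesis by (simp add: zero_set_def)
qed

text \<open>The claim is an approximation and not membership in \<open>J\<close>, because the induction passes to the
  image \<open>butlast ` J\<close> of the ideal in the previous stage, and closedness of that image is not
  available at this point.\<close>

theorem ideal_approximation:
  assumes "k \<le> len D" "ideal J (stage_alg D k)" "a \<in> stage_carrier D k"
    and "\<And>i x. \<lbrakk>i \<le> k; x \<in> zero_set D J i\<rbrakk> \<Longrightarrow> (a ! i) x = 0\<^sub>m (msize D i) (msize D i)"
    and "e > 0"
  shows "\<exists>c\<in>J. nrm (stage_alg D k) (a \<ominus>\<^bsub>stage_alg D k\<^esub> c) \<le> e"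
  using assms
proof (induction k arbitrary: J a e)
  case 0
  have "\<exists>c'\<in>J. nrm (stage_alg D 0) (a \<ominus>\<^bsub>stage_alg D 0\<^esub> c') \<le> 2 * (e/2)"
  proof (rule approximation_step)
    show "\<zero>\<^bsub>stage_alg D 0\<^esub> \<in> J"
      by (rule additive_subgroup.zero_closed [OF ideal.axioms(1) [OF 0(2)]])
  qed (use 0 in \<open>auto simp: attached_def\<close>)
  then show ?case by simp
next
  case (Suc k)
  let ?S = "stage_alg D k" and ?B = "attach_alg D (Suc k)" and ?g = "glue D (Suc k)"
  note k = Suc.prems(1)
  have k': "k \<le> len D" using k by simp
  interpret J: ideal J "stage_alg D (Suc k)" by (rule Suc.prems(2))
  have J_sub: "J \<subseteq> stage_carrier D (Suc k)" using J.Icarr by auto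
  obtain a' f where a: "a = a' @ [f]" "a' \<in> stage_carrier D k" "f \<in> carrier (level_alg D (Suc k))"
    "?g a' = restrict f (attach D (Suc k))" using Suc.prems(3) by (rule stage_SucE)
  have la: "length a' = Suc k" using a(2) by (rule stage_carrier_length)
  have "\<exists>c\<in>butlast ` J. nrm ?S (a' \<ominus>\<^bsub>?S\<^esub> c) \<le> e/2"
  proof (rule Suc.IH [OF k' ideal_butlast [OF k Suc.prems(2)] a(2)])
    fix i x assume i: "i \<le> k" and "x \<in> zero_set D (butlast ` J) i"
    then have "x \<in> zero_set D J i" using zero_set_butlast [OF J_sub i] by simp
    then show "(a' ! i) x = 0\<^sub>m (msize D i) (msize D i)"
      using Suc.prems(4) [of i x] i la by (simp add: a(1) nth_append)
  qed (use Suc.prems in simp)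
  then obtain c where c: "c \<in> J" and le: "nrm ?S (a' \<ominus>\<^bsub>?S\<^esub> butlast c) \<le> e/2"
    by blast
  obtain c' g where c': "c = c' @ [g]" "c' \<in> stage_carrier D k" "g \<in> carrier (level_alg D (Suc k))"
    "?g c' = restrict g (attach D (Suc k))" using c J_sub by (blast elim: stage_SucE)
  have lc: "length c' = Suc k" using c'(2) by (rule stage_carrier_length)
  have le': "nrm ?S (a' \<ominus>\<^bsub>?S\<^esub> c') \<le> e/2" using le c'(1) by simp
  have "\<exists>c'\<in>J. nrm (stage_alg D (Suc k)) (a \<ominus>\<^bsub>stage_alg D (Suc k)\<^esub> c') \<le> 2 * (e/2)"
  proof (rule approximation_step [OF k Suc.prems(2,3) _ c])
    fix i assume i: "i < Suc k"
    then show "nrm (level_alg D i) (a ! i \<ominus>\<^bsub>level_alg D i\<^esub> c ! i) \<le> e/2"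
      using order_trans [OF stage_nrm_ub le', of i] la lc stage_diff_nth [OF k' _ a(2) c'(2), of i]
      by (simp add: a(1) c'(1) nth_append less_Suc_eq_le)
  next
    fix x assume "x \<in> attached (Suc k)"
    then have x: "x \<in> attach D (Suc k)" by (simp add: attached_def)
    have gc: "?g a' \<in> carrier ?B" "?g c' \<in> carrier ?B"
      using star_homD(1) [OF glue_hom [OF k]] a(2) c'(2) by auto
    have "?g a' \<ominus>\<^bsub>?B\<^esub> ?g c'
        = (\<lambda>x\<in>attach D (Suc k). ?g a' x - ?g c' x)"
      using cont_mat_diff [OF compact_attach [OF k]] gc
      by (simp only: attach_alg_def topspace_attach [OF k])
    then have "(a ! Suc k) x - (c ! Suc k) x = (?g a' \<ominus>\<^bsub>?B\<^esub> ?g c') x"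
      using x la lc by (simp add: a(1,4) c'(1,4) nth_append)
    also have "mat_opnorm \<dots> \<le> nrm ?B (?g a' \<ominus>\<^bsub>?B\<^esub> ?g c')"
    proof -
      interpret B: cstar_algebra ?B by (rule cstar_attach [OF k])
      show ?thesis using gc x by (intro attach_carrierD(3) [OF k]) auto
    qed
    also have "\<dots> \<le> nrm ?S (a' \<ominus>\<^bsub>?S\<^esub> c')"
      using a(2) c'(2) by (intro star_hom_dist [OF cstar_stage [OF k'] cstar_attach [OF k] glue_hom [OF k]]) auto
    finally show "mat_opnorm ((a ! Suc k) x - (c ! Suc k) x) \<le> e/2" using le' by simp
  qed (use Suc.prems in auto)
  then show ?case by simp
qed

end

section \<open>The quotient as a recursive pullback\<close>

lemma star_hom_comp:
  assumes "g \<in> unital_star_hom A B" "h \<in> unital_star_hom B C"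
  shows "(\<lambda>x. h (g x)) \<in> unital_star_hom A C"
  using star_homD [OF assms(1)] star_homD [OF assms(2)]
  unfolding unital_star_hom_def by (auto intro!: ring_hom_memI)

text \<open>A map induced by a homomorphism on a quotient is a homomorphism. This gives both the gluing
  maps of the quotient and the inverse of an isomorphism.\<close>

lemma star_hom_factor:
  assumes A: "cstar_algebra A"
    and r: "r \<in> unital_star_hom A B" and surj: "carrier B \<subseteq> r ` carrier A"
    and p: "p \<in> unital_star_hom A C" and eq: "\<And>a. a \<in> carrier A \<Longrightarrow> g (r a) = p a"
  shows "g \<in> unital_star_hom B C"
proof -
  interpret A: cstar_algebra A by (rule A)
  note rD = star_homD [OF r] and pD = star_homD [OF p]
  show ?thesis
    unfolding unital_star_hom_def
  proof (intro CollectI conjI ring_hom_memI ballI allI)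
    fix x c assume "x \<in> carrier B"
    then obtain a where a: "a \<in> carrier A" "x = r a" using surj by blast
    show "g x \<in> carrier C" using a pD(1) eq by simp
    show "g (c \<odot>\<^bsub>B\<^esub> x) = c \<odot>\<^bsub>C\<^esub> g x"
      using a eq [of "c \<odot>\<^bsub>A\<^esub> a"] eq [of a] rD(5) [of a c] pD(5) [of a c] by simp
    show "g (adj B x) = adj C (g x)"
      using a eq [of "adj A a"] eq [of a] rD(6) [of a] pD(6) [of a] by simp
    fix y assume "y \<in> carrier B"
    then obtain b where b: "b \<in> carrier A" "y = r b" using surj by blast
    show "g (x \<otimes>\<^bsub>B\<^esub> y) = g x \<otimes>\<^bsub>C\<^esub> g y"
      using a b eq [of "a \<otimes>\<^bsub>A\<^esub> b"] eq [of a] eq [of b] rD(3) [of a b] pD(3) [of a b] by simp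
    show "g (x \<oplus>\<^bsub>B\<^esub> y) = g x \<oplus>\<^bsub>C\<^esub> g y"
      using a b eq [of "a \<oplus>\<^bsub>A\<^esub> b"] eq [of a] eq [of b] rD(2) [of a b] pD(2) [of a b] by simp
  next
    show "g \<one>\<^bsub>B\<^esub> = \<one>\<^bsub>C\<^esub>" using eq [OF A.one_closed] rD(4) pD(4) by simp
  qed
qed

locale rsh_ideal = rsh D for D :: "'x rsh_data" +
  fixes K :: "('x \<Rightarrow> complex mat) list set"
  assumes K: "ideal K (stage_alg D (len D))"
begin

lemma K_sub: "K \<subseteq> stage_carrier D (len D)"
  using ideal.Icarr [OF K] by auto

definition Y :: "nat \<Rightarrow> 'x set" where
  "Y i = zero_set D K i"

lemma Y_closed: "i \<le> len D \<Longrightarrow> closedin (base D i) (Y i)"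
  unfolding Y_def by (rule zero_set_closed [OF order_refl _ K_sub])

lemma Y_sub: "i \<le> len D \<Longrightarrow> Y i \<subseteq> topspace (base D i)"
  using Y_closed closedin_subset by blast

lemma topspace_Y: "i \<le> len D \<Longrightarrow> topspace (subtopology (base D i) (Y i)) = Y i"
  using Y_sub by fastforce

lemma compact_Y: "i \<le> len D \<Longrightarrow> compact_space (subtopology (base D i) (Y i))"
  by (simp add: closedin_compact_space compact_space_subtopology Y_closed level)

text \<open>Dropping the last component of the ideal repeatedly.\<close>

lemma ideal_truncated: "k \<le> len D \<Longrightarrow> ideal (take (Suc k) ` K) (stage_alg D k)"
proof (induction rule: inc_induct)
  case base
  have "take (Suc (len D)) a = a" if "a \<in> K" for a
    using stage_carrier_length [of a D "len D"] K_sub that by auto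
  then have "take (Suc (len D)) ` K = K" by force
  then show ?case using K by simp
next
  case (step m)
  have "butlast (take (Suc (Suc m)) a) = take (Suc m) a" if "a \<in> K" for a
  proof -
    have "length a = Suc (len D)" using K_sub that by (intro stage_carrier_length) blast
    then show ?thesis using step by (simp add: butlast_take)
  qed
  then have "butlast ` take (Suc (Suc m)) ` K = take (Suc m) ` K" by (force simp: image_image)
  then show ?case using ideal_butlast [OF _ step.IH] step by simp
qed

lemma zero_set_truncated:
  "i \<le> k \<Longrightarrow> zero_set D (take (Suc k) ` K) i = Y i"
  by (simp add: zero_set_def Y_def)

text \<open>Approximating \<open>a\<close> by truncated elements of the ideal, whose images vanish on
  \<open>Y (Suc k)\<close>, shows that the gluing maps descend to the quotient.\<close>

lemma glue_vanishes:
  assumes k: "Suc k \<le> len D" and a: "a \<in> stage_carrier D k"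
    and van: "\<And>i x. \<lbrakk>i \<le> k; x \<in> Y i\<rbrakk> \<Longrightarrow> (a ! i) x = 0\<^sub>m (msize D i) (msize D i)"
    and x: "x \<in> attach D (Suc k)" "x \<in> Y (Suc k)"
  shows "glue D (Suc k) a x = 0\<^sub>m (msize D (Suc k)) (msize D (Suc k))"
proof -
  let ?B = "attach_alg D (Suc k)" and ?n = "msize D (Suc k)" and ?S = "stage_alg D k" and ?g = "glue D (Suc k)"
  have k': "k \<le> len D" using k by simp
  interpret S: cstar_algebra ?S by (rule cstar_stage [OF k'])
  interpret B: cstar_algebra ?B by (rule cstar_attach [OF k])
  have ga: "?g a \<in> carrier ?B" using star_homD(1) [OF glue_hom [OF k]] a by simp
  have gax: "?g a x \<in> carrier_mat ?n ?n" by (rule attach_carrierD(4) [OF k ga x(1)])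
  have "mat_opnorm (?g a x) \<le> 0"
  proof (rule field_le_epsilon)
    fix e :: real assume e: "e > 0"
    obtain b where b: "b \<in> K" and le: "nrm ?S (a \<ominus>\<^bsub>?S\<^esub> take (Suc k) b) \<le> e"
      using ideal_approximation [OF k' ideal_truncated [OF k'] a _ e] van zero_set_truncated by auto
    define c where "c = take (Suc k) b"
    have c: "c \<in> stage_carrier D k"
      using ideal.Icarr [OF ideal_truncated [OF k']] b by (auto simp: c_def)
    have "take (Suc (Suc k)) b \<in> stage_carrier D (Suc k)"
      using ideal.Icarr [OF ideal_truncated [OF k]] b by auto
    moreover have lb: "length b = Suc (len D)" using K_sub b by (intro stage_carrier_length) blast
    then have "take (Suc (Suc k)) b = c @ [b ! Suc k]"
      using k by (simp add: c_def take_Suc_conv_app_nth)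
    ultimately have gc: "?g c = restrict (b ! Suc k) (attach D (Suc k))"
      by (auto elim: stage_SucE)
    have gcB: "?g c \<in> carrier ?B" using star_homD(1) [OF glue_hom [OF k]] c by simp
    have "(b ! Suc k) x = 0\<^sub>m ?n ?n" using x(2) b by (auto simp: Y_def zero_set_def)
    then have "?g a x = (?g a \<ominus>\<^bsub>?B\<^esub> ?g c) x"
      using cont_mat_diff [OF compact_attach [OF k] ga [unfolded attach_alg_def] gcB [unfolded attach_alg_def]]
        x gc gax attach_subset [OF k] by (auto simp: attach_alg_def)
    also have "mat_opnorm \<dots> \<le> nrm ?B (?g a \<ominus>\<^bsub>?B\<^esub> ?g c)"
      using ga gcB x by (intro attach_carrierD(3) [OF k]) auto
    also have "\<dots> \<le> nrm ?S (a \<ominus>\<^bsub>?S\<^esub> c)"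
      using a c by (intro star_hom_dist [OF cstar_stage [OF k'] cstar_attach [OF k] glue_hom [OF k]]) auto
    finally show "mat_opnorm (?g a x) \<le> 0 + e" using le by (simp add: c_def)
  qed
  then show ?thesis using mat_opnorm_eq_0 [OF gax] mat_opnorm_nonneg [OF gax] by simp
qed

lemma glue_cong:
  assumes k: "Suc k \<le> len D" and a: "a \<in> stage_carrier D k" and b: "b \<in> stage_carrier D k"
    and eq: "\<And>i x. \<lbrakk>i \<le> k; x \<in> Y i\<rbrakk> \<Longrightarrow> (a ! i) x = (b ! i) x"
    and x: "x \<in> attach D (Suc k)" "x \<in> Y (Suc k)"
  shows "glue D (Suc k) a x = glue D (Suc k) b x"
proof -
  let ?B = "attach_alg D (Suc k)" and ?n = "msize D (Suc k)" and ?S = "stage_alg D k" and ?g = "glue D (Suc k)"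
  have k': "k \<le> len D" using k by simp
  interpret S: cstar_algebra ?S by (rule cstar_stage [OF k'])
  have g: "?g a \<in> carrier ?B" "?g b \<in> carrier ?B"
    using star_homD(1) [OF glue_hom [OF k]] a b by auto
  have ab: "a \<ominus>\<^bsub>?S\<^esub> b \<in> stage_carrier D k" using S.minus_closed [of a b] a b by simp
  have "?g (a \<ominus>\<^bsub>?S\<^esub> b) x = 0\<^sub>m ?n ?n"
  proof (rule glue_vanishes [OF k ab _ x])
    fix i y assume i: "i \<le> k" and y: "y \<in> Y i"
    have "i \<le> len D" using i k by simp
    have y': "y \<in> topspace (base D i)" using y Y_sub [OF \<open>i \<le> len D\<close>] by blast
    have L: "a ! i \<in> carrier (level_alg D i)" "b ! i \<in> carrier (level_alg D i)"
      using stage_carrier_nth a b i by auto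
    have "(b ! i) y - (b ! i) y = 0\<^sub>m (msize D i) (msize D i)"
      using level_carrierD(2) [OF L(2) y'] by (rule minus_r_inv_mat)
    then show "((a \<ominus>\<^bsub>?S\<^esub> b) ! i) y = 0\<^sub>m (msize D i) (msize D i)"
      using y' L eq [OF i y] by (simp add: stage_diff_nth [OF k' i a b] level_diff [OF \<open>i \<le> len D\<close>])
  qed
  moreover have "?g (a \<ominus>\<^bsub>?S\<^esub> b) = ?g a \<ominus>\<^bsub>?B\<^esub> ?g b"
    using a b by (intro star_hom_diff [OF cstar_stage [OF k'] cstar_attach [OF k] glue_hom [OF k]]) auto
  ultimately have 0: "?g a x - ?g b x = 0\<^sub>m ?n ?n"
    using cont_mat_diff [OF compact_attach [OF k] g(1) [unfolded attach_alg_def] g(2) [unfolded attach_alg_def]]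
      x attach_subset [OF k] by (auto simp: attach_alg_def)
  have c: "?g a x \<in> carrier_mat ?n ?n" "?g b x \<in> carrier_mat ?n ?n"
    by (rule attach_carrierD(4) [OF k g(1) x(1)], rule attach_carrierD(4) [OF k g(2) x(1)])
  show ?thesis
  proof (rule eq_matI)
    fix i j assume "i < dim_row (?g b x)" "j < dim_col (?g b x)"
    then have ij: "i < ?n" "j < ?n" using c by auto
    have "(?g a x - ?g b x) $$ (i, j) = 0" using ij 0 by simp
    then show "?g a x $$ (i, j) = ?g b x $$ (i, j)"
      using ij carrier_matD [OF c(2)] by simp
  qed (use carrier_matD [OF c(1)] carrier_matD [OF c(2)] in auto)
qed

definition restr :: "nat \<Rightarrow> ('x \<Rightarrow> complex mat) list \<Rightarrow> ('x \<Rightarrow> complex mat) list" where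
  "restr k a = map (\<lambda>i. restrict (a ! i) (Y i)) [0..<Suc k]"

lemma restr_nth: "i \<le> k \<Longrightarrow> restr k a ! i = restrict (a ! i) (Y i)"
  by (simp add: restr_def nth_append)

lemma length_restr [simp]: "length (restr k a) = Suc k"
  by (simp add: restr_def)

lemma restr_append: "length a = Suc k \<Longrightarrow> restr (Suc k) (a @ [f]) = restr k a @ [restrict f (Y (Suc k))]"
  by (simp add: restr_def nth_append)

text \<open>The decomposition of the quotient. Its gluing maps lift their argument to the given algebra in
  an arbitrary way; by \<open>glue_cong\<close> the choice does not matter.\<close>

definition E :: "'x rsh_data" where
  "E = \<lparr>len = len D, base = (\<lambda>i. subtopology (base D i) (Y i)), msize = msize D,
    attach = (\<lambda>i. attach D i \<inter> Y i),
    glue = (\<lambda>i b. restrict (glue D i (SOME a. a \<in> stage_carrier D (i - 1) \<and> restr (i - 1) a = b))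
      (attach D i \<inter> Y i))\<rparr>"

lemma E_simps [simp]:
  "len E = len D" "base E i = subtopology (base D i) (Y i)" "msize E = msize D"
  "attach E i = attach D i \<inter> Y i"
  by (simp_all add: E_def)

lemma glue_E:
  assumes k: "Suc k \<le> len D" and a: "a \<in> stage_carrier D k"
  shows "glue E (Suc k) (restr k a) = restrict (glue D (Suc k) a) (attach D (Suc k) \<inter> Y (Suc k))"
proof -
  define b where "b = (SOME b. b \<in> stage_carrier D k \<and> restr k b = restr k a)"
  have b: "b \<in> stage_carrier D k" "restr k b = restr k a"
    unfolding b_def using someI [of "\<lambda>b. b \<in> stage_carrier D k \<and> restr k b = restr k a" a] a by auto
  have "(b ! i) x = (a ! i) x" if "i \<le> k" "x \<in> Y i" for i x
    using arg_cong [OF b(2), of "\<lambda>r. (r ! i) x"] that by (simp add: restr_nth)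
  then have "glue D (Suc k) b x = glue D (Suc k) a x" if "x \<in> attach D (Suc k) \<inter> Y (Suc k)" for x
    using glue_cong [OF k b(1) a] that by blast
  then show ?thesis unfolding E_def by (simp add: b_def [symmetric] cong: restrict_cong)
qed

lemma restrict_level_hom:
  "i \<le> len D \<Longrightarrow> (\<lambda>f. restrict f (Y i)) \<in> unital_star_hom (level_alg D i) (level_alg E i)"
  unfolding level_alg_def by (simp add: restrict_star_hom Y_sub)

lemma restr_ops:
  assumes k: "k \<le> len D" and a: "a \<in> stage_carrier D k" and b: "b \<in> stage_carrier D k"
  shows "restr k (a \<otimes>\<^bsub>stage_alg D k\<^esub> b) = restr k a \<otimes>\<^bsub>stage_alg E k\<^esub> restr k b"
    and "restr k (a \<oplus>\<^bsub>stage_alg D k\<^esub> b) = restr k a \<oplus>\<^bsub>stage_alg E k\<^esub> restr k b"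
    and "restr k (c \<odot>\<^bsub>stage_alg D k\<^esub> a) = c \<odot>\<^bsub>stage_alg E k\<^esub> restr k a"
    and "restr k (adj (stage_alg D k) a) = adj (stage_alg E k) (restr k a)"
    and "restr k \<one>\<^bsub>stage_alg D k\<^esub> = \<one>\<^bsub>stage_alg E k\<^esub>"
proof -
  have h: "(\<lambda>f. restrict f (Y i)) \<in> unital_star_hom (level_alg D i) (level_alg E i)" if "i < Suc k" for i
    using that k by (intro restrict_level_hom) simp
  have c: "a ! i \<in> carrier (level_alg D i)" "b ! i \<in> carrier (level_alg D i)" if "i < Suc k" for i
    using stage_carrier_nth [OF a, of i] stage_carrier_nth [OF b, of i] that by simp_all
  have len: "length (x \<otimes>\<^bsub>stage_alg E k\<^esub> y) = Suc k" "length (x \<oplus>\<^bsub>stage_alg E k\<^esub> y) = Suc k"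
    "length (c \<odot>\<^bsub>stage_alg E k\<^esub> x) = Suc k" "length (adj (stage_alg E k) x) = Suc k"
    "length \<one>\<^bsub>stage_alg E k\<^esub> = Suc k" for x y
    by (simp_all add: stage_alg_def)
  show "restr k (a \<otimes>\<^bsub>stage_alg D k\<^esub> b) = restr k a \<otimes>\<^bsub>stage_alg E k\<^esub> restr k b"
    by (rule nth_equalityI) (use star_homD(3) [OF h] c in \<open>simp_all add: len restr_nth stage_alg_nth\<close>)
  show "restr k (a \<oplus>\<^bsub>stage_alg D k\<^esub> b) = restr k a \<oplus>\<^bsub>stage_alg E k\<^esub> restr k b"
    by (rule nth_equalityI) (use star_homD(2) [OF h] c in \<open>simp_all add: len restr_nth stage_alg_nth\<close>)
  show "restr k (c \<odot>\<^bsub>stage_alg D k\<^esub> a) = c \<odot>\<^bsub>stage_alg E k\<^esub> restr k a"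
    by (rule nth_equalityI) (use star_homD(5) [OF h] c in \<open>simp_all add: len restr_nth stage_alg_nth\<close>)
  show "restr k (adj (stage_alg D k) a) = adj (stage_alg E k) (restr k a)"
    by (rule nth_equalityI) (use star_homD(6) [OF h] c in \<open>simp_all add: len restr_nth stage_alg_nth\<close>)
  show "restr k \<one>\<^bsub>stage_alg D k\<^esub> = \<one>\<^bsub>stage_alg E k\<^esub>"
    by (rule nth_equalityI) (use star_homD(4) [OF h] in \<open>simp_all add: len restr_nth stage_alg_nth\<close>)
qed

lemma level_E_carrierD:
  assumes i: "i \<le> len D" and f: "f \<in> carrier (level_alg E i)"
  shows "mat_continuous (subtopology (base D i) (Y i)) (msize D i) f" "f \<in> extensional (Y i)"
    and "x \<in> Y i \<Longrightarrow> mat_opnorm (f x) \<le> nrm (level_alg E i) f"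
    and "0 \<le> nrm (level_alg E i) f"
proof -
  have f': "f \<in> carrier (cont_mat (subtopology (base D i) (Y i)) (msize D i))"
    using f by (simp add: level_alg_def)
  note X = cont_mat_carrierD [OF f'] cont_mat_nrm_ub [OF compact_Y [OF i] f']
    cont_mat_nrm_nonneg [OF compact_Y [OF i] f']
  show "mat_continuous (subtopology (base D i) (Y i)) (msize D i) f" by (rule X)
  show "f \<in> extensional (Y i)" using X(2) by (simp only: topspace_Y [OF i])
  show "x \<in> Y i \<Longrightarrow> mat_opnorm (f x) \<le> nrm (level_alg E i) f"
    using X(4) by (simp only: topspace_Y [OF i] level_alg_def E_simps)
  show "0 \<le> nrm (level_alg E i) f" using X(5) by (simp add: level_alg_def)
qed

text \<open>Surjectivity is an iterated Tietze extension: at each level the function is prescribed on the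
  attached part by the lower levels and on \<open>Y\<close> by the given element. The extension can be chosen
  without increasing the norm.\<close>

lemma restr_stage:
  assumes "k \<le> len D"
  shows "(\<forall>a\<in>stage_carrier D k. restr k a \<in> stage_carrier E k) \<and>
    (\<forall>b\<in>stage_carrier E k. \<exists>a\<in>stage_carrier D k. restr k a = b \<and> nrm (stage_alg D k) a \<le> nrm (stage_alg E k) b)"
  using assms
proof (induction k)
  case 0
  show ?case
  proof (intro conjI ballI)
    fix a assume "a \<in> stage_carrier D 0"
    then show "restr 0 a \<in> stage_carrier E 0"
      using star_homD(1) [OF restrict_level_hom [of 0]] by (auto simp: restr_def)
  next
    fix b assume "b \<in> stage_carrier E 0"
    then obtain g where b: "b = [g]" and g: "g \<in> carrier (level_alg E 0)" by auto
    have z: "0 \<le> len D" by simp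
    note gD = level_E_carrierD [OF z g]
    note T = mat_Tietze_bounded [OF normal_base [OF z] Y_closed [OF z] gD(1) gD(4) gD(3)]
    obtain f where f: "mat_continuous (base D 0) (msize D 0) f" "\<And>x. x \<in> Y 0 \<Longrightarrow> f x = g x"
      "\<And>x. x \<in> topspace (base D 0) \<Longrightarrow> mat_opnorm (f x) \<le> nrm (level_alg E 0) g"
      by (rule T) (assumption, rule that)
    have "restrict (restrict f (topspace (base D 0))) (Y 0) = g"
      using f(2) gD(2) Y_sub [of 0] by (intro extensionalityI [of _ "Y 0"]) auto
    moreover have "nrm (level_alg D 0) (restrict f (topspace (base D 0))) \<le> nrm (level_alg E 0) g"
      using f(3) gD(4) by (intro level_nrm_le) auto
    ultimately show "\<exists>a\<in>stage_carrier D 0. restr 0 a = b \<and> nrm (stage_alg D 0) a \<le> nrm (stage_alg E 0) b"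
      using level_carrierI [OF f(1)]
      by (intro bexI [of _ "[restrict f (topspace (base D 0))]"]) (auto simp: b restr_def stage_alg_def)
  qed
next
  case (Suc k)
  note k = Suc.prems
  have k': "k \<le> len D" using k by simp
  let ?X = "base D (Suc k)" and ?S = "attach D (Suc k)" and ?n = "msize D (Suc k)" and ?Y = "Y (Suc k)"
  interpret S: cstar_algebra "stage_alg D k" by (rule cstar_stage [OF k'])
  have IH1: "restr k a \<in> stage_carrier E k" if "a \<in> stage_carrier D k" for a
    using Suc.IH k' that by blast
  show ?case
  proof (intro conjI ballI)
    fix a assume "a \<in> stage_carrier D (Suc k)"
    then obtain a' f where a: "a = a' @ [f]" "a' \<in> stage_carrier D k" "f \<in> carrier (level_alg D (Suc k))"
      "glue D (Suc k) a' = restrict f ?S" by (rule stage_SucE)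
    have "glue E (Suc k) (restr k a') = restrict (restrict f ?Y) (attach E (Suc k))"
      using glue_E [OF k a(2)] a(4) by (auto simp: Int_commute)
    moreover have "restrict f ?Y \<in> carrier (level_alg E (Suc k))"
      using star_homD(1) [OF restrict_level_hom [OF k]] a(3) .
    ultimately show "restr (Suc k) a \<in> stage_carrier E (Suc k)"
      using IH1 [OF a(2)] by (auto simp: a(1) restr_append [OF stage_carrier_length [OF a(2)]])
  next
    fix b assume "b \<in> stage_carrier E (Suc k)"
    then obtain b' g where b: "b = b' @ [g]" "b' \<in> stage_carrier E k" "g \<in> carrier (level_alg E (Suc k))"
      "glue E (Suc k) b' = restrict g (attach E (Suc k))"
      by (auto simp del: E_simps)
    note gD = level_E_carrierD [OF k b(3)]
    have lb: "length b' = Suc k" using b(2) by (rule stage_carrier_length)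
    define M where "M = nrm (stage_alg E (Suc k)) b"
    have gM: "nrm (level_alg E (Suc k)) g \<le> M"
      using stage_nrm_ub [of "Suc k" "Suc k" E b] lb by (simp add: M_def b(1) nth_append)
    have bM: "nrm (stage_alg E k) b' \<le> M"
    proof -
      have "nrm (level_alg E i) (b' ! i) \<le> M" if "i \<le> k" for i
        using stage_nrm_ub [of i "Suc k" E b] that lb by (simp add: M_def b(1) nth_append)
      then show ?thesis by (simp add: stage_nrm_le_iff)
    qed
    obtain a' where a': "a' \<in> stage_carrier D k" "restr k a' = b'" "nrm (stage_alg D k) a' \<le> nrm (stage_alg E k) b'"
      using Suc.IH k' b(2) by blast
    let ?B = "attach_alg D (Suc k)"
    let ?\<gamma> = "glue D (Suc k) a'"
    have \<gamma>: "?\<gamma> \<in> carrier ?B" using star_homD(1) [OF glue_hom [OF k]] a' by simp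
    have "nrm ?B ?\<gamma> \<le> nrm (stage_alg D k) a'"
      using a'(1) by (intro star_hom_contractive [OF cstar_stage [OF k'] cstar_attach [OF k] glue_hom [OF k]]) simp
    then have \<gamma>M: "mat_opnorm (?\<gamma> x) \<le> M" if "x \<in> ?S" for x
      using attach_carrierD(3) [OF k \<gamma> that] a'(3) bM by linarith
    have agree: "?\<gamma> x = g x" if x: "x \<in> ?S \<inter> ?Y" for x
      using glue_E [OF k a'(1)] b(4) a'(2) x by (metis E_simps(4) restrict_apply')
    have cont: "mat_continuous (subtopology ?X (?S \<union> ?Y)) ?n (\<lambda>x. if x \<in> ?S then ?\<gamma> x else g x)"
      by (rule mat_continuous_Un_closed [OF attach_closed [OF k] Y_closed [OF k] attach_carrierD(1) [OF k \<gamma>] gD(1) agree])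
    have clo: "closedin ?X (?S \<union> ?Y)" by (intro closedin_Un attach_closed Y_closed k)
    have bound: "mat_opnorm (if x \<in> ?S then ?\<gamma> x else g x) \<le> M" if "x \<in> ?S \<union> ?Y" for x
      using that \<gamma>M order_trans [OF gD(3) gM] by auto
    have "M \<ge> 0" using gD(4) gM by simp
    obtain f where f: "mat_continuous ?X ?n f" "\<And>x. x \<in> ?S \<union> ?Y \<Longrightarrow> f x = (if x \<in> ?S then ?\<gamma> x else g x)"
      "\<And>x. x \<in> topspace ?X \<Longrightarrow> mat_opnorm (f x) \<le> M"
      by (rule mat_Tietze_bounded [OF normal_base [OF k] clo cont \<open>M \<ge> 0\<close> bound]) blast+
    let ?f = "restrict f (topspace ?X)"
    have "?\<gamma> = restrict ?f ?S"
      using f(2) attach_carrierD(2) [OF k \<gamma>] attach_subset [OF k] by (intro extensionalityI [of _ ?S]) auto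
    then have mem: "a' @ [?f] \<in> stage_carrier D (Suc k)" using a'(1) level_carrierI [OF f(1)] by auto
    have "f x = g x" if "x \<in> ?Y" for x using f(2) [of x] agree [of x] that by auto
    then have "restrict ?f ?Y = g"
      using gD(2) Y_sub [OF k] by (intro extensionalityI [of _ ?Y]) auto
    then have res: "restr (Suc k) (a' @ [?f]) = b"
      by (simp add: restr_append [OF stage_carrier_length [OF a'(1)]] a'(2) b(1))
    have la: "length a' = Suc k" using a'(1) by (rule stage_carrier_length)
    have fM: "nrm (level_alg D (Suc k)) ?f \<le> M"
      using f(3) \<open>M \<ge> 0\<close> by (intro level_nrm_le) auto
    have "nrm (level_alg D i) ((a' @ [?f]) ! i) \<le> M" if "i \<le> Suc k" for i
    proof (cases "i = Suc k")
      case True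
      then show ?thesis using fM la by (simp add: nth_append)
    next
      case False
      then show ?thesis using stage_nrm_ub [of i k D a'] a'(3) bM la that by (simp add: nth_append)
    qed
    then have "nrm (stage_alg D (Suc k)) (a' @ [?f]) \<le> nrm (stage_alg E (Suc k)) b"
      by (simp add: stage_nrm_le_iff M_def)
    then show "\<exists>a\<in>stage_carrier D (Suc k). restr (Suc k) a = b \<and>
        nrm (stage_alg D (Suc k)) a \<le> nrm (stage_alg E (Suc k)) b"
      using mem res by blast
  qed
qed

lemma restr_hom: "k \<le> len D \<Longrightarrow> restr k \<in> unital_star_hom (stage_alg D k) (stage_alg E k)"
  using restr_ops restr_stage [of k] stage_closed [of k]
  unfolding unital_star_hom_def by (auto intro!: ring_hom_memI)

lemma restr_surj: "k \<le> len D \<Longrightarrow> carrier (stage_alg E k) \<subseteq> restr k ` carrier (stage_alg D k)"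
  using restr_stage [of k] by fastforce

theorem E_valid: "rsh_data_valid E"
  unfolding rsh_data_valid_def
proof (intro conjI allI impI)
  fix k assume "k \<le> len E"
  then have k: "k \<le> len D" by simp
  show "compact_space (base E k)" "Hausdorff_space (base E k)" "1 \<le> msize E k"
    using level [OF k] compact_Y [OF k] by (auto simp: Hausdorff_space_subtopology)
next
  fix k assume "k < len E"
  then have k: "Suc k \<le> len D" by simp
  then have k': "k \<le> len D" by simp
  let ?X = "base D (Suc k)" and ?S = "attach D (Suc k)" and ?Y = "Y (Suc k)"
  show "closedin (base E (Suc k)) (attach E (Suc k))"
    using attach_closed [OF k] closedin_subtopology_Int_closed [of ?X ?S ?Y] by (simp add: Int_commute)
  have "subtopology (subtopology ?X ?Y) (?S \<inter> ?Y) = subtopology (subtopology ?X ?S) (?S \<inter> ?Y)"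
    by (simp add: subtopology_subtopology Int_ac)
  then have eq: "attach_alg E (Suc k) = cont_mat (subtopology (subtopology ?X ?S) (?S \<inter> ?Y)) (msize D (Suc k))"
    by (simp add: attach_alg_def)
  have "(\<lambda>f. restrict f (?S \<inter> ?Y)) \<in> unital_star_hom (attach_alg D (Suc k)) (attach_alg E (Suc k))"
    unfolding eq unfolding attach_alg_def using attach_subset [OF k] by (intro restrict_star_hom) auto
  from star_hom_comp [OF glue_hom [OF k] this]
  show "glue E (Suc k) \<in> unital_star_hom (stage_alg E k) (attach_alg E (Suc k))"
    by (rule star_hom_factor [OF cstar_stage [OF k'] restr_hom [OF k'] restr_surj [OF k']])
      (simp add: glue_E [OF k])
qed

end

section \<open>Quotients of C*-algebras\<close>

lemma star_hom_inv:
  assumes A: "cstar_algebra A" and h: "h \<in> unital_star_hom A B" and bij: "bij_betw h (carrier A) (carrier B)"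
  shows "inv_into (carrier A) h \<in> unital_star_hom B A"
proof -
  interpret A: cstar_algebra A by (rule A)
  have id: "(\<lambda>x. x) \<in> unital_star_hom A A"
    unfolding unital_star_hom_def by (auto intro: ring_hom_memI)
  show ?thesis
    by (rule star_hom_factor [OF A h _ id])
      (use bij in \<open>auto simp: bij_betw_def\<close>)
qed

text \<open>The fibres of \<open>\<phi>\<close> are the cosets of its kernel. Since every element of \<open>Q\<close> has a preimage of no
  larger norm, the quotient norm is the norm of \<open>Q\<close>.\<close>

theorem cstar_quotient_by_kernel:
  fixes A :: "'a cstar" and Q :: "'q cstar"
  assumes A: "cstar_algebra A" and Q: "cstar_algebra Q" and \<phi>: "\<phi> \<in> unital_star_hom A Q"
    and I: "ideal I A" and ker: "\<And>x. x \<in> carrier A \<Longrightarrow> x \<in> I \<longleftrightarrow> \<phi> x = \<zero>\<^bsub>Q\<^esub>"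
    and lift: "\<And>q. q \<in> carrier Q \<Longrightarrow> \<exists>x\<in>carrier A. \<phi> x = q \<and> nrm A x \<le> nrm Q q"
  shows "cstar_algebra (cstar_quotient A I)" "star_isomorphic (cstar_quotient A I) Q"
proof -
  interpret A: cstar_algebra A by (rule A)
  interpret Q: cstar_algebra Q by (rule Q)
  interpret I: ideal I A by (rule I)
  note \<phi>D = star_homD [OF \<phi>]
  let ?B = "cstar_quotient A I"
  define cs where "cs x = I +>\<^bsub>A\<^esub> x" for x
  have cs_eq: "cs x = cs y \<longleftrightarrow> \<phi> x = \<phi> y" if xy: "x \<in> carrier A" "y \<in> carrier A" for x y
  proof -
    have "cs x = cs y \<longleftrightarrow> \<phi> x \<ominus>\<^bsub>Q\<^esub> \<phi> y = \<zero>\<^bsub>Q\<^esub>"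
      using A.quotient_eq_iff_same_a_r_cos [OF I xy] ker [of "x \<ominus>\<^bsub>A\<^esub> y"] xy star_hom_diff [OF A Q \<phi> xy]
      by (simp add: cs_def)
    then show ?thesis using \<phi>D(1) xy by simp
  qed
  have mem_cs: "y \<in> cs x \<longleftrightarrow> y \<in> carrier A \<and> \<phi> y = \<phi> x" if x: "x \<in> carrier A" for x y
  proof -
    have I0: "\<zero>\<^bsub>A\<^esub> \<in> I" by (rule additive_subgroup.zero_closed [OF ideal.axioms(1) [OF I]])
    show ?thesis
    proof
      assume "y \<in> cs x"
      then obtain i where i: "i \<in> I" "y = i \<oplus>\<^bsub>A\<^esub> x" by (auto simp: cs_def a_r_coset_def')
      have iA: "i \<in> carrier A" using I.Icarr [OF i(1)] .
      have "\<phi> i = \<zero>\<^bsub>Q\<^esub>" using ker [OF iA] i(1) by blast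
      then show "y \<in> carrier A \<and> \<phi> y = \<phi> x" using \<phi>D(1) [OF x] \<phi>D(2) [OF iA x] iA x i(2) by simp
    next
      assume y: "y \<in> carrier A \<and> \<phi> y = \<phi> x"
      then have "y \<in> cs y" using I0 unfolding cs_def a_r_coset_def' by force
      also have "cs y = cs x" using cs_eq [OF _ x, of y] y by blast
      finally show "y \<in> cs x" .
    qed
  qed
  have carrier: "carrier ?B = cs ` carrier A"
    by (auto simp: cstar_quotient_def FactRing_def A_RCOSETS_def' cs_def)
  have ops: "cs x \<otimes>\<^bsub>?B\<^esub> cs y = cs (x \<otimes>\<^bsub>A\<^esub> y)" "cs x \<oplus>\<^bsub>?B\<^esub> cs y = cs (x \<oplus>\<^bsub>A\<^esub> y)"
    if "x \<in> carrier A" "y \<in> carrier A" for x y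
    using that I.rcoset_mult_add [of x y] I.a_rcos_sum [of x y]
    by (simp_all add: cstar_quotient_def FactRing_def cs_def)
  have one: "\<one>\<^bsub>?B\<^esub> = cs \<one>\<^bsub>A\<^esub>" by (simp add: cstar_quotient_def FactRing_def cs_def)
  have zero: "\<zero>\<^bsub>?B\<^esub> = cs \<zero>\<^bsub>A\<^esub>"
    using A.a_rcos_zero [OF I additive_subgroup.zero_closed [OF ideal.axioms(1) [OF I]]]
    by (simp add: cstar_quotient_def FactRing_def cs_def)
  have UN_cs: "(\<Union>y\<in>cs x. cs (f y)) = cs (f x)"
    if x: "x \<in> carrier A" and f: "\<And>y. y \<in> carrier A \<Longrightarrow> f y \<in> carrier A"
      and eq: "\<And>y. \<lbrakk>y \<in> carrier A; \<phi> y = \<phi> x\<rbrakk> \<Longrightarrow> \<phi> (f y) = \<phi> (f x)" for x f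
  proof -
    have "cs (f y) = cs (f x)" if "y \<in> cs x" for y
    proof -
      have y: "y \<in> carrier A" "\<phi> y = \<phi> x" using that mem_cs [OF x] by auto
      then show ?thesis using cs_eq [OF f [OF y(1)] f [OF x]] eq [OF y] by blast
    qed
    moreover have "x \<in> cs x" using mem_cs [OF x] x by blast
    ultimately show ?thesis by blast
  qed
  have smult: "c \<odot>\<^bsub>?B\<^esub> cs x = cs (c \<odot>\<^bsub>A\<^esub> x)" if x: "x \<in> carrier A" for c x
    using UN_cs [of x "\<lambda>y. c \<odot>\<^bsub>A\<^esub> y"] x \<phi>D(5) by (simp add: cstar_quotient_def cs_def)
  have adj: "adj ?B (cs x) = cs (adj A x)" if x: "x \<in> carrier A" for x
    using UN_cs [of x "adj A"] x \<phi>D(6) by (simp add: cstar_quotient_def cs_def)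
  have nrm: "nrm ?B (cs x) = nrm Q (\<phi> x)" if x: "x \<in> carrier A" for x
  proof -
    have "(INF y\<in>cs x. nrm A y) = nrm Q (\<phi> x)"
    proof (rule antisym)
      obtain y where y: "y \<in> carrier A" "\<phi> y = \<phi> x" "nrm A y \<le> nrm Q (\<phi> x)"
        using lift [OF \<phi>D(1) [OF x]] by blast
      have "(INF y\<in>cs x. nrm A y) \<le> nrm A y"
        by (rule cINF_lower) (use x y in \<open>auto simp: mem_cs A.nrm_nonneg intro!: bdd_belowI [of _ 0]\<close>)
      then show "(INF y\<in>cs x. nrm A y) \<le> nrm Q (\<phi> x)" using y by simp
      show "nrm Q (\<phi> x) \<le> (INF y\<in>cs x. nrm A y)"
      proof (rule cINF_greatest)
        show "cs x \<noteq> {}" using mem_cs [OF x, of x] x by auto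
        fix y assume "y \<in> cs x"
        then have y: "y \<in> carrier A" "\<phi> y = \<phi> x" using mem_cs [OF x] by auto
        show "nrm Q (\<phi> x) \<le> nrm A y"
          using star_hom_contractive [OF A Q \<phi> y(1)] y(2) by simp
      qed
    qed
    then show ?thesis by (simp add: cstar_quotient_def)
  qed
  define \<theta> where "\<theta> S = \<phi> (SOME x. x \<in> S)" for S
  have \<theta>: "\<theta> (cs x) = \<phi> x" if x: "x \<in> carrier A" for x
  proof -
    have "x \<in> cs x" using mem_cs [OF x] x by blast
    then have "(SOME y. y \<in> cs x) \<in> cs x" by (rule someI [of "\<lambda>y. y \<in> cs x"])
    then show ?thesis unfolding \<theta>_def using mem_cs [OF x] by blast
  qed
  note simps = ops one zero smult adj nrm \<theta> carrier
  have \<phi>_zero: "\<phi> \<zero>\<^bsub>A\<^esub> = \<zero>\<^bsub>Q\<^esub>"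
    using ker [OF A.zero_closed] additive_subgroup.zero_closed [OF ideal.axioms(1) [OF I]] by blast
  have \<theta>_inj: "S = T" if S: "S \<in> carrier ?B" and T: "T \<in> carrier ?B" and eq: "\<theta> S = \<theta> T" for S T
  proof -
    obtain x y where "x \<in> carrier A" "S = cs x" "y \<in> carrier A" "T = cs y"
      using S T unfolding carrier by blast
    then show ?thesis using eq cs_eq [of x y] \<theta> by simp
  qed
  show "cstar_algebra ?B"
  proof (rule subdirect_cstar_algebra [where J = "{()}" and B = "\<lambda>_. Q" and \<pi> = "\<lambda>_. \<theta>"])
    fix \<sigma> :: "nat \<Rightarrow> 'a set"
    assume \<sigma>: "\<And>n. \<sigma> n \<in> carrier ?B"
      and Cau: "\<And>e. e > 0 \<Longrightarrow> \<exists>N. \<forall>m\<ge>N. \<forall>n\<ge>N. \<forall>i\<in>{()}. nrm Q (\<theta> (\<sigma> m) \<ominus>\<^bsub>Q\<^esub> \<theta> (\<sigma> n)) < e"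
    have \<theta>\<sigma>: "\<theta> (\<sigma> n) \<in> carrier Q" for n using \<sigma> [of n] \<phi>D(1) by (auto simp: simps)
    obtain q where q: "q \<in> carrier Q" and lim: "\<And>e. e > 0 \<Longrightarrow> \<exists>N. \<forall>n\<ge>N. nrm Q (\<theta> (\<sigma> n) \<ominus>\<^bsub>Q\<^esub> q) < e"
    proof (rule Q.Cauchy_converges [of "\<lambda>n. \<theta> (\<sigma> n)", OF \<theta>\<sigma>])
      show "\<exists>N. \<forall>m\<ge>N. \<forall>n\<ge>N. nrm Q (\<theta> (\<sigma> m) \<ominus>\<^bsub>Q\<^esub> \<theta> (\<sigma> n)) < e" if "e > 0" for e
        using Cau [OF that] by simp
    qed (blast intro: that)
    obtain x where x: "x \<in> carrier A" "\<phi> x = q" using lift [OF q] by blast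
    have "\<exists>N. \<forall>n\<ge>N. \<forall>i\<in>{()}. nrm Q (\<theta> (\<sigma> n) \<ominus>\<^bsub>Q\<^esub> \<theta> (cs x)) \<le> e" if "e > 0" for e
      using lim [OF that] x by (simp add: \<theta>) (meson less_imp_le)
    then show "\<exists>l\<in>carrier ?B. \<forall>e>0. \<exists>N. \<forall>n\<ge>N. \<forall>i\<in>{()}. nrm Q (\<theta> (\<sigma> n) \<ominus>\<^bsub>Q\<^esub> \<theta> l) \<le> e"
      using x(1) by (intro bexI [of _ "cs x"]) (auto simp: carrier)
  next
    fix S T assume "S \<in> carrier ?B" "T \<in> carrier ?B" "\<And>i. i \<in> {()} \<Longrightarrow> \<theta> S = \<theta> T"
    then show "S = T" by (intro \<theta>_inj) auto
  qed (use \<phi>D \<phi>_zero Q.nrm_nonneg Q in \<open>auto simp: simps\<close>)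
  have "\<theta> \<in> unital_star_hom ?B Q"
    unfolding unital_star_hom_def using \<phi>D by (auto simp: simps intro!: ring_hom_memI)
  moreover have "bij_betw \<theta> (carrier ?B) (carrier Q)"
    unfolding bij_betw_def
  proof
    show "inj_on \<theta> (carrier ?B)" using \<theta>_inj by (intro inj_onI)
    show "\<theta> ` carrier ?B = carrier Q"
    proof
      show "\<theta> ` carrier ?B \<subseteq> carrier Q" using \<phi>D(1) by (auto simp: simps)
      show "carrier Q \<subseteq> \<theta> ` carrier ?B"
      proof
        fix q assume "q \<in> carrier Q"
        then obtain x where "x \<in> carrier A" "\<phi> x = q" using lift by blast
        then show "q \<in> \<theta> ` carrier ?B" by (metis \<theta> carrier image_eqI)
      qed
    qed
  qed
  ultimately show "star_isomorphic ?B Q" unfolding star_isomorphic_def by blast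
qed

section \<open>Dimension of closed subspaces\<close>

text \<open>A finite open cover of the subspace is extended to the whole space, refined there, and
  restricted again; restriction does not increase the number of members through a point.\<close>

lemma covering_dim_closed_subspace:
  assumes Y: "closedin X Y"
  shows "covering_dim (subtopology X Y) \<le> covering_dim X"
proof -
  have Y_sub: "Y \<subseteq> topspace X" using Y by (rule closedin_subset)
  then have top: "topspace (subtopology X Y) = Y" by auto
  have "\<exists>\<V>. finite_open_cover (subtopology X Y) \<V> \<and> (\<forall>V\<in>\<V>. \<exists>U\<in>\<U>. V \<subseteq> U) \<and>
      (\<forall>x\<in>topspace (subtopology X Y). card {V \<in> \<V>. x \<in> V} \<le> m)"
    if m: "\<And>\<U>. finite_open_cover X \<U> \<Longrightarrow> \<exists>\<V>. finite_open_cover X \<V> \<and> (\<forall>V\<in>\<V>. \<exists>U\<in>\<U>. V \<subseteq> U) \<and>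
      (\<forall>x\<in>topspace X. card {V \<in> \<V>. x \<in> V} \<le> m)"
      and \<U>: "finite_open_cover (subtopology X Y) \<U>" for m :: nat and \<U>
  proof (cases "\<U> = {}")
    case True
    then have "topspace (subtopology X Y) = {}" using \<U> by (simp add: finite_open_cover_def)
    then show ?thesis using \<U> True by (intro exI [of _ "{}"]) auto
  next
    case False
    have "\<forall>U\<in>\<U>. \<exists>W. openin X W \<and> U = W \<inter> Y"
      using \<U> by (auto simp: finite_open_cover_def openin_subtopology)
    then obtain W where W: "\<And>U. U \<in> \<U> \<Longrightarrow> openin X (W U)" "\<And>U. U \<in> \<U> \<Longrightarrow> U = W U \<inter> Y"
      by metis
    \<comment> \<open>Each member is enlarged by the open complement of \<open>Y\<close>, which gives a cover of \<open>X\<close>.\<close>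
    define \<W> where "\<W> = (\<lambda>U. W U \<union> (topspace X - Y)) ` \<U>"
    have "finite_open_cover X \<W>"
      unfolding finite_open_cover_def
    proof (intro conjI ballI)
      show "finite \<W>" using \<U> by (simp add: \<W>_def finite_open_cover_def)
      show "openin X V" if "V \<in> \<W>" for V
        using that W(1) Y by (auto simp: \<W>_def closedin_def)
      have "topspace X \<subseteq> \<Union>\<W>"
      proof
        fix x assume x: "x \<in> topspace X"
        show "x \<in> \<Union>\<W>"
        proof (cases "x \<in> Y")
          case True
          then have "x \<in> \<Union>\<U>" using \<U> top by (simp add: finite_open_cover_def)
          then show ?thesis using W(2) by (auto simp: \<W>_def)
        next
          case out: False
          then show ?thesis using x False by (auto simp: \<W>_def)
        qed
      qed
      moreover have "\<Union>\<W> \<subseteq> topspace X"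
        using W(1) openin_subset by (fastforce simp: \<W>_def)
      ultimately show "\<Union>\<W> = topspace X" by blast
    qed
    then obtain \<V> where \<V>: "finite_open_cover X \<V>" "\<forall>V\<in>\<V>. \<exists>U\<in>\<W>. V \<subseteq> U"
      "\<forall>x\<in>topspace X. card {V \<in> \<V>. x \<in> V} \<le> m" using m by blast
    define \<V>' where "\<V>' = (\<lambda>V. V \<inter> Y) ` \<V>"
    have fin: "finite \<V>" using \<V> by (simp add: finite_open_cover_def)
    show ?thesis
    proof (intro exI [of _ \<V>'] conjI ballI)
      show "finite_open_cover (subtopology X Y) \<V>'"
        unfolding finite_open_cover_def
      proof (intro conjI ballI)
        show "finite \<V>'" using fin by (simp add: \<V>'_def)
        show "openin (subtopology X Y) V" if "V \<in> \<V>'" for V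
          using that \<V>(1) by (auto simp: \<V>'_def finite_open_cover_def openin_subtopology)
        have "\<Union>\<V>' = \<Union>\<V> \<inter> Y" by (auto simp: \<V>'_def)
        also have "\<dots> = Y" using \<V>(1) Y_sub by (auto simp: finite_open_cover_def)
        finally show "\<Union>\<V>' = topspace (subtopology X Y)" by (simp only: top)
      qed
      fix V' assume "V' \<in> \<V>'"
      then obtain V where V: "V \<in> \<V>" "V' = V \<inter> Y" by (auto simp: \<V>'_def)
      then obtain U where U: "U \<in> \<U>" "V \<subseteq> W U \<union> (topspace X - Y)" using \<V>(2) by (auto simp: \<W>_def)
      have "V' \<subseteq> U" using V(2) U(2) W(2) [OF U(1)] by blast
      then show "\<exists>U\<in>\<U>. V' \<subseteq> U" using U(1) by blast
    next
      fix x assume "x \<in> topspace (subtopology X Y)"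
      then have x: "x \<in> Y" by (simp only: top)
      have "{V \<in> \<V>'. x \<in> V} \<subseteq> (\<lambda>V. V \<inter> Y) ` {V \<in> \<V>. x \<in> V}" by (auto simp: \<V>'_def)
      then have "card {V \<in> \<V>'. x \<in> V} \<le> card {V \<in> \<V>. x \<in> V}"
        using fin by (intro surj_card_le) auto
      then show "card {V \<in> \<V>'. x \<in> V} \<le> m" using \<V>(3) x Y_sub by force
    qed
  qed
  then show ?thesis
    unfolding covering_dim_def by (intro INF_superset_mono) auto
qed

section \<open>Quotients of recursive subhomogeneous algebras\<close>

theorem proposition3p1:
  fixes A :: "'a cstar" and D :: "'x rsh_data" and I :: "'a set"
  assumes "rsh_decomposition A D"
    and "separable_space (cstar_topology A)"
    and "cstar_ideal I A"
  shows "\<exists>E :: 'x rsh_data. rsh_decomposition (cstar_quotient A I) E \<and>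
           topological_dim E \<le> topological_dim D \<and>
           max_matrix_size E \<le> max_matrix_size D"
proof -
  have A: "cstar_algebra A" and valid: "rsh_data_valid D"
    and iso: "star_isomorphic A (stage_alg D (len D))"
    using assms(1) by (auto simp: rsh_decomposition_def)
  have I: "ideal I A" and I_closed: "closedin (cstar_topology A) I"
    using assms(3) by (auto simp: cstar_ideal_def)
  let ?S = "stage_alg D (len D)"
  interpret A: cstar_algebra A by (rule A)
  interpret D: rsh D by unfold_locales (rule valid)
  have S: "cstar_algebra ?S" by (rule D.cstar_stage) simp
  interpret S: cstar_algebra ?S by (rule S)
  obtain h where h: "h \<in> unital_star_hom A ?S" and bij: "bij_betw h (carrier A) (carrier ?S)"
    using iso by (auto simp: star_isomorphic_def)
  let ?g = "inv_into (carrier A) h"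
  have g: "?g \<in> unital_star_hom ?S A" by (rule star_hom_inv [OF A h bij])
  have gh: "?g (h x) = x" if "x \<in> carrier A" for x
    using bij that by (auto simp: bij_betw_def)
  have hg: "h (?g s) = s" if "s \<in> carrier ?S" for s
    using bij that by (auto simp: bij_betw_def f_inv_into_f)
  have surj: "carrier ?S \<subseteq> h ` carrier A" using bij by (auto simp: bij_betw_def)
  interpret R: rsh_ideal D "h ` I"
    by (intro rsh_ideal.intro rsh_ideal_axioms.intro D.rsh_axioms ideal_surj_image [OF A S h surj I])
  let ?E = "R.E" and ?Q = "stage_alg R.E (len D)" and ?r = "R.restr (len D)"
  interpret E: rsh ?E by unfold_locales (rule R.E_valid)
  have Q: "cstar_algebra ?Q" by (rule E.cstar_stage) simp
  interpret Q: cstar_algebra ?Q by (rule Q)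
  have r: "?r \<in> unital_star_hom ?S ?Q" by (rule R.restr_hom) simp
  have \<phi>: "(\<lambda>x. ?r (h x)) \<in> unital_star_hom A ?Q" by (rule star_hom_comp [OF h r])
  have r_zero: "?r a = \<zero>\<^bsub>?Q\<^esub> \<longleftrightarrow> (\<forall>i\<le>len D. \<forall>x\<in>R.Y i. (a ! i) x = 0\<^sub>m (msize D i) (msize D i))" for a
  proof -
    have "?r a = \<zero>\<^bsub>?Q\<^esub> \<longleftrightarrow> (\<forall>i\<le>len D. ?r a ! i = \<zero>\<^bsub>?Q\<^esub> ! i)"
      by (auto simp: list_eq_iff_nth_eq stage_alg_def less_Suc_eq_le simp del: upt_Suc)
    also have "\<dots> \<longleftrightarrow> (\<forall>i\<le>len D. restrict (a ! i) (R.Y i) = (\<lambda>x\<in>R.Y i. 0\<^sub>m (msize D i) (msize D i)))"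
      by (auto simp: R.restr_nth stage_alg_nth level_alg_def R.topspace_Y [simplified])
    also have "\<dots> \<longleftrightarrow> (\<forall>i\<le>len D. \<forall>x\<in>R.Y i. (a ! i) x = 0\<^sub>m (msize D i) (msize D i))"
      by (auto simp: fun_eq_iff restrict_def)
    finally show ?thesis .
  qed
  have ker: "x \<in> I \<longleftrightarrow> ?r (h x) = \<zero>\<^bsub>?Q\<^esub>" if x: "x \<in> carrier A" for x
  proof
    assume "x \<in> I"
    then show "?r (h x) = \<zero>\<^bsub>?Q\<^esub>" unfolding r_zero by (auto simp: R.Y_def zero_set_def)
  next
    assume 0: "?r (h x) = \<zero>\<^bsub>?Q\<^esub>"
    have hx: "h x \<in> carrier ?S" using star_homD(1) [OF h x] .
    show "x \<in> I"
    proof (rule A.closed_if_approximated [OF I_closed x])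
      fix e :: real assume e: "e > 0"
      \<comment> \<open>The approximation takes place in the pullback; the inverse of \<open>h\<close> is contractive and
        carries it back to \<open>A\<close>, where \<open>I\<close> is closed.\<close>
      obtain c where c: "c \<in> h ` I" "nrm ?S (h x \<ominus>\<^bsub>?S\<^esub> c) \<le> e/2"
        using D.ideal_approximation [OF order_refl R.K, of "h x" "e/2"] hx e 0
        unfolding r_zero R.Y_def by auto
      then obtain y where y: "y \<in> I" "c = h y" by blast
      have yA: "y \<in> carrier A" using ideal.Icarr [OF I y(1)] .
      have "nrm A (?g (h x) \<ominus>\<^bsub>A\<^esub> ?g (h y)) \<le> nrm ?S (h x \<ominus>\<^bsub>?S\<^esub> h y)"
        using hx star_homD(1) [OF h yA] by (intro star_hom_dist [OF S A g])
      then show "\<exists>y\<in>I. nrm A (x \<ominus>\<^bsub>A\<^esub> y) < e"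
        using c(2) y yA x e by (intro bexI [of _ y]) (auto simp: gh)
    qed
  qed
  have lift: "\<exists>x\<in>carrier A. ?r (h x) = q \<and> nrm A x \<le> nrm ?Q q" if q: "q \<in> carrier ?Q" for q
  proof -
    obtain a where a: "a \<in> carrier ?S" "?r a = q" "nrm ?S a \<le> nrm ?Q q"
      using R.restr_stage [OF order_refl] q by auto
    have "nrm A (?g a) \<le> nrm ?S a" by (rule star_hom_contractive [OF S A g a(1)])
    then show ?thesis using a hg [OF a(1)] star_homD(1) [OF g a(1)] by (intro bexI [of _ "?g a"]) auto
  qed
  note quot = cstar_quotient_by_kernel [OF A Q \<phi> I ker lift]
  show ?thesis
  proof (intro exI [of _ ?E] conjI)
    show "rsh_decomposition (cstar_quotient A I) ?E"
      unfolding rsh_decomposition_def using quot R.E_valid by simp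
    have "covering_dim (base ?E k) \<le> topological_dim D" if k: "k \<le> len D" for k
    proof -
      have "covering_dim (base ?E k) \<le> covering_dim (base D k)"
        using covering_dim_closed_subspace [OF R.Y_closed [OF k]] by simp
      also have "\<dots> \<le> topological_dim D" unfolding topological_dim_def using k by (intro Max_ge) auto
      finally show ?thesis .
    qed
    then show "topological_dim ?E \<le> topological_dim D"
      unfolding topological_dim_def [of ?E] by (intro Max.boundedI) auto
    show "max_matrix_size ?E \<le> max_matrix_size D" by (simp add: max_matrix_size_def)
  qed
qed

end
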